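(* Let $\omega>0$ and $\kappa>0$, let $r>0$ be defined by $\tanh r=e^{-\pi\omega/\kappa}$, and set $z=\tanh^2 r$. Let $\mathcal N$ be the qubit black hole channel in the perfectly reflecting case, i.e. $\mathcal N(\rho)=\mathrm{Tr}_{E_1E_2}\big[(V\otimes V)\rho(V\otimes V)^\dagger\big]$ for states $\rho$ on the dual-rail qubit space spanned by $|0\rangle_{A_1}|1\rangle_{A_2}$ and $|1\rangle_{A_1}|0\rangle_{A_2}$, where each copy of the isometry $V$ maps mode $A_j$ to modes $B_jE_j$ by $$V|n\rangle_A=\frac{1}{\cosh^{1+n} r}\sum_{m=0}^{\infty}\binom{n+m}{n}^{1/2}\tanh^m r\;|n+m\rangle_B|m\rangle_E .$$ Then the quantum capacity of $\mathcal N$ is $$Q(\mathcal N)=\frac{(1-z)^3}{2}\sum_{\ell=1}^{\infty}\ell(\ell+1)z^{\ell-1}\log_2\frac{\ell+1}{\ell},$$ and in particular $Q(\mathcal N)>0$.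
   Context: $A_1,A_2,B_1,B_2,E_1,E_2$ are bosonic modes, each with Hilbert space having orthonormal Fock basis $\{|n\rangle\}_{n\ge 0}$. The quantum capacity of a quantum channel (completely positive trace-preserving map) $\mathcal N$ is $Q(\mathcal N)=\lim_{n\to\infty}\frac1n Q^{(1)}(\mathcal N^{\otimes n})$, where $Q^{(1)}(\mathcal N)=\max_{\phi_{RA}}[H(B)_\sigma-H(E)_\sigma]$ is the optimized coherent information. Here the maximum is over pure states $\phi_{RA}$ on the channel input $A$ and a reference $R$, $\sigma_{RBE}=(\mathrm{id}_R\otimes U_{\mathcal N})(\phi_{RA})$ with $U_{\mathcal N}:A\to BE$ an isometric extension (Stinespring dilation) of $\mathcal N$, and $H$ is the von Neumann entropy with base-2 logarithm. $\omega$ is the mode frequency and $\kappa$ is the surface gravity of the black hole. *)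

theory Defs
  imports
    "HOL-Analysis.Analysis"
    "HOL-Library.Function_Algebras"
begin

text \<open>
  A separable Hilbert space with a fixed orthonormal basis indexed by a set \<open>I\<close> is \<open>\<ell>\<^sup>2(I)\<close>.
  Operators are given by their matrices in the fixed bases: \<open>M i j\<close> is the entry
  \<open>\<langle>i|M|j\<rangle>\<close>.  A tensor product has the product of the index sets as its index set, and an
  \<open>n\<close>-fold tensor power has the words of length \<open>n\<close>.
\<close>

type_synonym 'i vec = "'i \<Rightarrow> complex"
type_synonym ('i, 'j) opr = "'i \<Rightarrow> 'j \<Rightarrow> complex"
type_synonym ('a, 'b) superop = "('a, 'a) opr \<Rightarrow> ('b, 'b) opr"

definition ell2 :: "'i set \<Rightarrow> 'i vec set" where
  "ell2 I = {v. (\<forall>i. i \<notin> I \<longrightarrow> v i = 0) \<and> (\<lambda>i. (cmod (v i))\<^sup>2) summable_on I}"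

definition pure_state :: "'i set \<Rightarrow> 'i vec \<Rightarrow> bool" where
  "pure_state I v \<longleftrightarrow> v \<in> ell2 I \<and> ((\<lambda>i. (cmod (v i))\<^sup>2) has_sum 1) I"

definition projector :: "'i vec \<Rightarrow> ('i, 'i) opr" where
  "projector v = (\<lambda>i j. v i * cnj (v j))"

definition ptrace_left :: "'i set \<Rightarrow> ('i \<times> 'j, 'i \<times> 'j) opr \<Rightarrow> ('j, 'j) opr" where
  "ptrace_left I M = (\<lambda>j j'. \<Sum>\<^sub>\<infinity>i\<in>I. M (i, j) (i, j'))"

definition ptrace_right :: "'j set \<Rightarrow> ('i \<times> 'j, 'i \<times> 'j) opr \<Rightarrow> ('i, 'i) opr" where
  "ptrace_right J M = (\<lambda>i i'. \<Sum>\<^sub>\<infinity>j\<in>J. M (i, j) (i', j))"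

subsection \<open>Von Neumann entropy\<close>

definition eigenspace :: "'i set \<Rightarrow> ('i, 'i) opr \<Rightarrow> complex \<Rightarrow> 'i vec set" where
  "eigenspace I M c = {v \<in> ell2 I. \<forall>i\<in>I. (\<Sum>\<^sub>\<infinity>j\<in>I. M i j * v j) = c * v i}"

definition multiplicity :: "'i set \<Rightarrow> ('i, 'i) opr \<Rightarrow> complex \<Rightarrow> nat" where
  "multiplicity I M c = vector_space.dim (\<lambda>(a::complex) v i. a * v i) (eigenspace I M c)"

text \<open>
  \<open>H(\<rho>) = - Tr (\<rho> log\<^sub>2 \<rho>)\<close> as the sum of \<open>- \<lambda> log\<^sub>2 \<lambda>\<close> over the positive eigenvalues of the
  density operator \<open>\<rho>\<close>, counted with multiplicity.  Eigenspaces of a trace-class operator for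
  nonzero eigenvalues are finite-dimensional, and numbers that are not eigenvalues
  contribute 0.  The value may be \<open>\<infinity>\<close>.
\<close>

definition vn_entropy :: "'i set \<Rightarrow> ('i, 'i) opr \<Rightarrow> ereal" where
  "vn_entropy I \<rho> =
     (\<Sum>\<^sub>\<infinity>p\<in>{0<..}. ereal (real (multiplicity I \<rho> (complex_of_real p)) * (- p * log 2 p)))"

subsection \<open>Channels, isometric extensions and capacity\<close>

text \<open>
  From here on \<open>A\<close> indexes a finite-dimensional input space.  Superoperators are linear maps on all
  operators on the input space, so density operators need not be singled out.
\<close>

definition isometry :: "'a set \<Rightarrow> 'b set \<Rightarrow> ('b, 'a) opr \<Rightarrow> bool" where
  "isometry A B U \<longleftrightarrow>
     (\<forall>a\<in>A. \<forall>a'\<in>A. ((\<lambda>b. cnj (U b a) * U b a') has_sum (if a = a' then 1 else 0)) B)"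

definition conjugate_by :: "'a set \<Rightarrow> ('b, 'a) opr \<Rightarrow> ('a, 'b) superop" where
  "conjugate_by A U \<rho> = (\<lambda>b b'. \<Sum>a\<in>A. \<Sum>a'\<in>A. U b a * \<rho> a a' * cnj (U b' a'))"

definition isometric_extension ::
    "'a set \<Rightarrow> 'b set \<Rightarrow> 'e set \<Rightarrow> ('b \<times> 'e, 'a) opr \<Rightarrow> ('a, 'b) superop \<Rightarrow> bool" where
  "isometric_extension A B E U N \<longleftrightarrow>
     isometry A (B \<times> E) U \<and>
     (\<forall>\<rho>. \<forall>b\<in>B. \<forall>b'\<in>B. N \<rho> b b' = ptrace_right E (conjugate_by A U \<rho>) b b')"

text \<open>
  Reference \<open>R\<close> and environment \<open>E\<close> are both taken to be \<open>\<ell>\<^sup>2(\<nat>)\<close>.  Every separable Hilbert space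
  embeds isometrically into it.
\<close>

definition apply_to_input ::
    "'a set \<Rightarrow> ('b \<times> nat, 'a) opr \<Rightarrow> (nat \<times> 'a) vec \<Rightarrow> (nat \<times> ('b \<times> nat)) vec" where
  "apply_to_input A U \<phi> = (\<lambda>(r, be). \<Sum>a\<in>A. U be a * \<phi> (r, a))"

definition coherent_information ::
    "'a set \<Rightarrow> 'b set \<Rightarrow> ('b \<times> nat, 'a) opr \<Rightarrow> (nat \<times> 'a) vec \<Rightarrow> ereal" where
  "coherent_information A B U \<phi> =
     (let \<sigma>BE = ptrace_left UNIV (projector (apply_to_input A U \<phi>))
      in vn_entropy B (ptrace_right UNIV \<sigma>BE) - vn_entropy UNIV (ptrace_left B \<sigma>BE))"

text \<open>
  The isometric extension is unique up to partial isometries on the environment, so the coherent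
  information does not depend on which one is chosen.
\<close>

definition optimized_coherent_information ::
    "'a set \<Rightarrow> 'b set \<Rightarrow> ('a, 'b) superop \<Rightarrow> ereal" where
  "optimized_coherent_information A B N =
     (let U = (SOME U. isometric_extension A B UNIV U N)
      in GREATEST q. \<exists>\<phi>. pure_state (UNIV \<times> A) \<phi> \<and> q = coherent_information A B U \<phi>)"

definition words :: "nat \<Rightarrow> 'i set \<Rightarrow> 'i list set" where
  "words n I = {xs. set xs \<subseteq> I \<and> length xs = n}"

definition matrix_unit :: "'a \<Rightarrow> 'a \<Rightarrow> ('a, 'a) opr" where
  "matrix_unit a a' = (\<lambda>i j. if i = a \<and> j = a' then 1 else 0)"

text \<open>
  The linear extension of
  \<open>|a\<^sub>1\<rangle>\<langle>a'\<^sub>1| \<otimes> \<dots> \<otimes> |a\<^sub>n\<rangle>\<langle>a'\<^sub>n| \<mapsto> N(|a\<^sub>1\<rangle>\<langle>a'\<^sub>1|) \<otimes> \<dots> \<otimes> N(|a\<^sub>n\<rangle>\<langle>a'\<^sub>n|)\<close>.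
\<close>

definition tensor_power ::
    "'a set \<Rightarrow> nat \<Rightarrow> ('a, 'b) superop \<Rightarrow> ('a list, 'b list) superop" where
  "tensor_power A n N \<rho> = (\<lambda>b b'. \<Sum>a\<in>words n A. \<Sum>a'\<in>words n A.
     \<rho> a a' * (\<Prod>i<n. N (matrix_unit (a ! i) (a' ! i)) (b ! i) (b' ! i)))"

definition quantum_capacity :: "'a set \<Rightarrow> 'b set \<Rightarrow> ('a, 'b) superop \<Rightarrow> ereal" where
  "quantum_capacity A B N =
     lim (\<lambda>n. optimized_coherent_information (words n A) (words n B) (tensor_power A n N)
              / ereal (real n))"

subsection \<open>The black hole channel in the perfectly reflecting case\<close>

text \<open>Modes are indexed by their Fock basis \<open>nat\<close>.\<close>

definition hawking_isometry :: "real \<Rightarrow> (nat \<times> nat, nat) opr" where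
  "hawking_isometry r = (\<lambda>(b, e) n.
     if b = n + e
     then complex_of_real (1 / cosh r ^ (1 + n) * sqrt (real ((n + e) choose n)) * tanh r ^ e)
     else 0)"

text \<open>\<open>V \<otimes> V : A\<^sub>1 A\<^sub>2 \<rightarrow> (B\<^sub>1 B\<^sub>2) (E\<^sub>1 E\<^sub>2)\<close>, with the output factors reordered.\<close>

definition hawking_isometry2 :: "real \<Rightarrow> ((nat \<times> nat) \<times> (nat \<times> nat), nat \<times> nat) opr" where
  "hawking_isometry2 r = (\<lambda>((b1, b2), (e1, e2)) (a1, a2).
     hawking_isometry r (b1, e1) a1 * hawking_isometry r (b2, e2) a2)"

definition dual_rail :: "(nat \<times> nat) set" where
  "dual_rail = {(0, 1), (1, 0)}"

definition black_hole_channel :: "real \<Rightarrow> (nat \<times> nat, nat \<times> nat) superop" where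
  "black_hole_channel r \<rho> = ptrace_right UNIV (conjugate_by dual_rail (hawking_isometry2 r) \<rho>)"

end

theory Submission
  imports Defs "HOL-Computational_Algebra.Fundamental_Theorem_Algebra"
begin

text \<open>
  Write \<open>a\<^sub>1, a\<^sub>2\<close> for the annihilation operators of the two output modes.  The isometry maps the input basis
  state \<open>|k\<rangle>\<close> to a multiple of \<open>\<Sum>\<^sub>e tanh\<^bsup>|e|\<^esup> r (a\<^sub>k\<^sup>\<dagger> |e\<rangle>) |e\<rangle>\<close>.  Hence for input \<open>\<rho>\<close> the output is block diagonal
  with respect to the photon number \<open>l\<close>, block \<open>l\<close> being proportional to \<open>X = \<Sum> \<rho>\<^sub>j\<^sub>k a\<^sub>j\<^sup>\<dagger> a\<^sub>k\<close>, while the environment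
  with \<open>l - 1\<close> photons is proportional to the transpose of \<open>X + 1\<close>.  The trace \<open>p\<^sub>l = (1-z)\<^sup>3 z\<^bsup>l-1\<^esup> l(l+1)/2\<close> of a
  block does not depend on \<open>\<rho>\<close>.

  The transposed environment block is the image of the output block under a channel \<open>D\<close> with
  \<open>D(1) = ((l+1)/l) 1\<close>.  Comparing spectra through \<open>D\<close> gives a scaled doubly stochastic matrix, so Jensen's
  inequality bounds the entropy difference of the blocks by \<open>p\<^sub>l log ((l+1)/l)\<close>.  The argument uses only these two
  properties of \<open>D\<close>, which tensor powers inherit, so it applies verbatim to several copies, and equality holds
  for the maximally mixed input: the coherent information is additive.  That the
  environment entropy does not depend on the chosen isometric extension follows from the Schmidt
  decomposition across environment versus reference and output.
\<close>

subsection \<open>Diagonalisation of Hermitian matrices\<close>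

text \<open>Why \<open>D\<close> has two summands: for an input of trace 1 the commutation relations
  give \<open>\<Sum> a_k X a_k\<dagger> = (l + 2) X' + 1\<close>, where X' is the expression X on l
  - 1 photons. Lowering alone therefore misses (l + 2) (X' + 1) by (l + 1) times the identity. Since
  X has trace l (l + 1) / 2 on block l, the missing term is (2 / l) Tr(X) 1, a completely
  depolarizing map. The scalar (l + 1) / l is then forced: \<open>D\<close> preserves the trace
  between blocks of dimensions l + 1 and l. The obstacle is infinite dimension. Entropy is an
  unordered sum over eigenvalues with multiplicity, and a difference of two entropies means
  something only if both are finite. Photon number cuts both states into finite matrices, so the
  finite spectral theorem is enough. An eigenvalue is at most the trace of its block, the square
  roots of these traces decay geometrically, and -p log p is at most a constant times sqrt p. This
  makes all the sums converge absolutely, so they may be regrouped by blocks and compared block by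
  block.\<close>

lemma homogeneous_system_nontrivial_solution:
  fixes f :: "'j \<Rightarrow> 'i \<Rightarrow> complex"
  assumes "finite F" "finite J" "card F < card J"
  shows "\<exists>a. (\<exists>j\<in>J. a j \<noteq> 0) \<and> (\<forall>x\<in>F. (\<Sum>j\<in>J. a j * f j x) = 0)"
  using assms
proof (induction F arbitrary: J f rule: finite_induct)
  case empty
  then obtain j where "j \<in> J" by (metis card.empty card_gt_0_iff ex_in_conv)
  then show ?case by (intro exI[of _ "\<lambda>_. 1"]) auto
next
  case (insert x F)
  show ?case
  proof (cases "\<forall>j\<in>J. f j x = 0")
    case True
    have "card F < card J" using insert by simp
    from insert.IH[OF insert(4) this, of f] obtain a
      where "\<exists>j\<in>J. a j \<noteq> 0" "\<forall>y\<in>F. (\<Sum>j\<in>J. a j * f j y) = 0"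
      by blast
    with True show ?thesis by (intro exI[of _ a]) auto
  next
    case False
    then obtain k where k: "k \<in> J" "f k x \<noteq> 0" by blast
    have "card F < card (J - {k})" using insert k by simp
    \<comment> \<open>Gaussian elimination: equation \<open>x\<close> is solved for the unknown
      \<open>k\<close> and substituted into the remaining equations.\<close>
    from insert.IH[OF _ this, of "\<lambda>j y. f j y - f j x / f k x * f k y"] insert(4) obtain a
      where a: "\<exists>j\<in>J-{k}. a j \<noteq> 0"
        "\<forall>y\<in>F. (\<Sum>j\<in>J-{k}. a j * (f j y - f j x / f k x * f k y)) = 0"
      by auto
    define b where "b = a(k := - (\<Sum>j\<in>J-{k}. a j * f j x) / f k x)"
    have split: "(\<Sum>j\<in>J. b j * f j y) = b k * f k y + (\<Sum>j\<in>J-{k}. a j * f j y)" for y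
      using k insert(4) by (subst sum.remove[of _ k]) (auto simp: b_def intro!: sum.cong)
    have "(\<Sum>j\<in>J. b j * f j y) = 0" if "y \<in> insert x F" for y
    proof (cases "y = x")
      case True
      then show ?thesis using k by (simp add: split) (simp add: b_def)
    next
      case False
      have "(\<Sum>j\<in>J-{k}. a j * (f j y - f j x / f k x * f k y)) =
        (\<Sum>j\<in>J-{k}. a j * f j y) - (\<Sum>j\<in>J-{k}. a j * f j x) / f k x * f k y"
        by (simp add: right_diff_distrib sum_subtractf sum_distrib_right sum_divide_distrib mult.assoc)
      with a(2) False that show ?thesis by (simp add: split) (simp add: b_def)
    qed
    moreover have "\<exists>j\<in>J. b j \<noteq> 0" using a(1) by (auto simp: b_def)
    ultimately show ?thesis by blast
  qed
qed

text \<open>Iterates of \<open>v\<close> become linearly dependent, so some nonzero polynomial in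
  \<open>T\<close> kills \<open>v\<close>. One of minimal degree has a complex root
  \<open>c\<close>; dividing out the linear factor leaves a vector that is nonzero by minimality and
  is mapped by \<open>T\<close> to \<open>c\<close> times itself. \<open>V\<close> is any invariant
  set closed under finite combinations, so that it can be an orthogonal complement.\<close>

lemma ex_eigenvector:
  fixes T :: "'i vec \<Rightarrow> 'i vec"
  assumes F: "finite F" and supp: "\<And>v x. v \<in> V \<Longrightarrow> x \<notin> F \<Longrightarrow> v x = 0"
    and V: "\<And>(A::nat set) c g. finite A \<Longrightarrow> (\<And>i. i \<in> A \<Longrightarrow> g i \<in> V) \<Longrightarrow> (\<lambda>x. \<Sum>i\<in>A. c i * g i x) \<in> V"
    and T: "\<And>(A::nat set) c g. finite A \<Longrightarrow> T (\<lambda>x. \<Sum>i\<in>A. c i * g i x) = (\<lambda>x. \<Sum>i\<in>A. c i * T (g i) x)"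
    and TV: "\<And>v. v \<in> V \<Longrightarrow> T v \<in> V"
    and v: "v \<in> V" "v \<noteq> 0"
  shows "\<exists>w\<in>V. w \<noteq> 0 \<and> (\<exists>c. T w = (\<lambda>x. c * w x))"
proof -
  define ap where "ap p = (\<lambda>x. \<Sum>i\<le>degree p. coeff p i * (T ^^ i) v x)" for p
  have ap_le: "ap p = (\<lambda>x. \<Sum>i\<le>n. coeff p i * (T ^^ i) v x)" if "degree p \<le> n" for p n
    unfolding ap_def using that by (intro ext sum.mono_neutral_left) (auto simp: coeff_eq_0)
  have TVi: "(T ^^ i) v \<in> V" for i by (induction i) (auto simp: v TV)
  have ap_in: "ap p \<in> V" for p unfolding ap_def by (rule V) (auto simp: TVi)
  have ap_mult: "ap ([:-c, 1:] * q) = (\<lambda>x. T (ap q) x - c * ap q x)" for c q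
  proof (rule ext)
    fix x
    have d: "degree ([:-c, 1:] * q) \<le> Suc (degree q)"
      using degree_mult_le[of "[:-c, 1:]" q] by simp
    have "ap ([:-c, 1:] * q) x = (\<Sum>i\<le>Suc (degree q). coeff ([:-c, 1:] * q) i * (T ^^ i) v x)"
      by (simp only: ap_le[OF d])
    also have "\<dots> = (\<Sum>i\<le>Suc (degree q). coeff (pCons 0 q) i * (T ^^ i) v x)
        - c * (\<Sum>i\<le>Suc (degree q). coeff q i * (T ^^ i) v x)"
      unfolding sum_distrib_left sum_subtractf[symmetric]
      by (intro sum.cong) (auto simp: algebra_simps)
    also have "(\<Sum>i\<le>Suc (degree q). coeff q i * (T ^^ i) v x) = ap q x"
      by (subst ap_le[of q "Suc (degree q)"]) auto
    also have "(\<Sum>i\<le>Suc (degree q). coeff (pCons 0 q) i * (T ^^ i) v x) = T (ap q) x"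
      unfolding ap_def by (subst sum.atMost_Suc_shift) (simp add: T)
    finally show "ap ([:-c, 1:] * q) x = T (ap q) x - c * ap q x" .
  qed
  have "\<exists>p. p \<noteq> 0 \<and> ap p = 0"
  proof -
    \<comment> \<open>One vector more than there are coordinates.\<close>
    obtain a where a: "\<exists>j\<in>{..card F}. a j \<noteq> 0" "\<forall>x\<in>F. (\<Sum>j\<in>{..card F}. a j * (T ^^ j) v x) = 0"
      using homogeneous_system_nontrivial_solution[of F "{..card F}" "\<lambda>j. (T ^^ j) v"] F by auto
    define p where "p = (\<Sum>j\<le>card F. monom (a j) j)"
    have c: "coeff p j = (if j \<le> card F then a j else 0)" for j
      unfolding p_def coeff_sum by (simp add: if_distrib cong: if_cong)
    have "degree p \<le> card F" by (rule degree_le) (auto simp: c)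
    from ap_le[OF this] have "ap p x = 0" for x
      using a(2) supp[OF TVi, of x] by (cases "x \<in> F") (auto simp: c)
    moreover have "p \<noteq> 0" using a(1) c by (metis atMost_iff coeff_0)
    ultimately show ?thesis by (auto simp: fun_eq_iff)
  qed
  then obtain p where p: "p \<noteq> 0" "ap p = 0"
    and minimal: "\<And>q. q \<noteq> 0 \<Longrightarrow> ap q = 0 \<Longrightarrow> degree p \<le> degree q"
    using ex_has_least_nat[of "\<lambda>p. p \<noteq> 0 \<and> ap p = 0" _ degree] by blast
  have "degree p \<noteq> 0"
  proof
    assume "degree p = 0"
    then obtain a where "p = [:a:]" by (rule degree_eq_zeroE)
    then have "a * v x = 0" for x using p(2) by (auto simp: ap_def fun_eq_iff)
    moreover have "a \<noteq> 0" using p(1) \<open>p = [:a:]\<close> by simp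
    ultimately show False using v(2) by (auto simp: fun_eq_iff)
  qed
  then obtain c where "poly p c = 0"
    using fundamental_theorem_of_algebra constant_degree by metis
  then obtain q where q: "p = [:-c, 1:] * q" by (auto simp: poly_eq_0_iff_dvd)
  have "q \<noteq> 0" using p(1) q by auto
  have "degree p = Suc (degree q)" using \<open>q \<noteq> 0\<close> unfolding q by (subst degree_mult_eq) auto
  then have "ap q \<noteq> 0" using minimal[of q] \<open>q \<noteq> 0\<close> by auto
  moreover have "T (ap q) = (\<lambda>x. c * ap q x)"
    using p(2) unfolding q ap_mult by (auto simp: fun_eq_iff)
  ultimately show ?thesis using ap_in by blast
qed

text \<open>The vector \<open>w i\<close> is the projection of the \<open>i\<close>-th unit vector
  onto the orthogonal complement of the \<open>u k\<close>. The squared norms add up to the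
  codimension. This single count serves twice: too few vectors leave a nonzero vector in the
  complement, and \<open>card F\<close> vectors force completeness.\<close>

lemma orthonormal_defect:
  fixes u :: "'k \<Rightarrow> 'i vec"
  assumes "finite F" "finite S"
    and on: "\<And>k l. k \<in> S \<Longrightarrow> l \<in> S \<Longrightarrow> (\<Sum>i\<in>F. cnj (u k i) * u l i) = (if k = l then 1 else 0)"
  defines "w \<equiv> \<lambda>i j. (if i = j then 1 else 0) - (\<Sum>k\<in>S. u k j * cnj (u k i))"
  shows "(\<Sum>i\<in>F. \<Sum>j\<in>F. (cmod (w i j))\<^sup>2) = real (card F) - real (card S)"
    and "\<And>k i. k \<in> S \<Longrightarrow> i \<in> F \<Longrightarrow> (\<Sum>j\<in>F. cnj (u k j) * w i j) = 0"
proof -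
  show orth: "(\<Sum>j\<in>F. cnj (u k j) * w i j) = 0" if "k \<in> S" "i \<in> F" for k i
  proof -
    have "(\<Sum>j\<in>F. cnj (u k j) * w i j) = (\<Sum>j\<in>F. if i = j then cnj (u k j) else 0)
        - (\<Sum>j\<in>F. \<Sum>l\<in>S. cnj (u l i) * (cnj (u k j) * u l j))"
      unfolding w_def sum_subtractf[symmetric] right_diff_distrib sum_distrib_left
      by (intro sum.cong arg_cong2[of _ _ _ _ "(-)"]) (auto simp: mult_ac)
    also have "\<dots> = cnj (u k i) - (\<Sum>l\<in>S. cnj (u l i) * (\<Sum>j\<in>F. cnj (u k j) * u l j))"
      using assms(1) that by (subst sum.swap) (simp add: sum_distrib_left)
    also have "\<dots> = 0" using that assms(2) by (simp add: on if_distrib cong: if_cong)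
    finally show ?thesis .
  qed
  have "(\<Sum>i\<in>F. \<Sum>j\<in>F. cnj (w i j) * w i j) = of_nat (card F) - of_nat (card S)"
  proof -
    have "(\<Sum>j\<in>F. cnj (w i j) * w i j) = 1 - (\<Sum>k\<in>S. cnj (u k i) * u k i)" if i: "i \<in> F" for i
    proof -
      have "(\<Sum>j\<in>F. cnj (w i j) * w i j) = (\<Sum>j\<in>F. (if i = j then w i j else 0))
          - (\<Sum>j\<in>F. \<Sum>k\<in>S. u k i * (cnj (u k j) * w i j))"
      proof -
        have "cnj (w i j) = (if i = j then 1 else 0) - (\<Sum>k\<in>S. u k i * cnj (u k j))" for j
          by (simp add: w_def mult.commute)
        then show ?thesis
          by (simp add: left_diff_distrib sum_subtractf sum_distrib_right mult.assoc
              if_distrib[of "\<lambda>x. x * _"] cong: if_cong del: if_distrib_fun)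
      qed
      also have "(\<Sum>j\<in>F. \<Sum>k\<in>S. u k i * (cnj (u k j) * w i j)) = 0"
        by (subst sum.swap) (simp add: sum_distrib_left[symmetric] orth i)
      finally show ?thesis using i assms(1) by (simp add: w_def mult.commute)
    qed
    then have "(\<Sum>i\<in>F. \<Sum>j\<in>F. cnj (w i j) * w i j)
        = of_nat (card F) - (\<Sum>i\<in>F. \<Sum>k\<in>S. cnj (u k i) * u k i)"
      by (simp add: sum_subtractf)
    also have "(\<Sum>i\<in>F. \<Sum>k\<in>S. cnj (u k i) * u k i) = of_nat (card S)"
      by (subst sum.swap) (simp add: on)
    finally show ?thesis .
  qed
  moreover have "(\<Sum>i\<in>F. \<Sum>j\<in>F. cnj (w i j) * w i j)
      = of_real (\<Sum>i\<in>F. \<Sum>j\<in>F. (cmod (w i j))\<^sup>2)"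
    by (simp only: of_real_sum complex_norm_square mult.commute)
  ultimately have "complex_of_real (\<Sum>i\<in>F. \<Sum>j\<in>F. (cmod (w i j))\<^sup>2)
      = of_real (real (card F) - real (card S))" by simp
  then show "(\<Sum>i\<in>F. \<Sum>j\<in>F. (cmod (w i j))\<^sup>2) = real (card F) - real (card S)"
    using of_real_eq_iff by blast
qed

text \<open>Induction on \<open>S\<close>: the complement of the eigenvectors found so far is
  invariant because \<open>M\<close> is Hermitian, and it is nonzero by the defect count, so it
  contains a further eigenvector. Taking \<open>S\<close> inside \<open>F\<close> indexes the final
  eigenbasis by \<open>F\<close> itself.\<close>

lemma hermitian_orthonormal_eigenvectors:
  fixes M :: "('i, 'i) opr"
  assumes F: "finite F" and herm: "\<And>i j. i \<in> F \<Longrightarrow> j \<in> F \<Longrightarrow> M j i = cnj (M i j)" and "S \<subseteq> F"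
  shows "\<exists>u lam. (\<forall>k\<in>S. \<forall>l\<in>S. (\<Sum>i\<in>F. cnj (u k i) * u l i) = (if k = l then 1 else 0)) \<and>
    (\<forall>k\<in>S. \<forall>i\<in>F. (\<Sum>j\<in>F. M i j * u k j) = complex_of_real (lam k) * u k i)"
  using finite_subset[OF \<open>S \<subseteq> F\<close> F] \<open>S \<subseteq> F\<close>
proof (induction S rule: finite_induct)
  case empty
  then show ?case by simp
next
  case (insert s S)
  then have "S \<subseteq> F" by blast
  from insert.IH[OF this] obtain u lam where
    "\<forall>k\<in>S. \<forall>l\<in>S. (\<Sum>i\<in>F. cnj (u k i) * u l i) = (if k = l then 1 else 0)"
    "\<forall>k\<in>S. \<forall>i\<in>F. (\<Sum>j\<in>F. M i j * u k j) = complex_of_real (lam k) * u k i"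
    by blast
  then have
    on: "\<And>k l. k \<in> S \<Longrightarrow> l \<in> S \<Longrightarrow> (\<Sum>i\<in>F. cnj (u k i) * u l i) = (if k = l then 1 else 0)" and
    ev: "\<And>k i. k \<in> S \<Longrightarrow> i \<in> F \<Longrightarrow> (\<Sum>j\<in>F. M i j * u k j) = complex_of_real (lam k) * u k i"
    by auto
  define V where "V = {v. (\<forall>x. x \<notin> F \<longrightarrow> v x = 0) \<and> (\<forall>k\<in>S. (\<Sum>i\<in>F. cnj (u k i) * v i) = 0)}"
  define T where "T v = (\<lambda>i. if i \<in> F then \<Sum>j\<in>F. M i j * v j else 0)" for v :: "'i vec"
  have adj: "(\<Sum>i\<in>F. cnj (v i) * T w i) = (\<Sum>i\<in>F. cnj (T v i) * w i)" for v w
  proof -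
    have "(\<Sum>i\<in>F. cnj (v i) * T w i) = (\<Sum>i\<in>F. \<Sum>j\<in>F. cnj (v i) * M i j * w j)"
      by (simp add: T_def sum_distrib_left mult_ac)
    also have "\<dots> = (\<Sum>i\<in>F. \<Sum>j\<in>F. cnj (M j i * v i) * w j)"
      by (intro sum.cong refl) (simp add: herm[symmetric] mult_ac)
    also have "\<dots> = (\<Sum>i\<in>F. cnj (T v i) * w i)"
      by (subst sum.swap) (simp add: T_def sum_distrib_right)
    finally show ?thesis .
  qed
  have Tu: "T (u k) i = of_real (lam k) * u k i" if "k \<in> S" "i \<in> F" for k i
    using ev that by (simp add: T_def)
  have "\<exists>v\<in>V. v \<noteq> 0"
  proof -
    let ?w = "\<lambda>i j. (if i = j then 1 else 0) - (\<Sum>k\<in>S. u k j * cnj (u k i))"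
    have "card S < card F"
      using insert F by (metis card_mono card_insert_disjoint Suc_le_lessD)
    then have "(\<Sum>i\<in>F. \<Sum>j\<in>F. (cmod (?w i j))\<^sup>2) > 0"
      using orthonormal_defect(1)[OF F insert(1) on] by simp
    then obtain i where i: "i \<in> F" "(\<Sum>j\<in>F. (cmod (?w i j))\<^sup>2) \<noteq> 0"
      by (metis (no_types, lifting) less_irrefl sum.neutral)
    then obtain j where j: "j \<in> F" "?w i j \<noteq> 0"
      by (metis (no_types, lifting) norm_zero power_zero_numeral sum.neutral)
    let ?v = "\<lambda>j. if j \<in> F then ?w i j else 0"
    have "(\<Sum>j\<in>F. cnj (u k j) * ?v j) = (\<Sum>j\<in>F. cnj (u k j) * ?w i j)" for k
      by (intro sum.cong) auto
    then have "?v \<in> V"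
      using orthonormal_defect(2)[OF F insert(1) on _ i(1)] by (simp add: V_def)
    moreover have "?v \<noteq> 0" using fun_cong[of ?v 0 j] j by auto
    ultimately show ?thesis by blast
  qed
  then obtain v0 where v0: "v0 \<in> V" "v0 \<noteq> 0" by blast
  have "\<exists>w\<in>V. w \<noteq> 0 \<and> (\<exists>c. T w = (\<lambda>x. c * w x))"
  proof (rule ex_eigenvector[where F = F and V = V and T = T and v = v0])
    fix A :: "nat set" and c :: "nat \<Rightarrow> complex" and g :: "nat \<Rightarrow> 'i vec"
    assume A: "finite A"
    show "T (\<lambda>x. \<Sum>i\<in>A. c i * g i x) = (\<lambda>x. \<Sum>i\<in>A. c i * T (g i) x)"
    proof
      fix x
      show "T (\<lambda>x. \<Sum>i\<in>A. c i * g i x) x = (\<Sum>i\<in>A. c i * T (g i) x)"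
        unfolding T_def by (auto simp: sum_distrib_left mult_ac sum.swap[of _ A F])
    qed
    assume g: "\<And>i. i \<in> A \<Longrightarrow> g i \<in> V"
    have "(\<Sum>i\<in>F. cnj (u k i) * (\<Sum>n\<in>A. c n * g n i)) = (\<Sum>n\<in>A. c n * (\<Sum>i\<in>F. cnj (u k i) * g n i))" for k
      by (auto simp: sum_distrib_left mult_ac sum.swap[of _ A F])
    then show "(\<lambda>x. \<Sum>i\<in>A. c i * g i x) \<in> V"
      using g by (auto simp: V_def)
  next
    fix v assume v: "v \<in> V"
    have "(\<Sum>i\<in>F. cnj (u k i) * T v i) = 0" if "k \<in> S" for k
    proof -
      have "(\<Sum>i\<in>F. cnj (u k i) * T v i) = (\<Sum>i\<in>F. of_real (lam k) * (cnj (u k i) * v i))"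
        unfolding adj using that by (intro sum.cong) (auto simp: Tu)
      also have "\<dots> = 0" using v that by (simp add: V_def sum_distrib_left[symmetric])
      finally show ?thesis .
    qed
    then show "T v \<in> V" by (auto simp: V_def T_def)
  qed (use F v0 in \<open>auto simp: V_def\<close>)
  then obtain w c where w: "w \<in> V" "w \<noteq> 0" and c: "\<And>x. T w x = c * w x" by (metis (no_types))
  define N where "N = (\<Sum>i\<in>F. (cmod (w i))\<^sup>2)"
  have N: "(\<Sum>i\<in>F. cnj (w i) * w i) = of_real N"
    unfolding N_def of_real_sum by (intro sum.cong refl) (simp only: complex_norm_square mult.commute)
  obtain x where "w x \<noteq> 0" using w(2) by (auto simp: fun_eq_iff)
  moreover from this have "x \<in> F" using w(1) by (auto simp: V_def)
  ultimately have "N > 0" unfolding N_def by (intro sum_pos2[OF F, of x]) auto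
  have "c * of_real N = cnj c * of_real N"
    using adj[of w w] by (simp add: c N[symmetric] sum_distrib_left mult_ac)
  then have "c = cnj c" using \<open>N > 0\<close> by simp
  then have c_real: "c = of_real (Re c)" by (simp add: complex_eq_iff)
  define v where "v = (\<lambda>i. w i / of_real (sqrt N))"
  have vv: "(\<Sum>i\<in>F. cnj (v i) * v i) = 1"
  proof -
    have "(\<Sum>i\<in>F. cnj (v i) * v i) = (\<Sum>i\<in>F. cnj (w i) * w i) / (of_real (sqrt N) * of_real (sqrt N))"
      unfolding v_def sum_divide_distrib by simp
    also have "\<dots> = 1" unfolding N of_real_mult[symmetric] using \<open>N > 0\<close> by simp
    finally show ?thesis .
  qed
  have uv: "(\<Sum>i\<in>F. cnj (u k i) * v i) = 0" if "k \<in> S" for k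
    using w(1) that unfolding v_def V_def by (simp add: sum_divide_distrib[symmetric])
  then have vu: "(\<Sum>i\<in>F. cnj (v i) * u k i) = 0" if "k \<in> S" for k
  proof -
    have "(\<Sum>i\<in>F. cnj (v i) * u k i) = cnj (\<Sum>i\<in>F. cnj (u k i) * v i)"
      by (simp add: mult.commute)
    then show ?thesis using uv that by simp
  qed
  have evv: "(\<Sum>j\<in>F. M i j * v j) = of_real (Re c) * v i" if "i \<in> F" for i
    using c[of i] that c_real unfolding T_def v_def by (simp add: sum_divide_distrib[symmetric])
  show ?case
    using insert(2) on ev uv vu vv evv
    by (intro exI[of _ "u(s := v)"] exI[of _ "lam(s := Re c)"]) auto
qed

theorem hermitian_spectral_decomposition:
  fixes M :: "('i, 'i) opr"
  assumes F: "finite F" and herm: "\<And>i j. i \<in> F \<Longrightarrow> j \<in> F \<Longrightarrow> M j i = cnj (M i j)"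
  obtains u :: "'i \<Rightarrow> 'i vec" and lam :: "'i \<Rightarrow> real" where
    "\<And>k l. k \<in> F \<Longrightarrow> l \<in> F \<Longrightarrow> (\<Sum>i\<in>F. cnj (u k i) * u l i) = (if k = l then 1 else 0)"
    "\<And>i j. i \<in> F \<Longrightarrow> j \<in> F \<Longrightarrow> (\<Sum>k\<in>F. u k i * cnj (u k j)) = (if i = j then 1 else 0)"
    "\<And>i j. i \<in> F \<Longrightarrow> j \<in> F \<Longrightarrow> M i j = (\<Sum>k\<in>F. of_real (lam k) * u k i * cnj (u k j))"
proof -
  obtain u lam where
    "\<forall>k\<in>F. \<forall>l\<in>F. (\<Sum>i\<in>F. cnj (u k i) * u l i) = (if k = l then 1 else 0)"
    "\<forall>k\<in>F. \<forall>i\<in>F. (\<Sum>j\<in>F. M i j * u k j) = complex_of_real (lam k) * u k i"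
    using hermitian_orthonormal_eigenvectors[of F M F] F herm by blast
  then have
    on: "\<And>k l. k \<in> F \<Longrightarrow> l \<in> F \<Longrightarrow> (\<Sum>i\<in>F. cnj (u k i) * u l i) = (if k = l then 1 else 0)" and
    ev: "\<And>k i. k \<in> F \<Longrightarrow> i \<in> F \<Longrightarrow> (\<Sum>j\<in>F. M i j * u k j) = complex_of_real (lam k) * u k i"
    by auto
  have complete: "(\<Sum>k\<in>F. u k i * cnj (u k j)) = (if i = j then 1 else 0)" if "i \<in> F" "j \<in> F" for i j
  proof -
    let ?w = "\<lambda>i j. (if i = j then 1 else 0) - (\<Sum>k\<in>F. u k j * cnj (u k i))"
    have "(\<Sum>i\<in>F. \<Sum>j\<in>F. (cmod (?w i j))\<^sup>2) = 0"
      using orthonormal_defect(1)[OF F F on] by simp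
    then have "(cmod (?w j i))\<^sup>2 = 0"
      using that F by (simp add: sum_nonneg_eq_0_iff sum_nonneg)
    then show ?thesis by (auto split: if_splits)
  qed
  have "M i j = (\<Sum>k\<in>F. of_real (lam k) * u k i * cnj (u k j))" if "i \<in> F" "j \<in> F" for i j
  proof -
    have "(\<Sum>k\<in>F. of_real (lam k) * u k i * cnj (u k j)) = (\<Sum>k\<in>F. \<Sum>l\<in>F. M i l * (u k l * cnj (u k j)))"
      using that by (intro sum.cong refl) (simp add: ev[symmetric] sum_distrib_left sum_distrib_right mult_ac)
    also have "\<dots> = (\<Sum>l\<in>F. M i l * (\<Sum>k\<in>F. u k l * cnj (u k j)))"
      by (subst sum.swap) (simp add: sum_distrib_left)
    also have "\<dots> = M i j" using that F by (simp add: complete if_distrib cong: if_cong)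
    finally show ?thesis by simp
  qed
  with on complete show thesis by (rule that)
qed

section \<open>Complex functions as a vector space, for dimensions of eigenspaces\<close>

interpretation cfun: vector_space "\<lambda>(a::complex) (v::'i \<Rightarrow> complex) i. a * v i"
  by unfold_locales (auto simp: fun_eq_iff algebra_simps)

interpretation cfun_pair: vector_space_pair
  "\<lambda>(a::complex) (v::'i \<Rightarrow> complex) i. a * v i" "\<lambda>(a::complex) (v::'j \<Rightarrow> complex) i. a * v i"
  by unfold_locales

lemma sum_fun_apply: "(\<Sum>x\<in>A. f x) i = (\<Sum>x\<in>A. f x i)"
  for f :: "'a \<Rightarrow> 'i \<Rightarrow> 'b::comm_monoid_add"
  by (induction A rule: infinite_finite_induct) auto

subsection \<open>Block-diagonal operators\<close>

text \<open>
  The eigenvectors of each finite block \<open>{i \<in> I. t i = c}\<close> are indexed by the block itself.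
\<close>

definition block_spectral ::
    "'i set \<Rightarrow> ('i \<Rightarrow> 't) \<Rightarrow> ('i, 'i) opr \<Rightarrow> ('i \<Rightarrow> 'i vec) \<Rightarrow> ('i \<Rightarrow> real) \<Rightarrow> bool" where
  "block_spectral I t M u lam \<longleftrightarrow>
    (\<forall>k\<in>I. finite {i\<in>I. t i = t k}) \<and>
    (\<forall>i\<in>I. \<forall>j\<in>I. t i \<noteq> t j \<longrightarrow> M i j = 0) \<and>
    (\<forall>k\<in>I. \<forall>l\<in>I. t k = t l \<longrightarrow>
      (\<Sum>i | i \<in> I \<and> t i = t k. cnj (u k i) * u l i) = (if k = l then 1 else 0)) \<and>
    (\<forall>i\<in>I. \<forall>j\<in>I. t i = t j \<longrightarrow>
      (\<Sum>k | k \<in> I \<and> t k = t i. u k i * cnj (u k j)) = (if i = j then 1 else 0)) \<and>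
    (\<forall>i\<in>I. \<forall>j\<in>I. t i = t j \<longrightarrow>
      M i j = (\<Sum>k | k \<in> I \<and> t k = t i. of_real (lam k) * u k i * cnj (u k j)))"

text \<open>Since every block indexes its own eigenvectors, the decompositions chosen for the labels
  glue together: index \<open>k\<close> is read in the decomposition of its label
  \<open>t k\<close>.\<close>

lemma ex_block_spectral:
  assumes fin: "\<And>k. k \<in> I \<Longrightarrow> finite {i\<in>I. t i = t k}"
    and block: "\<And>i j. i \<in> I \<Longrightarrow> j \<in> I \<Longrightarrow> t i \<noteq> t j \<Longrightarrow> M i j = 0"
    and herm: "\<And>i j. i \<in> I \<Longrightarrow> j \<in> I \<Longrightarrow> M j i = cnj (M i j)"
  shows "\<exists>u lam. block_spectral I t M u lam"
proof -
  define B where "B c = {i\<in>I. t i = c}" for c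
  let ?P = "\<lambda>c u lam. (\<forall>k\<in>B c. \<forall>l\<in>B c. (\<Sum>i\<in>B c. cnj (u k i) * u l i) = (if k = l then 1 else 0)) \<and>
      (\<forall>i\<in>B c. \<forall>j\<in>B c. (\<Sum>k\<in>B c. u k i * cnj (u k j)) = (if i = j then 1 else 0)) \<and>
      (\<forall>i\<in>B c. \<forall>j\<in>B c. M i j = (\<Sum>k\<in>B c. of_real (lam k) * u k i * cnj (u k j)))"
  have "\<exists>u lam. ?P c u lam" if c: "c \<in> t ` I" for c
  proof -
    have "finite (B c)" using c fin by (auto simp: B_def)
    from hermitian_spectral_decomposition[OF this, of M] herm obtain u lam where "?P c u lam"
      unfolding B_def by (smt (verit) mem_Collect_eq)
    then show ?thesis by blast
  qed
  then have "\<forall>c\<in>t ` I. \<exists>ul. ?P c (fst ul) (snd ul)" by auto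
  then obtain ul where "\<forall>c\<in>t ` I. ?P c (fst (ul c)) (snd (ul c))"
    unfolding bchoice_iff by blast
  then obtain u lam where *: "\<And>c. c \<in> t ` I \<Longrightarrow> ?P c (u c) (lam c)"
    using that[of "\<lambda>c. fst (ul c)" "\<lambda>c. snd (ul c)"] by blast
  have "block_spectral I t M (\<lambda>k. u (t k) k) (\<lambda>k. lam (t k) k)"
    unfolding block_spectral_def
  proof (intro conjI ballI impI)
    fix k l assume "k \<in> I" "l \<in> I" "t k = t l"
    with *[of "t k"] show "(\<Sum>i | i \<in> I \<and> t i = t k. cnj (u (t k) k i) * u (t l) l i) = (if k = l then 1 else 0)"
      by (auto simp: B_def)
  next
    fix i j assume ij: "i \<in> I" "j \<in> I" "t i = t j"
    have "(\<Sum>k | k \<in> I \<and> t k = t i. u (t k) k i * cnj (u (t k) k j)) = (\<Sum>k\<in>B (t i). u (t i) k i * cnj (u (t i) k j))"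
      unfolding B_def by (intro sum.cong) auto
    with ij *[of "t i"] show "(\<Sum>k | k \<in> I \<and> t k = t i. u (t k) k i * cnj (u (t k) k j)) = (if i = j then 1 else 0)"
      by (auto simp: B_def)
    have "(\<Sum>k | k \<in> I \<and> t k = t i. of_real (lam (t k) k) * u (t k) k i * cnj (u (t k) k j))
        = (\<Sum>k\<in>B (t i). of_real (lam (t i) k) * u (t i) k i * cnj (u (t i) k j))"
      unfolding B_def by (intro sum.cong) auto
    with ij *[of "t i"] show "M i j = (\<Sum>k | k \<in> I \<and> t k = t i. of_real (lam (t k) k) * u (t k) k i * cnj (u (t k) k j))"
      by (auto simp: B_def)
  qed (use fin block in auto)
  then show ?thesis by blast
qed

text \<open>Turns the dimension of an eigenspace into a count of indices. The coefficient
  \<open>c v k\<close> is the inner product of \<open>u k\<close> with \<open>v\<close>; comparing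
  coefficients in the eigenvalue equation kills those with \<open>lam k \<noteq> p\<close>, so the
  finitely many remaining eigenvectors span.\<close>

lemma multiplicity_block_spectral:
  assumes bs: "block_spectral I t M u lam" and fin: "finite {k\<in>I. lam k = p}"
  shows "multiplicity I M (complex_of_real p) = card {k\<in>I. lam k = p}"
proof -
  define B where "B c = {i\<in>I. t i = c}" for c
  define K where "K = {k\<in>I. lam k = p}"
  \<comment> \<open>Truncation is needed because \<open>block_spectral\<close> leaves
    \<open>u k\<close> unconstrained outside the block of \<open>k\<close>.\<close>
  define w where "w k = (\<lambda>i. if i \<in> B (t k) then u k i else 0)" for k
  have finB: "finite (B (t k))" if "k \<in> I" for k
    using bs that by (simp add: block_spectral_def B_def)
  have block: "M i j = 0" if "i \<in> I" "j \<in> I" "t i \<noteq> t j" for i j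
    using bs that by (simp add: block_spectral_def)
  have on: "(\<Sum>i\<in>B (t k). cnj (u k i) * u l i) = (if k = l then 1 else 0)" if "k \<in> I" "l \<in> I" "t k = t l" for k l
    using bs that unfolding block_spectral_def B_def by blast
  have compl: "(\<Sum>k\<in>B (t i). u k i * cnj (u k j)) = (if i = j then 1 else 0)" if "i \<in> I" "j \<in> I" "t i = t j" for i j
    using bs that unfolding block_spectral_def B_def by blast
  have decomp: "M i j = (\<Sum>k\<in>B (t i). of_real (lam k) * u k i * cnj (u k j))" if "i \<in> I" "j \<in> I" "t i = t j" for i j
    using bs that unfolding block_spectral_def B_def by blast
  have row: "(\<Sum>\<^sub>\<infinity>j\<in>I. M i j * v j) = (\<Sum>j\<in>B (t i). M i j * v j)" if "i \<in> I" for i v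
  proof -
    have "(\<Sum>\<^sub>\<infinity>j\<in>I. M i j * v j) = (\<Sum>\<^sub>\<infinity>j\<in>B (t i). M i j * v j)"
      by (rule infsum_cong_neutral) (use that block in \<open>auto simp: B_def\<close>)
    then show ?thesis using finB[OF that] by simp
  qed
  define c where "c v k = (\<Sum>i\<in>B (t k). cnj (u k i) * v i)" for v k
  have row': "(\<Sum>\<^sub>\<infinity>j\<in>I. M i j * v j) = (\<Sum>k\<in>B (t i). of_real (lam k) * u k i * c v k)" if "i \<in> I" for i v
  proof -
    have "(\<Sum>j\<in>B (t i). M i j * v j) = (\<Sum>j\<in>B (t i). \<Sum>k\<in>B (t i). of_real (lam k) * u k i * cnj (u k j) * v j)"
      using that by (intro sum.cong refl) (auto simp: B_def decomp sum_distrib_right)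
    also have "\<dots> = (\<Sum>k\<in>B (t i). of_real (lam k) * u k i * c v k)"
    proof (subst sum.swap, intro sum.cong refl)
      fix k assume "k \<in> B (t i)"
      then have "t k = t i" by (auto simp: B_def)
      then show "(\<Sum>j\<in>B (t i). of_real (lam k) * u k i * cnj (u k j) * v j) = of_real (lam k) * u k i * c v k"
        by (simp add: c_def sum_distrib_left mult.assoc)
    qed
    finally show ?thesis using row[OF that] by simp
  qed
  have cw: "c (w l) k = (if k = l then 1 else 0)" if "k \<in> I" "l \<in> I" for k l
  proof (cases "t k = t l")
    case True
    then show ?thesis using on[OF that True] by (simp add: c_def w_def)
  next
    case False
    then have "c (w l) k = (\<Sum>i\<in>B (t k). 0)"
      unfolding c_def by (intro sum.cong) (auto simp: w_def B_def)
    with False show ?thesis by auto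
  qed
  have "cfun.dim (eigenspace I M (complex_of_real p)) = card K"
  proof (rule cfun.dim_unique)
    show "w ` K \<subseteq> eigenspace I M (complex_of_real p)"
    proof clarify
      fix l assume l: "l \<in> K"
      then have lI: "l \<in> I" by (simp add: K_def)
      have "(\<lambda>i. (cmod (w l i))\<^sup>2) summable_on I"
        by (rule finite_nonzero_values_imp_summable_on, rule finite_subset[OF _ finB[OF lI]]) (auto simp: w_def)
      moreover have "(\<Sum>\<^sub>\<infinity>j\<in>I. M i j * w l j) = of_real p * w l i" if i: "i \<in> I" for i
      proof -
        have "(\<Sum>\<^sub>\<infinity>j\<in>I. M i j * w l j) = (\<Sum>k\<in>B (t i). if k = l then of_real (lam k) * u k i else 0)"
          unfolding row'[OF i] by (intro sum.cong) (use lI in \<open>auto simp: cw B_def\<close>)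
        also have "\<dots> = of_real p * w l i"
          using l lI i finB[OF i] by (auto simp: w_def B_def K_def)
        finally show ?thesis .
      qed
      ultimately show "w l \<in> eigenspace I M (complex_of_real p)"
        using lI by (auto simp: eigenspace_def ell2_def w_def B_def)
    qed
    show "eigenspace I M (complex_of_real p) \<subseteq> cfun.span (w ` K)"
    proof
      fix v assume v: "v \<in> eigenspace I M (complex_of_real p)"
      then have ev: "\<And>i. i \<in> I \<Longrightarrow> (\<Sum>\<^sub>\<infinity>j\<in>I. M i j * v j) = of_real p * v i"
        and v0: "\<And>i. i \<notin> I \<Longrightarrow> v i = 0" by (auto simp: eigenspace_def ell2_def)
      have c0: "c v k = 0" if k: "k \<in> I" "k \<notin> K" for k
      proof -
        have "of_real p * c v k = (\<Sum>i\<in>B (t k). cnj (u k i) * (\<Sum>l\<in>B (t k). of_real (lam l) * u l i * c v l))"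
        proof -
          have "(\<Sum>l\<in>B (t k). of_real (lam l) * u l i * c v l) = of_real p * v i" if "i \<in> B (t k)" for i
            using that ev[of i] row'[of i v] by (simp add: B_def)
          then show ?thesis
            unfolding c_def[of v k] sum_distrib_left[of "of_real p"]
            by (intro sum.cong refl) (simp add: mult_ac)
        qed
        also have "\<dots> = (\<Sum>l\<in>B (t k). of_real (lam l) * c v l * (\<Sum>i\<in>B (t k). cnj (u k i) * u l i))"
          unfolding sum_distrib_left by (subst sum.swap) (auto simp: mult_ac)
        also have "\<dots> = (\<Sum>l\<in>B (t k). if l = k then of_real (lam l) * c v l else 0)"
        proof (intro sum.cong refl)
          fix l assume "l \<in> B (t k)"
          then have "l \<in> I" "t k = t l" by (auto simp: B_def)
          from on[OF k(1) this] show "of_real (lam l) * c v l * (\<Sum>i\<in>B (t k). cnj (u k i) * u l i)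
            = (if l = k then of_real (lam l) * c v l else 0)" by simp
        qed
        also have "\<dots> = of_real (lam k) * c v k"
        proof -
          have "k \<in> B (t k)" using k by (simp add: B_def)
          then show ?thesis using finB[OF k(1)] by simp
        qed
        finally show ?thesis using k by (auto simp: K_def)
      qed
      have "v = (\<Sum>k\<in>K. (\<lambda>i. c v k * w k i))"
      proof
        fix i
        show "v i = (\<Sum>k\<in>K. (\<lambda>i. c v k * w k i)) i"
        proof (cases "i \<in> I")
          case False
          then show ?thesis by (auto simp: sum_fun_apply v0 w_def B_def)
        next
          case i: True
          have "v i = (\<Sum>j\<in>B (t i). (if i = j then 1 else 0) * v j)"
          proof -
            have "i \<in> B (t i)" using i by (simp add: B_def)
            then show ?thesis using finB[OF i] by (simp add: if_distrib[of "\<lambda>x. x * _"] cong: if_cong)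
          qed
          also have "\<dots> = (\<Sum>j\<in>B (t i). (\<Sum>k\<in>B (t i). u k i * cnj (u k j)) * v j)"
          proof (intro sum.cong refl)
            fix j assume "j \<in> B (t i)"
            then have "j \<in> I" "t i = t j" by (auto simp: B_def)
            from compl[OF i this] show "(if i = j then 1 else 0) * v j
              = (\<Sum>k\<in>B (t i). u k i * cnj (u k j)) * v j" by simp
          qed
          also have "\<dots> = (\<Sum>k\<in>B (t i). u k i * c v k)"
            unfolding sum_distrib_right
          proof (subst sum.swap, intro sum.cong refl)
            fix k assume "k \<in> B (t i)"
            then have "t k = t i" by (auto simp: B_def)
            then show "(\<Sum>j\<in>B (t i). u k i * cnj (u k j) * v j) = u k i * c v k"
              by (simp add: c_def sum_distrib_left mult.assoc)
          qed
          also have "\<dots> = (\<Sum>k\<in>B (t i) \<inter> K. u k i * c v k)"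
          proof (intro sum.mono_neutral_right ballI)
            fix k assume "k \<in> B (t i) - B (t i) \<inter> K"
            then have "k \<in> I" "k \<notin> K" by (auto simp: B_def)
            then show "u k i * c v k = 0" using c0 by simp
          qed (use finB[OF i] in auto)
          also have "\<dots> = (\<Sum>k\<in>K. c v k * w k i)"
            using fin i by (intro sum.mono_neutral_cong_left) (auto simp: K_def w_def B_def)
          finally show ?thesis by (simp add: sum_fun_apply)
        qed
      qed
      also have "\<dots> \<in> cfun.span (w ` K)"
        by (intro cfun.span_sum cfun.span_scale cfun.span_base) auto
      finally show "v \<in> cfun.span (w ` K)" .
    qed
    have inj: "inj_on w K"
    proof (rule inj_onI)
      fix k l assume "k \<in> K" "l \<in> K" "w k = w l"
      then show "k = l" using cw[of k k] cw[of k l] by (auto simp: K_def split: if_splits)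
    qed
    then show "card (w ` K) = card K" by (rule card_image)
    show "cfun.independent (w ` K)"
    proof (rule cfun.independent_if_scalars_zero)
      show "finite (w ` K)" using fin by (simp add: K_def)
      fix f x assume f: "(\<Sum>x\<in>w ` K. (\<lambda>i. f x * x i)) = 0" and "x \<in> w ` K"
      then obtain l where l: "l \<in> K" "x = w l" by blast
      then have lI: "l \<in> I" by (simp add: K_def)
      have "0 = c (\<Sum>x\<in>w ` K. (\<lambda>i. f x * x i)) l" by (simp add: f c_def)
      also have "\<dots> = c (\<lambda>i. \<Sum>k\<in>K. f (w k) * w k i) l"
        using inj by (simp add: sum.reindex sum_fun_apply[abs_def] o_def c_def)
      also have "\<dots> = (\<Sum>k\<in>K. f (w k) * c (w k) l)"
        unfolding c_def sum_distrib_left by (subst sum.swap) (simp add: mult_ac)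
      also have "\<dots> = (\<Sum>k\<in>K. if k = l then f (w k) else 0)"
        by (intro sum.cong refl) (use lI in \<open>auto simp: cw K_def\<close>)
      also have "\<dots> = f x" using l fin by (simp add: K_def)
      finally show "f x = 0" by simp
    qed
  qed
  then show ?thesis by (simp add: multiplicity_def K_def)
qed

subsection \<open>Entropy of block-diagonal operators\<close>

definition eta :: "real \<Rightarrow> real" where
  "eta p = - p * log 2 p"

lemma eta_0 [simp]: "eta 0 = 0"
  by (simp add: eta_def)

lemma eta_nonneg: "0 \<le> p \<Longrightarrow> p \<le> 1 \<Longrightarrow> eta p \<ge> 0"
  by (cases "p = 0") (auto simp: eta_def mult_nonneg_nonpos log_le_zero_cancel_iff)

text \<open>The inequality \<open>ln x \<le> x - 1\<close> at \<open>x = 1 / sqrt p\<close>. It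
  supplies the majorant for entropy sums.\<close>

lemma eta_le_sqrt:
  assumes "0 \<le> p"
  shows "eta p \<le> 2 / ln 2 * sqrt p"
proof (cases "p = 0")
  case False
  with assms have p: "p > 0" by simp
  have "ln (1 / sqrt p) \<le> 1 / sqrt p - 1" using p by (intro ln_le_minus_one) simp
  then have "- ln p / 2 \<le> 1 / sqrt p - 1" using p by (simp add: ln_div ln_sqrt)
  then have "- ln p \<le> 2 / sqrt p" by (simp add: field_simps)
  then have "p * (- ln p) \<le> p * (2 / sqrt p)" using p by (intro mult_left_mono) auto
  also have "\<dots> = 2 * sqrt p" using p by (simp add: field_simps real_div_sqrt)
  finally show ?thesis
    by (simp add: eta_def log_def divide_right_mono field_simps)
qed simp

lemma has_sum_ereal:
  assumes "(f has_sum s) A"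
  shows "((\<lambda>x. ereal (f x)) has_sum ereal s) A"
proof -
  have "((\<lambda>F. ereal (sum f F)) \<longlongrightarrow> ereal s) (finite_subsets_at_top A)"
    using assms unfolding has_sum_def by (intro tendsto_intros)
  then show ?thesis unfolding has_sum_def by (simp add: sum_ereal[symmetric] del: sum_ereal)
qed

text \<open>Grouping indices by their eigenvalue. The groups are finite because a positive constant
  is not summable over an infinite set, and the eigenvalue 0 contributes nothing to either
  sum.\<close>

lemma vn_entropy_block_spectral:
  assumes bs: "block_spectral I t M u lam" and nonneg: "\<And>k. k \<in> I \<Longrightarrow> lam k \<ge> 0"
    and summ: "lam summable_on I" and eta: "((\<lambda>k. eta (lam k)) has_sum H) I"
  shows "vn_entropy I M = ereal H"
proof -
  have fin: "finite {k\<in>I. lam k = p}" if "p > 0" for p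
  proof (rule ccontr)
    assume inf: "infinite {k\<in>I. lam k = p}"
    have "lam summable_on {k\<in>I. lam k = p}"
      using summ by (rule summable_on_subset) auto
    then have "(\<lambda>k. p) summable_on {k\<in>I. lam k = p}"
      by (rule summable_on_cong[THEN iffD1, rotated]) auto
    with infsum_diverge_constant[OF inf, of p] \<open>p > 0\<close> show False by simp
  qed
  let ?K = "\<lambda>p. {k\<in>I. lam k = p}"
  have "((\<lambda>k. eta (lam k)) has_sum H) {k\<in>I. lam k > 0}"
    using eta by (rule has_sum_cong_neutral[THEN iffD1, rotated -1])
      (use nonneg in \<open>force simp: order.order_iff_strict\<close>)+
  also have "?this \<longleftrightarrow> ((\<lambda>(p, k). eta (lam k)) has_sum H) (Sigma {0<..} ?K)"
    by (rule has_sum_reindex_bij_witness[of _ snd "\<lambda>k. (lam k, k)"]) auto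
  finally have "((\<lambda>p. real (card (?K p)) * eta p) has_sum H) {0<..}"
  proof (rule has_sum_SigmaD)
    fix p :: real assume "p \<in> {0<..}"
    then have "finite (?K p)" using fin by simp
    then show "((\<lambda>k. case (p, k) of (p, k) \<Rightarrow> eta (lam k)) has_sum real (card (?K p)) * eta p) (?K p)"
      by (intro has_sum_finiteI) auto
  qed
  then have "((\<lambda>p. ereal (real (card (?K p)) * eta p)) has_sum ereal H) {0<..}"
    by (rule has_sum_ereal)
  also have "?this \<longleftrightarrow> ((\<lambda>p. ereal (real (multiplicity I M (complex_of_real p)) * (- p * log 2 p)))
      has_sum ereal H) {0<..}"
    by (intro has_sum_cong) (simp add: multiplicity_block_spectral[OF bs fin] eta_def)
  finally show ?thesis unfolding vn_entropy_def by (rule infsumI)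
qed

subsection \<open>The two reduced states of a pure state have the same nonzero spectrum\<close>

text \<open>Row sums are additive in the vector only where they converge; a divergent
  \<open>infsum\<close> is 0 by convention, which would destroy additivity.\<close>

lemma subspace_eigenspace: "cfun.subspace (eigenspace I M c)" if "\<And>i v. v \<in> ell2 I \<Longrightarrow> i \<in> I \<Longrightarrow> (\<lambda>j. M i j * v j) summable_on I"
proof -
  have add: "(\<lambda>i. v i + w i) \<in> ell2 I" if "v \<in> ell2 I" "w \<in> ell2 I" for v w
  proof -
    have "(\<lambda>i. 2 * (cmod (v i))\<^sup>2 + 2 * (cmod (w i))\<^sup>2) summable_on I"
      using that unfolding ell2_def by (intro summable_on_add summable_on_cmult_right) auto
    then have "(\<lambda>i. (cmod (v i + w i))\<^sup>2) summable_on I"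
    proof (rule summable_on_comparison_test)
      fix i
      have "(cmod (v i + w i))\<^sup>2 \<le> (cmod (v i) + cmod (w i))\<^sup>2"
        by (intro power_mono norm_triangle_ineq) auto
      also have "\<dots> \<le> 2 * (cmod (v i))\<^sup>2 + 2 * (cmod (w i))\<^sup>2"
        using zero_le_power2[of "cmod (v i) - cmod (w i)"] by (simp add: power2_eq_square algebra_simps)
      finally show "(cmod (v i + w i))\<^sup>2 \<le> 2 * (cmod (v i))\<^sup>2 + 2 * (cmod (w i))\<^sup>2" .
    qed auto
    then show ?thesis using that by (auto simp: ell2_def)
  qed
  have scale: "(\<lambda>i. a * v i) \<in> ell2 I" if "v \<in> ell2 I" for a v
    using that by (auto simp: ell2_def norm_mult power_mult_distrib intro!: summable_on_cmult_right)
  show ?thesis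
    unfolding cfun.subspace_def
  proof (intro conjI ballI allI)
    show "0 \<in> eigenspace I M c" by (auto simp: eigenspace_def ell2_def)
  next
    fix v w assume v: "v \<in> eigenspace I M c" and w: "w \<in> eigenspace I M c"
    then have l2: "v \<in> ell2 I" "w \<in> ell2 I" by (auto simp: eigenspace_def)
    have "(\<Sum>\<^sub>\<infinity>j\<in>I. M i j * (v j + w j)) = c * (v i + w i)" if "i \<in> I" for i
      using v w that l2 \<open>\<And>i v. v \<in> ell2 I \<Longrightarrow> i \<in> I \<Longrightarrow> (\<lambda>j. M i j * v j) summable_on I\<close>
      by (simp add: ring_distribs infsum_add eigenspace_def)
    then show "v + w \<in> eigenspace I M c"
      using add[OF l2] by (simp add: eigenspace_def plus_fun_def)
  next
    fix a v assume v: "v \<in> eigenspace I M c"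
    have "(\<Sum>\<^sub>\<infinity>j\<in>I. M i j * (a * v j)) = c * (a * v i)" if "i \<in> I" for i
    proof -
      have "(\<Sum>\<^sub>\<infinity>j\<in>I. M i j * (a * v j)) = (\<Sum>\<^sub>\<infinity>j\<in>I. a * (M i j * v j))" by (simp add: mult_ac)
      then show ?thesis using v that by (simp add: infsum_cmult_right' eigenspace_def mult_ac)
    qed
    then show "(\<lambda>i. a * v i) \<in> eigenspace I M c"
      using scale v by (simp add: eigenspace_def)
  qed
qed

text \<open>\<open>S\<close> will be given by infinite sums and is linear only on \<open>V\<close>.
  A basis of \<open>V\<close> carries it over to a linear map \<open>f\<close> on all functions that
  agrees with \<open>S\<close> on \<open>V\<close>.\<close>

lemma dim_eq_if_linear_bij:
  fixes V :: "'i vec set" and W :: "'j vec set"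
  assumes V: "cfun.subspace V" and SV: "S ` V = W" and inj: "inj_on S V"
    and lin: "\<And>v w a. v \<in> V \<Longrightarrow> w \<in> V \<Longrightarrow> S (\<lambda>i. v i + w i) = (\<lambda>i. S v i + S w i)"
    "\<And>v a. v \<in> V \<Longrightarrow> S (\<lambda>i. a * v i) = (\<lambda>i. a * S v i)"
  shows "cfun.dim V = cfun.dim W"
proof -
  obtain B where B: "B \<subseteq> V" "cfun.independent B" "V \<subseteq> cfun.span B" "card B = cfun.dim V"
    using cfun.basis_exists by blast
  then have VB: "cfun.span B = V" using V by (intro subset_antisym cfun.span_minimal) auto
  obtain f where f: "Vector_Spaces.linear (\<lambda>a v i. a * v i) (\<lambda>a v i. a * v i) f" "\<forall>b\<in>B. f b = S b"
    using cfun_pair.linear_independent_extend[OF B(2), of S] by blast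
  interpret f: Vector_Spaces.linear "\<lambda>(a::complex) (v::'i \<Rightarrow> complex) i. a * v i"
    "\<lambda>(a::complex) (v::'j \<Rightarrow> complex) i. a * v i" f by (rule f)
  have fS: "v \<in> V \<and> f v = S v" if "v \<in> cfun.span B" for v
    using that
  proof (induction rule: cfun.span_induct_alt)
    case base
    have "0 \<in> V" using V by (simp add: cfun.subspace_0)
    moreover from lin(2)[OF this, of 0] have "S 0 = 0" by (simp add: fun_eq_iff zero_fun_def)
    ultimately show ?case using f.zero by (simp add: zero_fun_def)
  next
    case (step a v w)
    have v: "v \<in> V" using step B(1) by auto
    have av: "(\<lambda>i. a * v i) \<in> V" using cfun.subspace_scale[OF V v] .
    have "(\<lambda>i. a * v i) + w \<in> V" using cfun.subspace_add[OF V av] step by blast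
    moreover have "f ((\<lambda>i. a * v i) + w) = (\<lambda>i. a * f v i) + f w"
      by (simp only: f.add f.scale)
    then have "f ((\<lambda>i. a * v i) + w) = S ((\<lambda>i. a * v i) + w)"
      using step f(2) lin(1)[OF av, of w] lin(2)[OF v, of a] v
      by (simp add: plus_fun_def)
    ultimately show ?case ..
  qed
  have "inj_on f (cfun.span B)"
  proof (rule inj_onI)
    fix v w assume "v \<in> cfun.span B" "w \<in> cfun.span B" "f v = f w"
    then have "v \<in> V" "w \<in> V" "S v = S w" using fS by auto
    then show "v = w" by (rule inj_onD[OF inj, rotated])
  qed
  then have ind: "cfun.independent (f ` B)"
    by (rule f.independent_injective_image[OF B(2)])
  have "cfun.span (f ` B) = f ` cfun.span B" by (rule f.span_image)
  also have "\<dots> = W" unfolding SV[symmetric] VB by (rule image_cong) (use fS VB in auto)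
  finally have "cfun.span (f ` B) = W" .
  then have "cfun.dim W = card (f ` B)"
    using cfun.dim_span_eq_card_independent[OF ind] by simp
  also have "\<dots> = card B"
    using \<open>inj_on f (cfun.span B)\<close> by (intro card_image) (rule inj_on_subset[OF _ cfun.span_superset])
  finally show ?thesis using B(4) by simp
qed

section \<open>Square-summable kernels: Cauchy-Schwarz, exchange of sums, Gram matrices\<close>

lemma infsum_Cauchy_Schwarz:
  assumes f: "(\<lambda>x. (cmod (f x))\<^sup>2) summable_on X" and g: "(\<lambda>x. (cmod (g x))\<^sup>2) summable_on X"
  shows "(\<lambda>x. cmod (f x * g x)) summable_on X"
    and "(cmod (\<Sum>\<^sub>\<infinity>x\<in>X. f x * g x))\<^sup>2 \<le> (\<Sum>\<^sub>\<infinity>x\<in>X. (cmod (f x))\<^sup>2) * (\<Sum>\<^sub>\<infinity>x\<in>X. (cmod (g x))\<^sup>2)"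
proof -
  show s: "(\<lambda>x. cmod (f x * g x)) summable_on X"
    by (rule abs_summable_product) (use f g in \<open>simp_all add: norm_mult power2_eq_square\<close>)
  define A B where "A = (\<Sum>\<^sub>\<infinity>x\<in>X. (cmod (f x))\<^sup>2)" and "B = (\<Sum>\<^sub>\<infinity>x\<in>X. (cmod (g x))\<^sup>2)"
  have AB: "A \<ge> 0" "B \<ge> 0" unfolding A_def B_def by (auto intro: infsum_nonneg)
  have "(\<Sum>x\<in>F. cmod (f x * g x)) \<le> sqrt (A * B)" if F: "finite F" "F \<subseteq> X" for F
  proof (rule real_le_rsqrt)
    have "(\<Sum>x\<in>F. cmod (f x * g x))\<^sup>2 \<le> (\<Sum>x\<in>F. (cmod (f x))\<^sup>2) * (\<Sum>x\<in>F. (cmod (g x))\<^sup>2)"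
      unfolding norm_mult by (rule Cauchy_Schwarz_ineq_sum)
    also have "\<dots> \<le> A * B"
      unfolding A_def B_def using F f g
      by (intro mult_mono finite_sum_le_infsum) (auto intro: sum_nonneg infsum_nonneg)
    finally show "(\<Sum>x\<in>F. cmod (f x * g x))\<^sup>2 \<le> A * B" .
  qed
  then have "(\<Sum>\<^sub>\<infinity>x\<in>X. cmod (f x * g x)) \<le> sqrt (A * B)"
    by (intro infsum_le_finite_sums s)
  moreover have "cmod (\<Sum>\<^sub>\<infinity>x\<in>X. f x * g x) \<le> (\<Sum>\<^sub>\<infinity>x\<in>X. cmod (f x * g x))"
    using s by (rule norm_infsum_bound)
  ultimately have "(cmod (\<Sum>\<^sub>\<infinity>x\<in>X. f x * g x))\<^sup>2 \<le> (sqrt (A * B))\<^sup>2"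
    by (intro power_mono) auto
  then show "(cmod (\<Sum>\<^sub>\<infinity>x\<in>X. f x * g x))\<^sup>2 \<le> A * B" using AB by simp
qed

lemma summable_on_product_squares:
  assumes "(\<lambda>x. (cmod (f x))\<^sup>2) summable_on X" "(\<lambda>y. (cmod (g y))\<^sup>2) summable_on Y"
  shows "(\<lambda>(x, y). (cmod (f x * g y))\<^sup>2) summable_on X \<times> Y"
proof (rule summable_on_SigmaI)
  show "((\<lambda>y. case (x, y) of (x, y) \<Rightarrow> (cmod (f x * g y))\<^sup>2) has_sum
      (cmod (f x))\<^sup>2 * (\<Sum>\<^sub>\<infinity>y\<in>Y. (cmod (g y))\<^sup>2)) Y" for x
    using assms(2) by (simp add: norm_mult power_mult_distrib has_sum_cmult_right)
  show "(\<lambda>x. (cmod (f x))\<^sup>2 * (\<Sum>\<^sub>\<infinity>y\<in>Y. (cmod (g y))\<^sup>2)) summable_on X"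
    using assms(1) by (rule summable_on_cmult_left)
qed auto

text \<open>Both the kernel and the product \<open>f x * g y\<close> are square summable over pairs,
  so by Cauchy-Schwarz the double family is absolutely summable.\<close>

lemma infsum_swap_ell2:
  fixes \<psi> :: "'x \<Rightarrow> 'y \<Rightarrow> complex"
  assumes \<psi>: "(\<lambda>(x, y). (cmod (\<psi> x y))\<^sup>2) summable_on X \<times> Y"
    and f: "(\<lambda>x. (cmod (f x))\<^sup>2) summable_on X" and g: "(\<lambda>y. (cmod (g y))\<^sup>2) summable_on Y"
  shows "(\<Sum>\<^sub>\<infinity>x\<in>X. \<Sum>\<^sub>\<infinity>y\<in>Y. \<psi> x y * (f x * g y)) = (\<Sum>\<^sub>\<infinity>y\<in>Y. \<Sum>\<^sub>\<infinity>x\<in>X. \<psi> x y * (f x * g y))"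
proof (rule infsum_swap_banach)
  have "(\<lambda>z. cmod ((\<lambda>(x, y). \<psi> x y) z * (\<lambda>(x, y). f x * g y) z)) summable_on X \<times> Y"
    by (rule infsum_Cauchy_Schwarz(1))
      (use \<psi> summable_on_product_squares[OF f g] in \<open>simp_all add: case_prod_unfold\<close>)
  then show "(\<lambda>(x, y). \<psi> x y * (f x * g y)) summable_on X \<times> Y"
    by (intro abs_summable_summable[where f = "\<lambda>(x, y). _ x y"]) (simp add: case_prod_unfold)
qed

lemma ell2_slices:
  fixes \<psi> :: "'x \<Rightarrow> 'y \<Rightarrow> complex"
  assumes \<psi>: "(\<lambda>(x, y). (cmod (\<psi> x y))\<^sup>2) summable_on X \<times> Y"
  shows "(\<lambda>(y, x). (cmod (\<psi> x y))\<^sup>2) summable_on Y \<times> X"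
    and "x \<in> X \<Longrightarrow> (\<lambda>y. (cmod (\<psi> x y))\<^sup>2) summable_on Y"
    and "y \<in> Y \<Longrightarrow> (\<lambda>x. (cmod (\<psi> x y))\<^sup>2) summable_on X"
    and "(\<lambda>y. \<Sum>\<^sub>\<infinity>x\<in>X. (cmod (\<psi> x y))\<^sup>2) summable_on Y"
proof -
  show sw: "(\<lambda>(y, x). (cmod (\<psi> x y))\<^sup>2) summable_on Y \<times> X"
    using \<psi> by (subst summable_on_swap) simp
  show "x \<in> X \<Longrightarrow> (\<lambda>y. (cmod (\<psi> x y))\<^sup>2) summable_on Y"
    using summable_on_SigmaD1[OF \<psi>] .
  show s: "(\<lambda>x. (cmod (\<psi> x y))\<^sup>2) summable_on X" if "y \<in> Y" for y
    using summable_on_SigmaD1[OF sw] that .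
  show "(\<lambda>y. \<Sum>\<^sub>\<infinity>x\<in>X. (cmod (\<psi> x y))\<^sup>2) summable_on Y"
    using summable_on_SigmaD[OF sw] s by simp
qed

text \<open>With \<open>\<psi>\<close> read as a matrix these are
  \<open>\<psi> \<psi>\<dagger>\<close> and, below, \<open>\<psi>\<dagger> \<psi>\<close>. With
  \<open>\<psi>\<close> read as a bipartite vector they are the reduced state on \<open>X\<close>
  and the transpose of the reduced state on \<open>Y\<close>.\<close>

abbreviation row_gram :: "'y set \<Rightarrow> ('x, 'y) opr \<Rightarrow> ('x, 'x) opr" where
  "row_gram Y \<psi> \<equiv> \<lambda>x x'. \<Sum>\<^sub>\<infinity>y\<in>Y. \<psi> x y * cnj (\<psi> x' y)"

abbreviation col_gram :: "'x set \<Rightarrow> ('x, 'y) opr \<Rightarrow> ('y, 'y) opr" where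
  "col_gram X \<psi> \<equiv> \<lambda>y y'. \<Sum>\<^sub>\<infinity>x\<in>X. cnj (\<psi> x y) * \<psi> x y'"

text \<open>The adjoint of \<open>\<psi>\<close> maps eigenvectors of
  \<open>\<psi> \<psi>\<dagger>\<close> to eigenvectors of \<open>\<psi>\<dagger> \<psi>\<close>,
  and \<open>\<psi>\<close> maps them back up to the factor \<open>p\<close>. Associativity of these
  infinite matrix products is an exchange of sums.\<close>

lemma gram_eigenvector:
  fixes \<psi> :: "'x \<Rightarrow> 'y \<Rightarrow> complex"
  assumes \<psi>: "(\<lambda>(x, y). (cmod (\<psi> x y))\<^sup>2) summable_on X \<times> Y"
    and v: "v \<in> eigenspace X (row_gram Y \<psi>) p"
  defines "w \<equiv> \<lambda>y. if y \<in> Y then \<Sum>\<^sub>\<infinity>x\<in>X. cnj (\<psi> x y) * v x else 0"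
  shows "w \<in> eigenspace Y (col_gram X \<psi>) p"
    and "(\<lambda>x. if x \<in> X then \<Sum>\<^sub>\<infinity>y\<in>Y. \<psi> x y * w y else 0) = (\<lambda>x. p * v x)"
proof -
  note sl = ell2_slices[OF \<psi>]
  have v2: "(\<lambda>x. (cmod (v x))\<^sup>2) summable_on X" and v0: "\<And>x. x \<notin> X \<Longrightarrow> v x = 0"
    and ev: "\<And>x. x \<in> X \<Longrightarrow> (\<Sum>\<^sub>\<infinity>x'\<in>X. (\<Sum>\<^sub>\<infinity>y\<in>Y. \<psi> x y * cnj (\<psi> x' y)) * v x') = p * v x"
    using v by (auto simp: eigenspace_def ell2_def)
  have c\<psi>: "(\<lambda>(x, y). (cmod (cnj (\<psi> x y)))\<^sup>2) summable_on X \<times> Y" using \<psi> by simp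
  have w2: "(\<lambda>y. (cmod (w y))\<^sup>2) summable_on Y"
  proof (rule summable_on_comparison_test)
    show "(\<lambda>y. (\<Sum>\<^sub>\<infinity>x\<in>X. (cmod (\<psi> x y))\<^sup>2) * (\<Sum>\<^sub>\<infinity>x\<in>X. (cmod (v x))\<^sup>2)) summable_on Y"
      using sl(4) by (rule summable_on_cmult_left)
    fix y assume y: "y \<in> Y"
    show "(cmod (w y))\<^sup>2 \<le> (\<Sum>\<^sub>\<infinity>x\<in>X. (cmod (\<psi> x y))\<^sup>2) * (\<Sum>\<^sub>\<infinity>x\<in>X. (cmod (v x))\<^sup>2)"
      using infsum_Cauchy_Schwarz(2)[of "\<lambda>x. cnj (\<psi> x y)" X v] sl(3)[OF y] v2 y by (simp add: w_def)
  qed auto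
  have Tw: "(\<Sum>\<^sub>\<infinity>y\<in>Y. \<psi> x y * w y) = p * v x" if x: "x \<in> X" for x
  proof -
    have "(\<Sum>\<^sub>\<infinity>y\<in>Y. \<psi> x y * w y) = (\<Sum>\<^sub>\<infinity>y\<in>Y. \<Sum>\<^sub>\<infinity>x'\<in>X. cnj (\<psi> x' y) * (v x' * \<psi> x y))"
      by (intro infsum_cong) (simp add: w_def infsum_cmult_right'[symmetric] mult_ac)
    also have "\<dots> = (\<Sum>\<^sub>\<infinity>x'\<in>X. \<Sum>\<^sub>\<infinity>y\<in>Y. cnj (\<psi> x' y) * (v x' * \<psi> x y))"
      by (rule infsum_swap_ell2[OF c\<psi> v2 sl(2)[OF x], symmetric])
    also have "\<dots> = p * v x"
      unfolding ev[OF x, symmetric] by (intro infsum_cong, subst infsum_cmult_left'[symmetric]) (simp add: mult_ac)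
    finally show ?thesis .
  qed
  then show "(\<lambda>x. if x \<in> X then \<Sum>\<^sub>\<infinity>y\<in>Y. \<psi> x y * w y else 0) = (\<lambda>x. p * v x)"
    using v0 by auto
  have "(\<Sum>\<^sub>\<infinity>y'\<in>Y. (\<Sum>\<^sub>\<infinity>x\<in>X. cnj (\<psi> x y) * \<psi> x y') * w y') = p * w y" if y: "y \<in> Y" for y
  proof -
    have "(\<Sum>\<^sub>\<infinity>y'\<in>Y. (\<Sum>\<^sub>\<infinity>x\<in>X. cnj (\<psi> x y) * \<psi> x y') * w y')
        = (\<Sum>\<^sub>\<infinity>y'\<in>Y. \<Sum>\<^sub>\<infinity>x\<in>X. \<psi> x y' * (cnj (\<psi> x y) * w y'))"
      by (intro infsum_cong, subst infsum_cmult_left'[symmetric]) (simp add: mult_ac)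
    also have "\<dots> = (\<Sum>\<^sub>\<infinity>x\<in>X. \<Sum>\<^sub>\<infinity>y'\<in>Y. \<psi> x y' * (cnj (\<psi> x y) * w y'))"
      by (rule infsum_swap_ell2[OF \<psi> _ w2, symmetric]) (use sl(3)[OF y] in simp)
    also have "\<dots> = (\<Sum>\<^sub>\<infinity>x\<in>X. cnj (\<psi> x y) * (p * v x))"
    proof (intro infsum_cong)
      fix x assume x: "x \<in> X"
      have "(\<Sum>\<^sub>\<infinity>y'\<in>Y. \<psi> x y' * (cnj (\<psi> x y) * w y')) = (\<Sum>\<^sub>\<infinity>y'\<in>Y. cnj (\<psi> x y) * (\<psi> x y' * w y'))"
        by (simp add: mult_ac)
      then show "(\<Sum>\<^sub>\<infinity>y'\<in>Y. \<psi> x y' * (cnj (\<psi> x y) * w y')) = cnj (\<psi> x y) * (p * v x)"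
        by (simp add: infsum_cmult_right' Tw[OF x])
    qed
    also have "\<dots> = (\<Sum>\<^sub>\<infinity>x\<in>X. p * (cnj (\<psi> x y) * v x))" by (simp add: mult_ac)
    also have "\<dots> = p * w y"
      using y by (simp add: w_def infsum_cmult_right')
    finally show ?thesis .
  qed
  then show "w \<in> eigenspace Y (col_gram X \<psi>) p"
    using w2 by (auto simp: eigenspace_def ell2_def w_def)
qed

lemma gram_row_ell2:
  fixes \<psi> :: "'x \<Rightarrow> 'y \<Rightarrow> complex"
  assumes \<psi>: "(\<lambda>(x, y). (cmod (\<psi> x y))\<^sup>2) summable_on X \<times> Y" and x: "x \<in> X"
  shows "(\<lambda>x'. (cmod (\<Sum>\<^sub>\<infinity>y\<in>Y. \<psi> x y * cnj (\<psi> x' y)))\<^sup>2) summable_on X"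
proof (rule summable_on_comparison_test)
  note sl = ell2_slices[OF ell2_slices(1)[OF \<psi>]]
  show "(\<lambda>x'. (\<Sum>\<^sub>\<infinity>y\<in>Y. (cmod (\<psi> x y))\<^sup>2) * (\<Sum>\<^sub>\<infinity>y\<in>Y. (cmod (\<psi> x' y))\<^sup>2)) summable_on X"
    using sl(4) by (rule summable_on_cmult_right)
  fix x' assume "x' \<in> X"
  then show "(cmod (\<Sum>\<^sub>\<infinity>y\<in>Y. \<psi> x y * cnj (\<psi> x' y)))\<^sup>2
      \<le> (\<Sum>\<^sub>\<infinity>y\<in>Y. (cmod (\<psi> x y))\<^sup>2) * (\<Sum>\<^sub>\<infinity>y\<in>Y. (cmod (\<psi> x' y))\<^sup>2)"
    using infsum_Cauchy_Schwarz(2)[of "\<psi> x" Y "\<lambda>y. cnj (\<psi> x' y)"] sl(3) x by simp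
qed auto

text \<open>The adjoint of \<open>\<psi>\<close> and \<open>\<psi> / p\<close> are mutually inverse
  between the two eigenspaces.\<close>

theorem multiplicity_gram:
  fixes \<psi> :: "'x \<Rightarrow> 'y \<Rightarrow> complex"
  assumes \<psi>: "(\<lambda>(x, y). (cmod (\<psi> x y))\<^sup>2) summable_on X \<times> Y" and p: "p \<noteq> 0"
  shows "multiplicity X (row_gram Y \<psi>) p
       = multiplicity Y (col_gram X \<psi>) p"
proof -
  define V where "V = eigenspace X (row_gram Y \<psi>) p"
  define W where "W = eigenspace Y (col_gram X \<psi>) p"
  define S where "S v = (\<lambda>y. if y \<in> Y then \<Sum>\<^sub>\<infinity>x\<in>X. cnj (\<psi> x y) * v x else 0)" for v
  define T where "T w = (\<lambda>x. if x \<in> X then \<Sum>\<^sub>\<infinity>y\<in>Y. \<psi> x y * w y else 0)" for w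
  note sl = ell2_slices[OF \<psi>]
  have S: "S v \<in> W" "T (S v) = (\<lambda>x. p * v x)" if "v \<in> V" for v
    using gram_eigenvector[OF \<psi>, of v p] that unfolding V_def W_def S_def T_def by auto
  have "(\<lambda>(y, x). (cmod (cnj (\<psi> x y)))\<^sup>2) summable_on Y \<times> X" using sl(1) by simp
  \<comment> \<open>The same lemma for the adjoint kernel, with \<open>X\<close> and
    \<open>Y\<close> exchanged.\<close>
  note gr = gram_eigenvector[OF this, of _ p, unfolded complex_cnj_cnj]
  have T: "T w \<in> V" "S (T w) = (\<lambda>y. p * w y)" if "w \<in> W" for w
    using gr[of w] that unfolding V_def W_def S_def T_def by auto
  have V: "cfun.subspace V"
    unfolding V_def
  proof (rule subspace_eigenspace)
    fix i v assume "v \<in> ell2 X" "i \<in> X"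
    then have "(\<lambda>j. cmod ((\<Sum>\<^sub>\<infinity>y\<in>Y. \<psi> i y * cnj (\<psi> j y)) * v j)) summable_on X"
      by (intro infsum_Cauchy_Schwarz(1) gram_row_ell2[OF \<psi>]) (auto simp: ell2_def)
    then show "(\<lambda>j. (\<Sum>\<^sub>\<infinity>y\<in>Y. \<psi> i y * cnj (\<psi> j y)) * v j) summable_on X"
      by (rule abs_summable_summable)
  qed
  have Sscale: "S (\<lambda>x. a * v x) = (\<lambda>y. a * S v y)" for a v
  proof
    fix y
    have "(\<Sum>\<^sub>\<infinity>x\<in>X. cnj (\<psi> x y) * (a * v x)) = (\<Sum>\<^sub>\<infinity>x\<in>X. a * (cnj (\<psi> x y) * v x))" by (simp add: mult_ac)
    then show "S (\<lambda>x. a * v x) y = a * S v y" by (simp add: S_def infsum_cmult_right')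
  qed
  have "cfun.dim V = cfun.dim W"
  proof (rule dim_eq_if_linear_bij[OF V, of S])
    show "inj_on S V"
    proof (rule inj_onI)
      fix v w assume "v \<in> V" "w \<in> V" "S v = S w"
      then have "(\<lambda>x. p * v x) = (\<lambda>x. p * w x)" using S(2) by metis
      then show "v = w" using p by (auto simp: fun_eq_iff)
    qed
    show "S ` V = W"
    proof (intro equalityI subsetI)
      fix w assume w: "w \<in> W"
      have "S (\<lambda>x. (1 / p) * T w x) = w" using T(2)[OF w] p by (simp only: Sscale) auto
      moreover have "(\<lambda>x. (1 / p) * T w x) \<in> V" using cfun.subspace_scale[OF V T(1)[OF w]] .
      ultimately show "w \<in> S ` V" by (metis image_eqI)
    qed (use S in auto)
    fix v w assume "v \<in> V" "w \<in> V"
    then have "(\<lambda>x. (cmod (v x))\<^sup>2) summable_on X" "(\<lambda>x. (cmod (w x))\<^sup>2) summable_on X"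
      by (auto simp: V_def eigenspace_def ell2_def)
    then have "(\<lambda>x. cnj (\<psi> x y) * v x) summable_on X" "(\<lambda>x. cnj (\<psi> x y) * w x) summable_on X" if "y \<in> Y" for y
      using sl(3)[OF that] by (intro abs_summable_summable[OF infsum_Cauchy_Schwarz(1)]; simp)+
    then show "S (\<lambda>i. v i + w i) = (\<lambda>i. S v i + S w i)"
      by (auto simp: S_def ring_distribs infsum_add)
  qed (rule Sscale)
  then show ?thesis by (simp add: multiplicity_def V_def W_def)
qed

subsection \<open>The environment of an isometric extension\<close>

lemma eigenspace_cong:
  "(\<And>i j. i \<in> I \<Longrightarrow> j \<in> I \<Longrightarrow> M i j = M' i j) \<Longrightarrow> eigenspace I M c = eigenspace I M' c"
  unfolding eigenspace_def by (intro Collect_cong conj_cong ball_cong refl) (simp cong: infsum_cong)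

lemma multiplicity_cong:
  "(\<And>i j. i \<in> I \<Longrightarrow> j \<in> I \<Longrightarrow> M i j = M' i j) \<Longrightarrow> multiplicity I M c = multiplicity I M' c"
  unfolding multiplicity_def by (simp cong: eigenspace_cong)

lemma vn_entropy_cong:
  "(\<And>i j. i \<in> I \<Longrightarrow> j \<in> I \<Longrightarrow> M i j = M' i j) \<Longrightarrow> vn_entropy I M = vn_entropy I M'"
  unfolding vn_entropy_def by (simp cong: multiplicity_cong)

lemma has_sum_sum:
  fixes f :: "'i \<Rightarrow> 'x \<Rightarrow> 'b::topological_comm_monoid_add"
  assumes "\<And>i. i \<in> F \<Longrightarrow> (f i has_sum s i) X"
  shows "((\<lambda>x. \<Sum>i\<in>F. f i x) has_sum (\<Sum>i\<in>F. s i)) X"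
  using assms by (induction F rule: infinite_finite_induct) (auto intro: has_sum_add)

lemma summable_on_sum:
  fixes f :: "'i \<Rightarrow> 'x \<Rightarrow> 'b::{t2_space, topological_comm_monoid_add}"
  assumes "\<And>i. i \<in> F \<Longrightarrow> f i summable_on X"
  shows "(\<lambda>x. \<Sum>i\<in>F. f i x) summable_on X"
  using has_sum_sum[where s = "\<lambda>i. infsum (f i) X" and f = f and F = F and X = X] assms by (auto intro: has_sum_imp_summable)

section \<open>The reduced input state, and environments of different extensions\<close>

definition input_state :: "(nat \<times> 'a) vec \<Rightarrow> ('a, 'a) opr" where
  "input_state \<phi> a a' = (\<Sum>\<^sub>\<infinity>r. \<phi> (r, a) * cnj (\<phi> (r, a')))"

lemma pure_state_slice:
  assumes "pure_state (UNIV \<times> A) \<phi>" "a \<in> A"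
  shows "(\<lambda>r. (cmod (\<phi> (r, a)))\<^sup>2) summable_on UNIV"
proof -
  have "(\<lambda>(r, a). (cmod (\<phi> (r, a)))\<^sup>2) summable_on UNIV \<times> A"
    using assms(1) by (auto simp: pure_state_def ell2_def case_prod_unfold)
  from ell2_slices(3)[OF this assms(2)] show ?thesis .
qed

lemma pure_state_correlation_summable:
  assumes "pure_state (UNIV \<times> A) \<phi>" "a \<in> A" "a' \<in> A"
  shows "(\<lambda>r. \<phi> (r, a) * cnj (\<phi> (r, a'))) summable_on UNIV"
  by (rule abs_summable_summable, rule infsum_Cauchy_Schwarz(1))
    (use pure_state_slice[OF assms(1)] assms(2,3) in auto)

lemma conjugate_by_input_state:
  assumes \<phi>: "pure_state (UNIV \<times> A) \<phi>"
  shows "(\<Sum>\<^sub>\<infinity>r. (\<Sum>a\<in>A. U x a * \<phi> (r, a)) * cnj (\<Sum>a\<in>A. U y a * \<phi> (r, a)))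
    = conjugate_by A U (input_state \<phi>) x y"
proof -
  have "(\<Sum>\<^sub>\<infinity>r. (\<Sum>a\<in>A. U x a * \<phi> (r, a)) * cnj (\<Sum>a\<in>A. U y a * \<phi> (r, a)))
      = (\<Sum>\<^sub>\<infinity>r. \<Sum>a\<in>A. \<Sum>a'\<in>A. U x a * cnj (U y a') * (\<phi> (r, a) * cnj (\<phi> (r, a'))))"
    by (simp add: sum_product mult_ac)
  also have "\<dots> = (\<Sum>a\<in>A. \<Sum>a'\<in>A. U x a * cnj (U y a') * input_state \<phi> a a')"
    unfolding input_state_def
    by (intro infsumI has_sum_sum has_sum_cmult_right has_sum_infsum pure_state_correlation_summable[OF \<phi>])
  finally show ?thesis by (simp add: conjugate_by_def mult_ac)
qed

lemma ptrace_left_apply_to_input: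
  assumes "pure_state (UNIV \<times> A) \<phi>"
  shows "ptrace_left UNIV (projector (apply_to_input A U \<phi>)) = conjugate_by A U (input_state \<phi>)"
  by (intro ext) (simp only: conjugate_by_input_state[OF assms, symmetric] ptrace_left_def
      projector_def apply_to_input_def case_prod_conv)

lemma isometry_column_summable:
  assumes "isometry A B U" "a \<in> A"
  shows "(\<lambda>b. (cmod (U b a))\<^sup>2) summable_on B"
proof -
  have "(\<lambda>b. cnj (U b a) * U b a) summable_on B"
    using assms by (auto simp: isometry_def dest: has_sum_imp_summable)
  then have "(\<lambda>b. Re (cnj (U b a) * U b a)) summable_on B" by (rule summable_on_Re)
  then show ?thesis by (simp add: cmod_def power2_eq_square)
qed

lemma norm_sum_square_le:
  assumes "finite A"
  shows "(cmod (\<Sum>a\<in>A. f a))\<^sup>2 \<le> card A * (\<Sum>a\<in>A. (cmod (f a))\<^sup>2)"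
proof -
  have "(cmod (\<Sum>a\<in>A. f a))\<^sup>2 \<le> (\<Sum>a\<in>A. 1 * cmod (f a))\<^sup>2"
    by (intro power_mono) (auto intro: norm_sum)
  also have "\<dots> \<le> (\<Sum>a\<in>A. 1\<^sup>2) * (\<Sum>a\<in>A. (cmod (f a))\<^sup>2)" by (rule Cauchy_Schwarz_ineq_sum)
  finally show ?thesis by simp
qed

lemma conjugate_by_matrix_unit:
  assumes "finite A" "a \<in> A" "a' \<in> A"
  shows "conjugate_by A U (matrix_unit a a') x y = U x a * cnj (U y a')"
proof -
  have "conjugate_by A U (matrix_unit a a') x y
    = (\<Sum>c\<in>A. if c = a then (\<Sum>c'\<in>A. if c' = a' then U x c * cnj (U y c') else 0) else 0)"
    unfolding conjugate_by_def matrix_unit_def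
    by (intro sum.cong refl) (use assms(1) in \<open>auto simp del: sum.delta sum.delta' intro!: sum.cong\<close>)
  then show ?thesis using assms by simp
qed

text \<open>The right-hand matrix is the entrywise conjugate of the state of reference and output.
  It is built from \<open>\<phi>\<close> and \<open>N\<close> and mentions neither \<open>U\<close>
  nor \<open>E\<close>, so two extensions with different environments can be compared through
  it.\<close>

lemma multiplicity_environment:
  assumes A: "finite A" and ext: "isometric_extension A B E U N" and \<phi>: "pure_state (UNIV \<times> A) \<phi>" and p: "p \<noteq> 0"
  shows "multiplicity E (ptrace_left B (conjugate_by A U (input_state \<phi>))) p
    = multiplicity (UNIV \<times> B) (\<lambda>(r, b) (r', b'). \<Sum>a\<in>A. \<Sum>a'\<in>A.
        cnj (\<phi> (r, a)) * \<phi> (r', a') * cnj (N (matrix_unit a a') b b')) p"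
proof -
  have iso: "isometry A (B \<times> E) U" using ext by (simp add: isometric_extension_def)
  \<comment> \<open>The conjugate makes \<open>col_gram\<close> the environment state itself instead
    of its transpose.\<close>
  define \<psi> where "\<psi> x e = cnj (\<Sum>a\<in>A. U (snd x, e) a * \<phi> (fst x, a))" for x e
  have sq: "(\<lambda>((r, b), e). (cmod (U (b, e) a * \<phi> (r, a)))\<^sup>2) summable_on (UNIV \<times> B) \<times> E" if a: "a \<in> A" for a
  proof -
    have "(\<lambda>(r, be). (cmod (\<phi> (r, a) * U be a))\<^sup>2) summable_on UNIV \<times> (B \<times> E)"
      by (rule summable_on_product_squares pure_state_slice[OF \<phi> a] isometry_column_summable[OF iso a])+
    also have "?this \<longleftrightarrow> ?thesis"
      by (rule summable_on_reindex_bij_witness[of _ "\<lambda>((r, b), e). (r, (b, e))" "\<lambda>(r, (b, e)). ((r, b), e)"])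
        (auto simp: mult.commute)
    finally show ?thesis .
  qed
  have \<psi>2: "(\<lambda>(x, e). (cmod (\<psi> x e))\<^sup>2) summable_on (UNIV \<times> B) \<times> E"
  proof (rule summable_on_comparison_test)
    show "(\<lambda>z. card A * (\<Sum>a\<in>A. (\<lambda>((r, b), e). (cmod (U (b, e) a * \<phi> (r, a)))\<^sup>2) z)) summable_on (UNIV \<times> B) \<times> E"
      by (intro summable_on_cmult_right summable_on_sum sq)
    fix z :: "(nat \<times> _) \<times> _"
    show "(case z of (x, e) \<Rightarrow> (cmod (\<psi> x e))\<^sup>2) \<le> card A * (\<Sum>a\<in>A. (\<lambda>((r, b), e). (cmod (U (b, e) a * \<phi> (r, a)))\<^sup>2) z)"
      using norm_sum_square_le[OF A, of "\<lambda>a. U (snd (fst z), snd z) a * \<phi> (fst (fst z), a)"]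
      unfolding \<psi>_def complex_mod_cnj case_prod_unfold by simp
  qed (auto simp: case_prod_unfold)
  note gram = multiplicity_gram[OF \<psi>2 p]
  have "multiplicity E (ptrace_left B (conjugate_by A U (input_state \<phi>))) p
    = multiplicity E (\<lambda>e e'. \<Sum>\<^sub>\<infinity>x\<in>UNIV \<times> B. cnj (\<psi> x e) * \<psi> x e') p"
  proof (rule multiplicity_cong)
    fix e e' assume e: "e \<in> E" "e' \<in> E"
    have sl: "(\<lambda>x. (cmod (\<psi> x e))\<^sup>2) summable_on UNIV \<times> B" if "e \<in> E" for e
      using ell2_slices(3)[OF \<psi>2 that] .
    have "(\<lambda>x. cmod (cnj (\<psi> x e) * \<psi> x e')) summable_on UNIV \<times> B"
      by (rule infsum_Cauchy_Schwarz(1)) (use sl e in simp_all)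
    then have "(\<lambda>x. cnj (\<psi> x e) * \<psi> x e') summable_on UNIV \<times> B" by (rule abs_summable_summable)
    then have s: "(\<lambda>(r, b). cnj (\<psi> (r, b) e) * \<psi> (r, b) e') summable_on UNIV \<times> B"
      by (simp add: case_prod_unfold)
    have "(\<Sum>\<^sub>\<infinity>x\<in>UNIV \<times> B. cnj (\<psi> x e) * \<psi> x e') = (\<Sum>\<^sub>\<infinity>(r, b)\<in>UNIV \<times> B. cnj (\<psi> (r, b) e) * \<psi> (r, b) e')"
      by (simp add: case_prod_unfold)
    also have "\<dots> = (\<Sum>\<^sub>\<infinity>r. \<Sum>\<^sub>\<infinity>b\<in>B. cnj (\<psi> (r, b) e) * \<psi> (r, b) e')"
      using infsum_Sigma'_banach[OF s] by simp
    also have "\<dots> = (\<Sum>\<^sub>\<infinity>b\<in>B. \<Sum>\<^sub>\<infinity>r. cnj (\<psi> (r, b) e) * \<psi> (r, b) e')"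
      by (rule infsum_swap_banach[OF s])
    also have "\<dots> = ptrace_left B (conjugate_by A U (input_state \<phi>)) e e'"
      unfolding ptrace_left_def conjugate_by_input_state[OF \<phi>, symmetric] by (simp add: \<psi>_def)
    finally show "ptrace_left B (conjugate_by A U (input_state \<phi>)) e e' = (\<Sum>\<^sub>\<infinity>x\<in>UNIV \<times> B. cnj (\<psi> x e) * \<psi> x e')"
      by simp
  qed
  also have "\<dots> = multiplicity (UNIV \<times> B) (\<lambda>x x'. \<Sum>\<^sub>\<infinity>e\<in>E. \<psi> x e * cnj (\<psi> x' e)) p"
    using gram by simp
  also have "\<dots> = multiplicity (UNIV \<times> B) (\<lambda>(r, b) (r', b'). \<Sum>a\<in>A. \<Sum>a'\<in>A.
        cnj (\<phi> (r, a)) * \<phi> (r', a') * cnj (N (matrix_unit a a') b b')) p"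
  proof (rule multiplicity_cong, clarify)
    fix r r' :: nat and b b' assume b: "b \<in> B" "b' \<in> B"
    have row: "(\<lambda>e. (cmod (U (b, e) a))\<^sup>2) summable_on E" if "a \<in> A" "b \<in> B" for a b
      using ell2_slices(2)[of "\<lambda>b e. U (b, e) a" B E] isometry_column_summable[OF iso that(1)] that(2)
      by (simp add: case_prod_unfold)
    have s: "(\<lambda>e. cnj (U (b, e) a) * U (b', e) a') summable_on E" if "a \<in> A" "a' \<in> A" for a a'
      by (rule abs_summable_summable, rule infsum_Cauchy_Schwarz(1)) (use row b that in simp_all)
    have N: "cnj (N (matrix_unit a a') b b') = (\<Sum>\<^sub>\<infinity>e\<in>E. cnj (U (b, e) a) * U (b', e) a')" if a: "a \<in> A" "a' \<in> A" for a a'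
    proof -
      have "N (matrix_unit a a') b b' = (\<Sum>\<^sub>\<infinity>e\<in>E. conjugate_by A U (matrix_unit a a') (b, e) (b', e))"
        using ext b by (simp add: isometric_extension_def ptrace_right_def)
      then show ?thesis using a A by (simp add: conjugate_by_matrix_unit infsum_cnj[symmetric])
    qed
    have "(\<Sum>\<^sub>\<infinity>e\<in>E. \<psi> (r, b) e * cnj (\<psi> (r', b') e))
      = (\<Sum>\<^sub>\<infinity>e\<in>E. \<Sum>a\<in>A. \<Sum>a'\<in>A. cnj (\<phi> (r, a)) * \<phi> (r', a') * (cnj (U (b, e) a) * U (b', e) a'))"
      unfolding \<psi>_def fst_conv snd_conv cnj_sum complex_cnj_cnj sum_product
      by (simp add: mult_ac)
    also have "\<dots> = (\<Sum>a\<in>A. \<Sum>a'\<in>A. cnj (\<phi> (r, a)) * \<phi> (r', a') * (\<Sum>\<^sub>\<infinity>e\<in>E. cnj (U (b, e) a) * U (b', e) a'))"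
      by (intro infsumI has_sum_sum has_sum_cmult_right has_sum_infsum s)
    also have "\<dots> = (\<Sum>a\<in>A. \<Sum>a'\<in>A. cnj (\<phi> (r, a)) * \<phi> (r', a') * cnj (N (matrix_unit a a') b b'))"
      by (intro sum.cong refl) (simp add: N)
    finally show "(\<Sum>\<^sub>\<infinity>e\<in>E. \<psi> (r, b) e * cnj (\<psi> (r', b') e))
      = (\<Sum>a\<in>A. \<Sum>a'\<in>A. cnj (\<phi> (r, a)) * \<phi> (r', a') * cnj (N (matrix_unit a a') b b'))" .
  qed
  finally show ?thesis .
qed

text \<open>Lets an explicit extension \<open>V\<close>, with any convenient environment, stand in
  for the unknown extension over \<open>nat\<close> selected by the definition of the
  capacity.\<close>

theorem coherent_information_eq:
  assumes A: "finite A" and \<phi>: "pure_state (UNIV \<times> A) \<phi>"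
    and U: "isometric_extension A B UNIV U N" and V: "isometric_extension A B E V N"
  shows "coherent_information A B U \<phi>
    = vn_entropy B (N (input_state \<phi>)) - vn_entropy E (ptrace_left B (conjugate_by A V (input_state \<phi>)))"
proof -
  have "vn_entropy B (ptrace_right UNIV (conjugate_by A U (input_state \<phi>))) = vn_entropy B (N (input_state \<phi>))"
    by (rule vn_entropy_cong) (use U in \<open>simp add: isometric_extension_def\<close>)
  moreover have "vn_entropy UNIV (ptrace_left B (conjugate_by A U (input_state \<phi>)))
      = vn_entropy E (ptrace_left B (conjugate_by A V (input_state \<phi>)))"
    unfolding vn_entropy_def
    by (intro infsum_cong) (simp add: multiplicity_environment[OF A U \<phi>] multiplicity_environment[OF A V \<phi>])
  ultimately show ?thesis
    by (simp add: coherent_information_def Let_def ptrace_left_apply_to_input[OF \<phi>])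
qed

lemma input_state_trace:
  assumes A: "finite A" and \<phi>: "pure_state (UNIV \<times> A) \<phi>"
  shows "(\<Sum>a\<in>A. input_state \<phi> a a) = 1"
proof -
  have h: "((\<lambda>(r, a). (cmod (\<phi> (r, a)))\<^sup>2) has_sum 1) (UNIV \<times> A)"
    using \<phi> by (simp add: pure_state_def case_prod_unfold)
  have "((\<lambda>r. \<Sum>a\<in>A. (cmod (\<phi> (r, a)))\<^sup>2) has_sum 1) UNIV"
    by (rule has_sum_SigmaD[OF h]) (use A in \<open>simp add: has_sum_finiteI\<close>)
  then have "((\<lambda>r. complex_of_real (\<Sum>a\<in>A. (cmod (\<phi> (r, a)))\<^sup>2)) has_sum of_real 1) UNIV"
    by (rule has_sum_of_real)
  moreover have "((\<lambda>r. \<Sum>a\<in>A. \<phi> (r, a) * cnj (\<phi> (r, a))) has_sum (\<Sum>a\<in>A. input_state \<phi> a a)) UNIV"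
    unfolding input_state_def
    by (intro has_sum_sum has_sum_infsum pure_state_correlation_summable[OF \<phi>])
  ultimately show ?thesis
    unfolding of_real_sum complex_norm_square of_real_1 using has_sum_unique by blast
qed

lemma input_state_psd:
  assumes A: "finite A" and \<phi>: "pure_state (UNIV \<times> A) \<phi>"
  shows "(\<Sum>a\<in>A. \<Sum>a'\<in>A. x a * input_state \<phi> a a' * cnj (x a')) \<in> \<real>"
    and "Re (\<Sum>a\<in>A. \<Sum>a'\<in>A. x a * input_state \<phi> a a' * cnj (x a')) \<ge> 0"
proof -
  have "((\<lambda>r. \<Sum>a\<in>A. \<Sum>a'\<in>A. (x a * cnj (x a')) * (\<phi> (r, a) * cnj (\<phi> (r, a'))))
      has_sum (\<Sum>a\<in>A. \<Sum>a'\<in>A. (x a * cnj (x a')) * input_state \<phi> a a')) UNIV"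
    unfolding input_state_def
    by (intro has_sum_sum has_sum_cmult_right has_sum_infsum pure_state_correlation_summable[OF \<phi>])
  also have "(\<lambda>r. \<Sum>a\<in>A. \<Sum>a'\<in>A. (x a * cnj (x a')) * (\<phi> (r, a) * cnj (\<phi> (r, a'))))
      = (\<lambda>r. complex_of_real ((cmod (\<Sum>a\<in>A. x a * \<phi> (r, a)))\<^sup>2))"
    unfolding complex_norm_square by (simp add: sum_product mult_ac)
  also have "(\<Sum>a\<in>A. \<Sum>a'\<in>A. (x a * cnj (x a')) * input_state \<phi> a a')
      = (\<Sum>a\<in>A. \<Sum>a'\<in>A. x a * input_state \<phi> a a' * cnj (x a'))" (is "_ = ?S")
    by (simp add: mult_ac)
  finally have h: "((\<lambda>r. complex_of_real ((cmod (\<Sum>a\<in>A. x a * \<phi> (r, a)))\<^sup>2)) has_sum ?S) UNIV" .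
  from has_sum_Im[OF this] have "((\<lambda>r::nat. 0) has_sum Im ?S) UNIV"
    unfolding Im_complex_of_real .
  moreover have "((\<lambda>r::nat. 0::real) has_sum 0) UNIV" by (rule has_sum_0) simp
  ultimately have "Im ?S = 0" by (rule has_sum_unique)
  then show "?S \<in> \<real>" by (simp add: complex_is_Real_iff)
  from has_sum_Re[OF h] show "Re ?S \<ge> 0" by (rule has_sum_nonneg) auto
qed

subsection \<open>Sums of products over words\<close>

text \<open>The letter set may vary with the position, since a block of several uses prescribes a
  separate photon number at each position.\<close>

definition pwords :: "nat \<Rightarrow> (nat \<Rightarrow> 'a set) \<Rightarrow> 'a list set" where
  "pwords n S = {w. length w = n \<and> (\<forall>i<n. w ! i \<in> S i)}"

lemma words_eq_pwords: "words n A = pwords n (\<lambda>_. A)"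
  by (auto simp: words_def pwords_def subset_iff in_set_conv_nth)

text \<open>A product of infinite sums is expanded one letter at a time. Absolute summability is
  part of the induction claim because splitting off the first letter is a Fubini step.\<close>

lemma has_sum_pwords:
  fixes f :: "nat \<Rightarrow> 'a \<Rightarrow> 'b::{real_normed_field, banach}"
  assumes "\<And>i. i < n \<Longrightarrow> (f i has_sum s i) (S i)" "\<And>i. i < n \<Longrightarrow> (\<lambda>x. norm (f i x)) summable_on S i"
  shows "((\<lambda>w. \<Prod>i<n. f i (w ! i)) has_sum (\<Prod>i<n. s i)) (pwords n S)
    \<and> (\<lambda>w. norm (\<Prod>i<n. f i (w ! i))) summable_on pwords n S"
  using assms
proof (induction n arbitrary: f s S)
  case 0
  have "pwords 0 S = {[]}" by (auto simp: pwords_def)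
  then show ?case by (simp add: has_sum_finiteI)
next
  case (Suc n)
  define g where "g w = (\<Prod>i<n. f (Suc i) (w ! i))" for w
  let ?W = "pwords n (\<lambda>i. S (Suc i))"
  have IH: "(g has_sum (\<Prod>i<n. s (Suc i))) ?W" "(\<lambda>w. norm (g w)) summable_on ?W"
    using Suc.IH[where f = "\<lambda>i. f (Suc i)" and s = "\<lambda>i. s (Suc i)" and S = "\<lambda>i. S (Suc i)"] Suc.prems unfolding g_def by auto
  have bij: "bij_betw (\<lambda>(x, w). x # w) (S 0 \<times> ?W) (pwords (Suc n) S)"
  proof (rule bij_betwI[of _ _ _ "\<lambda>w. (hd w, tl w)"])
    show "(\<lambda>(x, w). x # w) \<in> S 0 \<times> ?W \<rightarrow> pwords (Suc n) S"
      by (auto simp: pwords_def less_Suc_eq_0_disj)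
    show "(\<lambda>w. (hd w, tl w)) \<in> pwords (Suc n) S \<rightarrow> S 0 \<times> ?W"
    proof
      fix w assume "w \<in> pwords (Suc n) S"
      then have w: "length w = Suc n" "\<And>i. i < Suc n \<Longrightarrow> w ! i \<in> S i" by (auto simp: pwords_def)
      then obtain x v where "w = x # v" by (cases w) auto
      with w(1) w(2)[of 0] w(2)[of "Suc _"] show "(hd w, tl w) \<in> S 0 \<times> ?W"
        by (auto simp: pwords_def)
    qed
    show "\<And>w. w \<in> pwords (Suc n) S \<Longrightarrow> (\<lambda>(x, w). x # w) (hd w, tl w) = w"
      by (auto simp: pwords_def length_Suc_conv)
  qed auto
  have prod: "(\<Prod>i<Suc n. f i ((x # w) ! i)) = f 0 x * g w" for x w
    unfolding g_def by (subst prod.lessThan_Suc_shift) simp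
  have abs: "(\<lambda>(x, w). norm (f 0 x * g w)) summable_on S 0 \<times> ?W"
  proof (rule summable_on_SigmaI)
    show "((\<lambda>w. case (x, w) of (x, w) \<Rightarrow> norm (f 0 x * g w)) has_sum norm (f 0 x) * (\<Sum>\<^sub>\<infinity>w\<in>?W. norm (g w))) ?W" for x
      using IH(2) by (simp add: norm_mult has_sum_cmult_right)
    show "(\<lambda>x. norm (f 0 x) * (\<Sum>\<^sub>\<infinity>w\<in>?W. norm (g w))) summable_on S 0"
      using Suc.prems(2) by (intro summable_on_cmult_left) simp
  qed auto
  have "((\<lambda>(x, w). f 0 x * g w) has_sum (\<Prod>i<Suc n. s i)) (S 0 \<times> ?W)"
  proof (rule has_sum_SigmaI)
    show "((\<lambda>w. case (x, w) of (x, w) \<Rightarrow> f 0 x * g w) has_sum f 0 x * (\<Prod>i<n. s (Suc i))) ?W" for x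
      using IH(1) by (simp add: has_sum_cmult_right)
    show "((\<lambda>x. f 0 x * (\<Prod>i<n. s (Suc i))) has_sum (\<Prod>i<Suc n. s i)) (S 0)"
      using Suc.prems(1)[of 0] by (subst prod.lessThan_Suc_shift) (simp add: has_sum_cmult_left)
    show "(\<lambda>(x, w). f 0 x * g w) summable_on S 0 \<times> ?W"
      by (rule abs_summable_summable) (use abs in \<open>simp add: case_prod_unfold\<close>)
  qed
  then have "((\<lambda>z. \<Prod>i<Suc n. f i ((case z of (x, w) \<Rightarrow> x # w) ! i)) has_sum (\<Prod>i<Suc n. s i)) (S 0 \<times> ?W)"
    by (simp only: prod case_prod_unfold)
  moreover have "(\<lambda>z. norm (\<Prod>i<Suc n. f i ((case z of (x, w) \<Rightarrow> x # w) ! i))) summable_on (S 0 \<times> ?W)"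
    using abs by (simp only: prod case_prod_unfold)
  ultimately show ?case
    using has_sum_reindex_bij_betw[OF bij, of "\<lambda>w. \<Prod>i<Suc n. f i (w ! i)"]
      summable_on_reindex_bij_betw[OF bij, of "\<lambda>w. norm (\<Prod>i<Suc n. f i (w ! i))"] by blast
qed

lemma finite_pwords: "finite (pwords n S)" if "\<And>i. i < n \<Longrightarrow> finite (S i)"
proof (rule finite_subset)
  show "pwords n S \<subseteq> {w. set w \<subseteq> (\<Union>i<n. S i) \<and> length w = n}"
    by (fastforce simp: pwords_def in_set_conv_nth)
  show "finite {w. set w \<subseteq> (\<Union>i<n. S i) \<and> length w = n}"
    using that by (intro finite_lists_length_eq) auto
qed

lemma sum_pwords:
  fixes f :: "nat \<Rightarrow> 'a \<Rightarrow> 'b::{real_normed_field, banach}"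
  assumes "\<And>i. i < n \<Longrightarrow> finite (S i)"
  shows "(\<Sum>w\<in>pwords n S. \<Prod>i<n. f i (w ! i)) = (\<Prod>i<n. \<Sum>x\<in>S i. f i x)"
proof -
  have "((\<lambda>w. \<Prod>i<n. f i (w ! i)) has_sum (\<Prod>i<n. \<Sum>x\<in>S i. f i x)) (pwords n S)"
    using has_sum_pwords[where s = "\<lambda>i. \<Sum>x\<in>S i. f i x" and f = f and S = S] assms by (simp add: has_sum_finiteI)
  then show ?thesis using finite_pwords[of n S] assms by (simp add: has_sum_finite_iff)
qed

subsection \<open>Entropy under a positive map with a covariant normalisation\<close>

text \<open>The tangent of \<open>x log x\<close> at \<open>m\<close> lies below the graph, by
  \<open>ln t \<le> t - 1\<close> at \<open>t = m / x\<close>; the point \<open>x = 0\<close> is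
  included.\<close>

lemma xlogx_tangent:
  fixes x m :: real
  assumes "x \<ge> 0" "m > 0"
  shows "x * log 2 x \<ge> x * log 2 m + (x - m) / ln 2"
proof (cases "x = 0")
  case False
  with assms have x: "x > 0" by simp
  have "ln (m / x) \<le> m / x - 1" using x assms by (intro ln_le_minus_one) simp
  then have "x * (ln m - ln x) \<le> x * (m / x - 1)"
    using x assms by (intro mult_left_mono) (simp_all add: ln_div)
  also have "\<dots> = m - x" using x by (simp add: field_simps)
  finally have "x * ln x \<ge> x * ln m + (x - m)" by (simp add: algebra_simps)
  then have "x * ln x / ln 2 \<ge> (x * ln m + (x - m)) / ln 2" by (intro divide_right_mono) auto
  then show ?thesis by (simp add: log_def add_divide_distrib)
qed (use assms in \<open>simp add: divide_nonpos_pos\<close>)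

text \<open>Jensen's inequality for \<open>x log x\<close>: \<open>mu j / c\<close> is the mean of
  \<open>lam\<close> with weights \<open>W j i / c\<close>. Summing over \<open>j\<close> collapses
  the right-hand side because columns sum to 1, and the scaling by \<open>c\<close> leaves the term
  with \<open>log 2 c\<close>.\<close>

lemma entropy_doubly_stochastic:
  fixes W :: "'j \<Rightarrow> 'i \<Rightarrow> real"
  assumes "finite I" "finite J" and c: "c > 0"
    and W: "\<And>i j. i \<in> I \<Longrightarrow> j \<in> J \<Longrightarrow> W j i \<ge> 0"
    and col: "\<And>i. i \<in> I \<Longrightarrow> (\<Sum>j\<in>J. W j i) = 1" and row: "\<And>j. j \<in> J \<Longrightarrow> (\<Sum>i\<in>I. W j i) = c"
    and lam: "\<And>i. i \<in> I \<Longrightarrow> lam i \<ge> 0" and mu: "\<And>j. j \<in> J \<Longrightarrow> mu j = (\<Sum>i\<in>I. W j i * lam i)"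
  shows "\<And>j. j \<in> J \<Longrightarrow> mu j \<ge> 0" and "sum mu J = sum lam I"
    and "(\<Sum>i\<in>I. eta (lam i)) \<le> (\<Sum>j\<in>J. eta (mu j)) + log 2 c * (\<Sum>i\<in>I. lam i)"
proof -
  show mu0: "mu j \<ge> 0" if "j \<in> J" for j
    using that by (auto simp: mu intro!: sum_nonneg mult_nonneg_nonneg W lam)
  have sum_col: "(\<Sum>j\<in>J. \<Sum>i\<in>I. W j i * f i) = (\<Sum>i\<in>I. f i)" for f :: "'i \<Rightarrow> real"
    by (subst sum.swap) (simp add: sum_distrib_right[symmetric] col)
  show smu: "sum mu J = sum lam I" using sum_col[of lam] by (simp add: mu)
  have "mu j * (log 2 (mu j) - log 2 c) \<le> (\<Sum>i\<in>I. W j i * (lam i * log 2 (lam i)))" if j: "j \<in> J" for j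
  proof (cases "mu j = 0")
    case True
    then have "W j i * lam i = 0" if "i \<in> I" for i
      using that j W lam assms(1) by (simp add: mu sum_nonneg_eq_0_iff)
    then have "(\<Sum>i\<in>I. W j i * (lam i * log 2 (lam i))) = 0" by (intro sum.neutral) auto
    then show ?thesis using True by simp
  next
    case False
    with mu0[OF j] have pos: "mu j > 0" by simp
    define m where "m = mu j / c"
    have m: "m > 0" using pos c by (simp add: m_def)
    \<comment> \<open>The added fraction is 0, as row \<open>j\<close> sums to \<open>c\<close> and
      \<open>m = mu j / c\<close>; it is inserted to match the tangent line.\<close>
    have "mu j * log 2 m = (\<Sum>i\<in>I. W j i * lam i) * log 2 m + ((\<Sum>i\<in>I. W j i * lam i) - (\<Sum>i\<in>I. W j i) * m) / ln 2"
      using row[OF j] mu[OF j] c by (simp add: m_def)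
    also have "\<dots> = (\<Sum>i\<in>I. W j i * (lam i * log 2 m + (lam i - m) / ln 2))"
      by (simp add: ring_distribs sum.distrib sum_distrib_right sum_divide_distrib sum_subtractf diff_divide_distrib mult.assoc)
    also have "\<dots> \<le> (\<Sum>i\<in>I. W j i * (lam i * log 2 (lam i)))"
      using j by (intro sum_mono mult_left_mono xlogx_tangent W lam m)
    finally show ?thesis using pos c by (simp add: m_def log_divide)
  qed
  then have "(\<Sum>j\<in>J. mu j * (log 2 (mu j) - log 2 c)) \<le> (\<Sum>j\<in>J. \<Sum>i\<in>I. W j i * (lam i * log 2 (lam i)))"
    by (intro sum_mono)
  also have "\<dots> = (\<Sum>i\<in>I. lam i * log 2 (lam i))" by (rule sum_col)
  also have "(\<Sum>j\<in>J. mu j * (log 2 (mu j) - log 2 c)) = - (\<Sum>j\<in>J. eta (mu j)) - log 2 c * (\<Sum>i\<in>I. lam i)"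
    by (simp add: eta_def smu[symmetric] right_diff_distrib sum_subtractf sum_negf sum_distrib_right mult.commute[of "log 2 c"])
  finally show "(\<Sum>i\<in>I. eta (lam i)) \<le> (\<Sum>j\<in>J. eta (mu j)) + log 2 c * (\<Sum>i\<in>I. lam i)"
    by (simp add: eta_def sum_negf)
qed

lemma eigenvalue_quadratic_form:
  assumes "finite E"
    and u: "\<And>k l. k \<in> E \<Longrightarrow> l \<in> E \<Longrightarrow> (\<Sum>i\<in>E. cnj (u k i) * u l i) = (if k = l then 1 else 0)"
      "\<And>i j. i \<in> E \<Longrightarrow> j \<in> E \<Longrightarrow> SE i j = (\<Sum>k\<in>E. of_real (mu k) * u k i * cnj (u k j))"
    and j: "j \<in> E"
  shows "complex_of_real (mu j) = (\<Sum>e\<in>E. \<Sum>e'\<in>E. cnj (u j e) * SE e e' * u j e')"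
proof -
  have "(\<Sum>e\<in>E. \<Sum>e'\<in>E. cnj (u j e) * SE e e' * u j e')
    = (\<Sum>e\<in>E. \<Sum>e'\<in>E. \<Sum>k\<in>E. of_real (mu k) * (cnj (u j e) * u k e) * (cnj (u k e') * u j e'))"
    by (intro sum.cong refl) (simp add: u(2) sum_distrib_left sum_distrib_right mult_ac)
  also have "\<dots> = (\<Sum>k\<in>E. of_real (mu k) * (\<Sum>e\<in>E. cnj (u j e) * u k e) * (\<Sum>e'\<in>E. cnj (u k e') * u j e'))"
  proof -
    have "(\<Sum>e\<in>E. \<Sum>e'\<in>E. \<Sum>k\<in>E. of_real (mu k) * (cnj (u j e) * u k e) * (cnj (u k e') * u j e'))
      = (\<Sum>e\<in>E. \<Sum>k\<in>E. \<Sum>e'\<in>E. of_real (mu k) * (cnj (u j e) * u k e) * (cnj (u k e') * u j e'))"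
      by (rule sum.cong[OF refl], rule sum.swap)
    also have "\<dots> = (\<Sum>k\<in>E. \<Sum>e\<in>E. \<Sum>e'\<in>E. of_real (mu k) * (cnj (u j e) * u k e) * (cnj (u k e') * u j e'))"
      by (rule sum.swap)
    finally show ?thesis
      by (simp only: mult.assoc[of "of_real _"] sum_product) (simp only: sum_distrib_left)
  qed
  also have "\<dots> = (\<Sum>k\<in>E. if k = j then of_real (mu k) else 0)"
    by (intro sum.cong refl) (use j in \<open>auto simp: u(1)\<close>)
  also have "\<dots> = of_real (mu j)" using assms(1) j by simp
  finally show ?thesis by simp
qed

lemma sum_swap4:
  "(\<Sum>j\<in>J. \<Sum>a\<in>A. \<Sum>b\<in>B. \<Sum>c\<in>C. \<Sum>d\<in>D. f j a b c d)
    = (\<Sum>a\<in>A. \<Sum>b\<in>B. \<Sum>c\<in>C. \<Sum>d\<in>D. \<Sum>j\<in>J. f j a b c d)"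
proof -
  have "(\<Sum>j\<in>J. \<Sum>a\<in>A. \<Sum>b\<in>B. \<Sum>c\<in>C. \<Sum>d\<in>D. f j a b c d)
      = (\<Sum>a\<in>A. \<Sum>j\<in>J. \<Sum>b\<in>B. \<Sum>c\<in>C. \<Sum>d\<in>D. f j a b c d)" by (rule sum.swap)
  also have "\<dots> = (\<Sum>a\<in>A. \<Sum>b\<in>B. \<Sum>j\<in>J. \<Sum>c\<in>C. \<Sum>d\<in>D. f j a b c d)"
    by (intro sum.cong refl) (rule sum.swap)
  also have "\<dots> = (\<Sum>a\<in>A. \<Sum>b\<in>B. \<Sum>c\<in>C. \<Sum>j\<in>J. \<Sum>d\<in>D. f j a b c d)"
    by (intro sum.cong refl) (rule sum.swap)
  also have "\<dots> = (\<Sum>a\<in>A. \<Sum>b\<in>B. \<Sum>c\<in>C. \<Sum>d\<in>D. \<Sum>j\<in>J. f j a b c d)"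
    by (intro sum.cong refl) (rule sum.swap)
  finally show ?thesis .
qed

text \<open>
  \<open>K\<close> are real Kraus operators of a channel with \<open>D(1) = c 1\<close>, and \<open>SE\<close> is the transpose of \<open>D(SB)\<close>.
\<close>

lemma entropy_degraded:
  fixes SB :: "('b, 'b) opr" and SE :: "('e, 'e) opr" and K :: "'k \<Rightarrow> 'e \<Rightarrow> 'b \<Rightarrow> real"
  assumes fin: "finite B" "finite E" "finite X" and c: "c > 0"
    and v: "\<And>k l. k \<in> B \<Longrightarrow> l \<in> B \<Longrightarrow> (\<Sum>i\<in>B. cnj (v k i) * v l i) = (if k = l then 1 else 0)"
      "\<And>i j. i \<in> B \<Longrightarrow> j \<in> B \<Longrightarrow> (\<Sum>k\<in>B. v k i * cnj (v k j)) = (if i = j then 1 else 0)"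
      "\<And>i j. i \<in> B \<Longrightarrow> j \<in> B \<Longrightarrow> SB i j = (\<Sum>k\<in>B. of_real (lam k) * v k i * cnj (v k j))"
    and u: "\<And>k l. k \<in> E \<Longrightarrow> l \<in> E \<Longrightarrow> (\<Sum>i\<in>E. cnj (u k i) * u l i) = (if k = l then 1 else 0)"
      "\<And>i j. i \<in> E \<Longrightarrow> j \<in> E \<Longrightarrow> (\<Sum>k\<in>E. u k i * cnj (u k j)) = (if i = j then 1 else 0)"
      "\<And>i j. i \<in> E \<Longrightarrow> j \<in> E \<Longrightarrow> SE i j = (\<Sum>k\<in>E. of_real (mu k) * u k i * cnj (u k j))"
    and TP: "\<And>b b'. b \<in> B \<Longrightarrow> b' \<in> B \<Longrightarrow> (\<Sum>e\<in>E. \<Sum>x\<in>X. K x e b * K x e b') = (if b = b' then 1 else 0)"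
    and unital: "\<And>e e'. e \<in> E \<Longrightarrow> e' \<in> E \<Longrightarrow> (\<Sum>b\<in>B. \<Sum>x\<in>X. K x e b * K x e' b) = (if e = e' then c else 0)"
    and deg: "\<And>e e'. e \<in> E \<Longrightarrow> e' \<in> E \<Longrightarrow>
      SE e e' = (\<Sum>b\<in>B. \<Sum>b'\<in>B. of_real (\<Sum>x\<in>X. K x e' b * K x e b') * SB b b')"
    and lam: "\<And>i. i \<in> B \<Longrightarrow> lam i \<ge> 0"
  shows "\<And>j. j \<in> E \<Longrightarrow> mu j \<ge> 0" and "sum mu E = sum lam B"
    and "(\<Sum>i\<in>B. eta (lam i)) \<le> (\<Sum>j\<in>E. eta (mu j)) + log 2 c * (\<Sum>i\<in>B. lam i)"
proof -
  \<comment> \<open>\<open>W j i\<close> is the diagonal entry of the image under \<open>D\<close>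
    of the projector onto \<open>v i\<close>, taken at the conjugate of \<open>u j\<close>;
    conjugate because \<open>SE\<close> is the transpose of \<open>D(SB)\<close>. Trace preservation
    gives column sums 1, and \<open>D(1) = c 1\<close> gives row sums \<open>c\<close>.\<close>
  define y where "y j i x = (\<Sum>e\<in>E. \<Sum>b\<in>B. u j e * v i b * of_real (K x e b))" for j i x
  define W where "W j i = (\<Sum>x\<in>X. (cmod (y j i x))\<^sup>2)" for j i
  define G where "G e b e' b' = complex_of_real (\<Sum>x\<in>X. K x e b * K x e' b')" for e b e' b'
  let ?w = "\<lambda>j i e e' b b'. u j e * cnj (u j e') * (v i b * cnj (v i b'))"
  have W: "of_real (W j i) = (\<Sum>e\<in>E. \<Sum>e'\<in>E. \<Sum>b\<in>B. \<Sum>b'\<in>B.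
      ?w j i e e' b b' * G e b e' b')" for j i
  proof -
    have "of_real (W j i) = (\<Sum>x\<in>X. \<Sum>e\<in>E. \<Sum>e'\<in>E. \<Sum>b\<in>B. \<Sum>b'\<in>B.
        ?w j i e e' b b' * of_real (K x e b * K x e' b'))"
      unfolding W_def of_real_sum complex_norm_square y_def
    proof (rule sum.cong[OF refl])
      fix x
      let ?y = "\<Sum>e\<in>E. \<Sum>b\<in>B. u j e * v i b * of_real (K x e b)"
      have "?y * cnj ?y
        = (\<Sum>e\<in>E. \<Sum>e'\<in>E. (\<Sum>b\<in>B. u j e * v i b * of_real (K x e b)) * cnj (\<Sum>b\<in>B. u j e' * v i b * of_real (K x e' b)))"
        by (simp only: cnj_sum sum_product)
      also have "\<dots> = (\<Sum>e\<in>E. \<Sum>e'\<in>E. \<Sum>b\<in>B. \<Sum>b'\<in>B.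
        ?w j i e e' b b' * of_real (K x e b * K x e' b'))"
        unfolding cnj_sum sum_product by (simp add: mult_ac)
      finally show "?y * cnj ?y = \<dots>" .
    qed
    also have "\<dots> = (\<Sum>e\<in>E. \<Sum>e'\<in>E. \<Sum>b\<in>B. \<Sum>b'\<in>B. \<Sum>x\<in>X.
        ?w j i e e' b b' * of_real (K x e b * K x e' b'))"
      by (rule sum_swap4)
    finally show ?thesis by (simp add: G_def sum_distrib_left)
  qed
  have col: "(\<Sum>j\<in>E. W j i) = 1" if i: "i \<in> B" for i
  proof -
    have "complex_of_real (\<Sum>j\<in>E. W j i) = (\<Sum>e\<in>E. \<Sum>e'\<in>E. \<Sum>b\<in>B. \<Sum>b'\<in>B. \<Sum>j\<in>E.
        ?w j i e e' b b' * G e b e' b')"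
      unfolding of_real_sum W by (rule sum_swap4)
    also have "\<dots> = (\<Sum>e\<in>E. \<Sum>e'\<in>E. \<Sum>b\<in>B. \<Sum>b'\<in>B. (if e = e' then v i b * cnj (v i b') * G e b e' b' else 0))"
      by (intro sum.cong refl) (simp add: u(2) sum_distrib_right[symmetric])
    also have "\<dots> = (\<Sum>e\<in>E. \<Sum>b\<in>B. \<Sum>b'\<in>B. v i b * cnj (v i b') * G e b e b')"
    proof (rule sum.cong[OF refl])
      fix e assume e: "e \<in> E"
      have "(\<Sum>e'\<in>E. \<Sum>b\<in>B. \<Sum>b'\<in>B. (if e = e' then v i b * cnj (v i b') * G e b e' b' else 0))
        = (\<Sum>e'\<in>E. if e = e' then \<Sum>b\<in>B. \<Sum>b'\<in>B. v i b * cnj (v i b') * G e b e' b' else 0)"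
        by (intro sum.cong refl) auto
      then show "(\<Sum>e'\<in>E. \<Sum>b\<in>B. \<Sum>b'\<in>B. (if e = e' then v i b * cnj (v i b') * G e b e' b' else 0))
        = (\<Sum>b\<in>B. \<Sum>b'\<in>B. v i b * cnj (v i b') * G e b e b')" using fin e by simp
    qed
    also have "\<dots> = (\<Sum>b\<in>B. \<Sum>b'\<in>B. v i b * cnj (v i b') * (\<Sum>e\<in>E. G e b e b'))"
      unfolding sum_distrib_left
      by (subst sum.swap, intro sum.cong refl, subst sum.swap) (rule refl)
    also have "\<dots> = (\<Sum>b\<in>B. \<Sum>b'\<in>B. if b = b' then v i b * cnj (v i b') else 0)"
      by (intro sum.cong refl) (simp add: G_def TP flip: of_real_sum)
    also have "\<dots> = 1" using fin v(1)[OF i i] by (simp add: mult.commute)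
    finally show ?thesis using of_real_eq_1_iff by blast
  qed
  have row: "(\<Sum>i\<in>B. W j i) = c" if j: "j \<in> E" for j
  proof -
    have "complex_of_real (\<Sum>i\<in>B. W j i) = (\<Sum>e\<in>E. \<Sum>e'\<in>E. \<Sum>b\<in>B. \<Sum>b'\<in>B. \<Sum>i\<in>B.
        ?w j i e e' b b' * G e b e' b')"
      unfolding of_real_sum W by (rule sum_swap4)
    also have "\<dots> = (\<Sum>e\<in>E. \<Sum>e'\<in>E. \<Sum>b\<in>B. \<Sum>b'\<in>B. u j e * cnj (u j e') * G e b e' b' * (\<Sum>i\<in>B. v i b * cnj (v i b')))"
      by (simp add: sum_distrib_left mult_ac)
    also have "\<dots> = (\<Sum>e\<in>E. \<Sum>e'\<in>E. \<Sum>b\<in>B. \<Sum>b'\<in>B. (if b = b' then u j e * cnj (u j e') * G e b e' b' else 0))"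
      by (intro sum.cong refl) (simp add: v(2))
    also have "\<dots> = (\<Sum>e\<in>E. \<Sum>e'\<in>E. u j e * cnj (u j e') * (\<Sum>b\<in>B. G e b e' b))"
      using fin by (simp add: sum_distrib_left)
    also have "\<dots> = (\<Sum>e\<in>E. \<Sum>e'\<in>E. if e = e' then u j e * cnj (u j e') * of_real c else 0)"
      by (intro sum.cong refl) (simp add: G_def unital flip: of_real_sum)
    also have "\<dots> = of_real c * (\<Sum>e\<in>E. cnj (u j e) * u j e)" using fin by (simp add: sum_distrib_left mult_ac)
    also have "\<dots> = of_real c" using u(1)[OF j j] by simp
    finally show ?thesis using of_real_eq_iff by blast
  qed
  have mu: "mu j = (\<Sum>i\<in>B. W j i * lam i)" if j: "j \<in> E" for j
  proof -
    have "of_real (mu j) = (\<Sum>e\<in>E. \<Sum>e'\<in>E. cnj (u j e) * SE e e' * u j e')"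
      using fin(2) u(1,3) j by (rule eigenvalue_quadratic_form)
    also have "\<dots> = (\<Sum>e\<in>E. \<Sum>e'\<in>E. \<Sum>b\<in>B. \<Sum>b'\<in>B. \<Sum>i\<in>B.
        of_real (lam i) * (u j e' * cnj (u j e) * (v i b * cnj (v i b')) * G e' b e b'))"
      by (intro sum.cong refl) (simp add: deg v(3) G_def sum_distrib_left sum_distrib_right mult_ac)
    also have "\<dots> = (\<Sum>i\<in>B. of_real (lam i) * of_real (W j i))"
    proof -
      have "(\<Sum>i\<in>B. of_real (lam i) * of_real (W j i)) = (\<Sum>e'\<in>E. \<Sum>e\<in>E. \<Sum>b\<in>B. \<Sum>b'\<in>B. \<Sum>i\<in>B.
          of_real (lam i) * (u j e' * cnj (u j e) * (v i b * cnj (v i b')) * G e' b e b'))"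
        unfolding W sum_distrib_left by (rule sum_swap4)
      also have "\<dots> = (\<Sum>e\<in>E. \<Sum>e'\<in>E. \<Sum>b\<in>B. \<Sum>b'\<in>B. \<Sum>i\<in>B.
          of_real (lam i) * (u j e' * cnj (u j e) * (v i b * cnj (v i b')) * G e' b e b'))"
        by (rule sum.swap)
      finally show ?thesis by simp
    qed
    finally have "complex_of_real (mu j) = of_real (\<Sum>i\<in>B. W j i * lam i)" by (simp add: mult.commute)
    then show ?thesis using of_real_eq_iff by blast
  qed
  have W0: "W j i \<ge> 0" for i j by (simp add: W_def sum_nonneg)
  show "\<And>j. j \<in> E \<Longrightarrow> mu j \<ge> 0" and "sum mu E = sum lam B"
    and "(\<Sum>i\<in>B. eta (lam i)) \<le> (\<Sum>j\<in>E. eta (mu j)) + log 2 c * (\<Sum>i\<in>B. lam i)"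
    using entropy_doubly_stochastic[OF fin(1,2) c, of W lam mu] W0 col row lam mu by blast+
qed

subsection \<open>One use of the black hole channel\<close>

type_synonym fock = "nat \<times> nat"

definition photons :: "fock \<Rightarrow> nat" where
  "photons b = fst b + snd b"

definition shift :: "fock \<Rightarrow> fock \<Rightarrow> fock" where
  "shift a e = (fst a + fst e, snd a + snd e)"

text \<open>\<open>ladder a b = \<langle>b| a\<^sup>\<dagger> |e\<rangle>\<close> for \<open>b = shift a e\<close>, where \<open>a\<close> names the mode that is raised.\<close>

definition ladder :: "fock \<Rightarrow> fock \<Rightarrow> real" where
  "ladder a b = sqrt (real (if a = (1, 0) then fst b else snd b))"

text \<open>The input-independent factor of block \<open>l\<close>. The cube comes from squaring
  three factors \<open>1 / cosh r\<close>: one from the empty rail and two from the occupied one. At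
  \<open>l = 0\<close> the exponent truncates to 0, but there every ladder factor on an output state
  vanishes.\<close>

definition weight :: "real \<Rightarrow> nat \<Rightarrow> real" where
  "weight r l = (1 - (tanh r)\<^sup>2) ^ 3 * (tanh r)\<^sup>2 ^ (l - 1)"

text \<open>The entry of the two-mode isometry. For one input photon the binomial coefficient is the
  output occupation of that rail, hence the ladder factor; for the empty rail it is 1.\<close>

definition amplitude :: "real \<Rightarrow> fock \<Rightarrow> fock \<Rightarrow> fock \<Rightarrow> real" where
  "amplitude r a b e = (if b = shift a e then (1 / cosh r) ^ 3 * tanh r ^ photons e * ladder a b else 0)"

text \<open>The entry at \<open>b\<close>, \<open>b'\<close> of the channel output on the matrix
  unit of \<open>a\<close>, \<open>a'\<close>. The condition says b - a = b' - a', equality of the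
  two environment states, in additive form; if a difference would be negative, a ladder factor
  vanishes.\<close>

definition out_coeff :: "real \<Rightarrow> fock \<Rightarrow> fock \<Rightarrow> fock \<Rightarrow> fock \<Rightarrow> real" where
  "out_coeff r a a' b b' =
    (if shift a' b = shift a b' then weight r (photons b) * (ladder a b * ladder a' b') else 0)"

definition env_coeff :: "real \<Rightarrow> fock \<Rightarrow> fock \<Rightarrow> fock \<Rightarrow> fock \<Rightarrow> real" where
  "env_coeff r a a' e e' = (if shift a e = shift a' e'
    then weight r (Suc (photons e)) * (ladder a (shift a e) * ladder a' (shift a' e')) else 0)"

lemma dual_rail_cases: "a \<in> dual_rail \<Longrightarrow> (a = (0, 1) \<Longrightarrow> P) \<Longrightarrow> (a = (1, 0) \<Longrightarrow> P) \<Longrightarrow> P"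
  by (auto simp: dual_rail_def)

lemma photons_shift [simp]: "a \<in> dual_rail \<Longrightarrow> photons (shift a e) = Suc (photons e)"
  by (auto simp: photons_def shift_def dual_rail_def)

lemma shift_inj [simp]: "shift a e = shift a e' \<longleftrightarrow> e = e'" "shift a e = shift a' e \<longleftrightarrow> a = a'"
  by (auto simp: shift_def prod_eq_iff)

lemma finite_dual_rail [simp]: "finite dual_rail"
  by (simp add: dual_rail_def)

lemma ladder_nonneg [simp]: "ladder a b \<ge> 0"
  by (simp add: ladder_def)

lemma hawking_isometry2_eq:
  assumes "a \<in> dual_rail"
  shows "hawking_isometry2 r (b, e) a = of_real (amplitude r a b e)"
  using assms
  by (cases b; cases e; elim dual_rail_cases)
    (auto simp: hawking_isometry2_def hawking_isometry_def amplitude_def shift_def ladder_def photons_def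
      power_add power2_eq_square power3_eq_cube mult_ac)

lemma inverse_cosh_square: "(1 / cosh r)\<^sup>2 = 1 - (tanh r)\<^sup>2" for r :: real
proof -
  have "cosh r \<noteq> 0" by (simp add: cosh_real_pos less_imp_neq)
  then show ?thesis
    using hyperbolic_pythagoras[of r] diff_divide_distrib[of "(cosh r)\<^sup>2" "(sinh r)\<^sup>2" "(cosh r)\<^sup>2"]
    by (simp add: tanh_def power_divide)
qed

lemma weight_Suc: "weight r (Suc l) = ((1 / cosh r) ^ 3 * tanh r ^ l)\<^sup>2"
proof -
  have "((1 / cosh r) ^ 3 * tanh r ^ l)\<^sup>2 = ((1 / cosh r)\<^sup>2) ^ 3 * (tanh r)\<^sup>2 ^ l"
    by (simp add: power_mult_distrib flip: power_mult) (simp add: mult.commute)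
  then show ?thesis by (simp only: weight_def inverse_cosh_square) simp
qed

lemma weight_nonneg [simp]: "weight r l \<ge> 0"
proof -
  have "weight r l = weight r (Suc (l - 1))" by (simp add: weight_def)
  then show ?thesis by (simp add: weight_Suc)
qed

lemma amplitude_product:
  assumes "a \<in> dual_rail" "a' \<in> dual_rail"
  shows "amplitude r a b e * amplitude r a' b' e
    = (if b = shift a e \<and> b' = shift a' e then weight r (photons b) * (ladder a b * ladder a' b') else 0)"
  using assms by (auto simp: amplitude_def weight_Suc power2_eq_square)

text \<open>Input and output determine the environment state, so the partial trace has at most one
  nonzero term.\<close>

lemma out_coeff_has_sum:
  assumes a: "a \<in> dual_rail" "a' \<in> dual_rail"
  shows "((\<lambda>e. amplitude r a b e * amplitude r a' b' e) has_sum out_coeff r a a' b b') UNIV"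
    and "(\<lambda>e. norm (amplitude r a b e * amplitude r a' b' e)) summable_on UNIV"
proof -
  \<comment> \<open>If \<open>b\<close> has no photon in mode \<open>a\<close>, truncated
    subtraction yields a state with \<open>b \<noteq> shift a ?e\<close>; the amplitude is 0, in
    agreement with the ladder factor in \<open>out_coeff\<close>.\<close>
  let ?e = "(fst b - fst a, snd b - snd a)"
  have only: "amplitude r a b e * amplitude r a' b' e = 0" if "e \<noteq> ?e" for e
    using that by (auto simp: amplitude_def shift_def)
  have eq: "amplitude r a b ?e * amplitude r a' b' ?e = out_coeff r a a' b b'"
    unfolding amplitude_product[OF a] out_coeff_def using a
    by (cases b; cases b'; elim dual_rail_cases) (auto simp: shift_def ladder_def photons_def)
  show "((\<lambda>e. amplitude r a b e * amplitude r a' b' e) has_sum out_coeff r a a' b b') UNIV"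
    by (rule has_sum_finite_neutralI[of "{?e}"]) (use only eq in auto)
  have "{e. norm (amplitude r a b e * amplitude r a' b' e) \<noteq> 0} \<subseteq> {?e}" using only by force
  then show "(\<lambda>e. norm (amplitude r a b e * amplitude r a' b' e)) summable_on UNIV"
    by (intro finite_nonzero_values_imp_summable_on) (auto intro: finite_subset)
qed

lemma env_coeff_has_sum:
  assumes a: "a \<in> dual_rail" "a' \<in> dual_rail"
  shows "((\<lambda>b. amplitude r a b e * amplitude r a' b e') has_sum env_coeff r a a' e e') UNIV"
    and "(\<lambda>b. norm (amplitude r a b e * amplitude r a' b e')) summable_on UNIV"
proof -
  have only: "amplitude r a b e * amplitude r a' b e' = 0" if "b \<noteq> shift a e" for b
    using that by (auto simp: amplitude_def)
  have eq: "amplitude r a (shift a e) e * amplitude r a' (shift a e) e' = env_coeff r a a' e e'"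
  proof (cases "shift a e = shift a' e'")
    case True
    then have "photons e = photons e'" using photons_shift[OF a(1), of e] photons_shift[OF a(2), of e'] by simp
    then show ?thesis using True by (simp add: amplitude_def env_coeff_def weight_Suc power2_eq_square)
  qed (simp add: amplitude_def env_coeff_def)
  show "((\<lambda>b. amplitude r a b e * amplitude r a' b e') has_sum env_coeff r a a' e e') UNIV"
    by (rule has_sum_finite_neutralI[of "{shift a e}"]) (use only eq in auto)
  have "{b. norm (amplitude r a b e * amplitude r a' b e') \<noteq> 0} \<subseteq> {shift a e}" using only by force
  then show "(\<lambda>b. norm (amplitude r a b e * amplitude r a' b e')) summable_on UNIV"
    by (intro finite_nonzero_values_imp_summable_on) (auto intro: finite_subset)
qed

section \<open>Photon-number blocks, their dimensions and traces\<close>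

definition out_block :: "nat \<Rightarrow> fock set" where
  "out_block l = {b. photons b = l}"

text \<open>Labelled by the photon number of the accompanying output, so that corresponding blocks
  share a label. Label 0 is empty.\<close>

definition env_block :: "nat \<Rightarrow> fock set" where
  "env_block l = {e. Suc (photons e) = l}"

lemma out_block_eq: "out_block l = (\<lambda>i. (i, l - i)) ` {..l}"
proof -
  have "b \<in> (\<lambda>i. (i, l - i)) ` {..l}" if "fst b + snd b = l" for b
    using that by (intro image_eqI[of _ _ "fst b"]) (auto simp: prod_eq_iff)
  then show ?thesis by (auto simp: out_block_def photons_def)
qed

lemma env_block_Suc: "env_block (Suc l) = out_block l"
  by (simp add: env_block_def out_block_def)

lemma env_block_0 [simp]: "env_block 0 = {}"
  by (simp add: env_block_def)

lemma finite_out_block [simp]: "finite (out_block l)"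
  by (simp add: out_block_eq)

lemma finite_env_block [simp]: "finite (env_block l)"
  by (cases l) (simp_all add: env_block_Suc)

lemma card_out_block: "card (out_block l) = Suc l"
  unfolding out_block_eq by (subst card_image) (auto simp: inj_on_def)

lemma card_env_block: "card (env_block l) = l"
  by (cases l) (simp_all add: env_block_Suc card_out_block)

definition block_prob :: "real \<Rightarrow> nat \<Rightarrow> real" where
  "block_prob r l = weight r l * (real l * (real l + 1) / 2)"

lemma block_prob_0 [simp]: "block_prob r 0 = 0"
  by (simp add: block_prob_def)

lemma block_prob_nonneg [simp]: "block_prob r l \<ge> 0"
  by (simp add: block_prob_def)

lemma sum_out_block_ladder:
  assumes "a \<in> dual_rail"
  shows "(\<Sum>b\<in>out_block l. ladder a b * ladder a b) = real l * (real l + 1) / 2"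
proof -
  have "(\<Sum>i\<le>l. real i) = real l * (real l + 1) / 2"
    by (induction l) (simp_all add: field_simps)
  then have fst: "(\<Sum>b\<in>out_block l. real (fst b)) = real l * (real l + 1) / 2"
    unfolding out_block_eq by (subst sum.reindex) (auto simp: inj_on_def)
  have "(\<Sum>b\<in>out_block l. real (snd b)) = (\<Sum>b\<in>out_block l. real l - real (fst b))"
    by (intro sum.cong) (auto simp: out_block_def photons_def)
  also have "\<dots> = real l * (real l + 1) / 2"
    by (simp add: sum_subtractf fst card_out_block field_simps)
  finally have snd: "(\<Sum>b\<in>out_block l. real (snd b)) = real l * (real l + 1) / 2" .
  show ?thesis using assms fst snd by (auto simp: dual_rail_def ladder_def)
qed

lemma out_coeff_trace:
  assumes "a \<in> dual_rail" "a' \<in> dual_rail"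
  shows "(\<Sum>b\<in>out_block l. out_coeff r a a' b b) = (if a = a' then block_prob r l else 0)"
proof (cases "a = a'")
  case True
  have "(\<Sum>b\<in>out_block l. out_coeff r a a b b) = (\<Sum>b\<in>out_block l. weight r l * (ladder a b * ladder a b))"
    by (intro sum.cong refl) (auto simp: out_coeff_def out_block_def)
  then show ?thesis
    using True sum_out_block_ladder[OF assms(1), of l] by (simp add: sum_distrib_left[symmetric] block_prob_def)
next
  case False
  then have "a' \<noteq> a" by simp
  then have "out_coeff r a a' b b = 0" for b by (simp add: out_coeff_def)
  then show ?thesis using False by simp
qed

text \<open>
  Up to transposition, the environment state in block \<open>l\<close> is the image of the output state under
  the mixture of the lowering map \<open>Y \<mapsto> (1/l) \<Sum>\<^sub>k a\<^sub>k Y a\<^sub>k\<^sup>\<dagger>\<close> with weight \<open>l/(l+2)\<close> and of the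
  completely depolarizing map with weight \<open>2/(l+2)\<close>; these are its Kraus operators.
\<close>

fun kraus :: "nat \<Rightarrow> fock + fock \<times> fock \<Rightarrow> fock \<Rightarrow> fock \<Rightarrow> real" where
  "kraus l (Inl k) e b = (if b = shift k e then ladder k b / sqrt (real l + 2) else 0)"
| "kraus l (Inr (e0, b0)) e b = (if e = e0 \<and> b = b0 then sqrt (2 / (real l * (real l + 2))) else 0)"

definition kraus_indices :: "nat \<Rightarrow> (fock + fock \<times> fock) set" where
  "kraus_indices l = dual_rail <+> (env_block l \<times> out_block l)"

abbreviation kraus_kernel :: "nat \<Rightarrow> fock \<Rightarrow> fock \<Rightarrow> fock \<Rightarrow> fock \<Rightarrow> real" where
  "kraus_kernel l e b e' b' \<equiv> \<Sum>x\<in>kraus_indices l. kraus l x e b * kraus l x e' b'"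

lemma finite_kraus_indices [simp]: "finite (kraus_indices l)"
  by (simp add: kraus_indices_def)

lemma sum_kraus:
  assumes "e \<in> env_block l" "b \<in> out_block l"
  shows "kraus_kernel l e b e' b'
    = (\<Sum>k\<in>dual_rail. if b = shift k e \<and> b' = shift k e' then ladder k b * ladder k b' else 0) / (real l + 2)
      + (if e = e' \<and> b = b' then 2 / (real l * (real l + 2)) else 0)"
proof -
  have "kraus_kernel l e b e' b'
    = (\<Sum>k\<in>dual_rail. kraus l (Inl k) e b * kraus l (Inl k) e' b')
      + (\<Sum>y\<in>env_block l \<times> out_block l. kraus l (Inr y) e b * kraus l (Inr y) e' b')"
    unfolding kraus_indices_def by (subst sum.Plus) auto
  also have "(\<Sum>k\<in>dual_rail. kraus l (Inl k) e b * kraus l (Inl k) e' b')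
    = (\<Sum>k\<in>dual_rail. if b = shift k e \<and> b' = shift k e' then ladder k b * ladder k b' else 0) / (real l + 2)"
    unfolding sum_divide_distrib by (intro sum.cong refl) auto
  also have "(\<Sum>y\<in>env_block l \<times> out_block l. kraus l (Inr y) e b * kraus l (Inr y) e' b')
    = (\<Sum>y\<in>env_block l \<times> out_block l. if y = (e, b) then if e = e' \<and> b = b' then 2 / (real l * (real l + 2)) else 0 else 0)"
  proof (intro sum.cong refl)
    fix y :: "fock \<times> fock"
    obtain e0 b0 where "y = (e0, b0)" by (cases y)
    then show "kraus l (Inr y) e b * kraus l (Inr y) e' b'
      = (if y = (e, b) then if e = e' \<and> b = b' then 2 / (real l * (real l + 2)) else 0 else 0)"
      by (cases "e = e0 \<and> b = b0") auto
  qed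
  also have "\<dots> = (if e = e' \<and> b = b' then 2 / (real l * (real l + 2)) else 0)"
    using assms by (subst sum.delta) auto
  finally show ?thesis .
qed

text \<open>On l photons \<open>\<Sum> a_k\<dagger> a_k = l\<close>, so lowering contributes l / (l
  + 2). The depolarizing part contributes 2 / (l (l + 2)) for each of the l environment states, that
  is 2 / (l + 2).\<close>

lemma kraus_trace_preserving:
  assumes b: "b \<in> out_block l" "b' \<in> out_block l" and l: "l > 0"
  shows "(\<Sum>e\<in>env_block l. kraus_kernel l e b e b') = (if b = b' then 1 else 0)"
proof (cases "b = b'")
  case False
  have "kraus_kernel l e b e b' = 0" if "e \<in> env_block l" for e
    using False by (subst sum_kraus[OF that b(1)]) (auto intro!: sum.neutral)
  then show ?thesis using False by simp
next
  case True
  have lad: "(\<Sum>e\<in>env_block l. if b = shift k e then ladder k b * ladder k b else 0) = real (if k = (1, 0) then fst b else snd b)"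
    if k: "k \<in> dual_rail" for k
  proof (cases "(if k = (1, 0) then fst b else snd b) = 0")
    case True
    then have "ladder k b = 0" unfolding ladder_def by (simp only: True) simp
    then show ?thesis by (simp only: True) (auto intro!: sum.neutral)
  next
    case nz: False
    let ?e = "(fst b - fst k, snd b - snd k)"
    have be: "b = shift k e \<longleftrightarrow> e = ?e" for e
      using k nz by (elim dual_rail_cases) (auto simp: shift_def prod_eq_iff)
    have "?e \<in> env_block l"
      using k nz b(1) by (elim dual_rail_cases) (auto simp: env_block_def out_block_def photons_def)
    then show ?thesis unfolding be by (simp add: ladder_def)
  qed
  have "(\<Sum>e\<in>env_block l. kraus_kernel l e b e b)
    = (\<Sum>e\<in>env_block l. (\<Sum>k\<in>dual_rail. if b = shift k e then ladder k b * ladder k b else 0) / (real l + 2)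
      + 2 / (real l * (real l + 2)))"
    by (intro sum.cong refl) (simp add: sum_kraus b)
  also have "\<dots> = (\<Sum>k\<in>dual_rail. \<Sum>e\<in>env_block l. if b = shift k e then ladder k b * ladder k b else 0) / (real l + 2)
      + real l * (2 / (real l * (real l + 2)))"
    by (subst sum.swap) (simp add: sum.distrib sum_divide_distrib card_env_block)
  also have "(\<Sum>k\<in>dual_rail. \<Sum>e\<in>env_block l. if b = shift k e then ladder k b * ladder k b else 0)
    = (\<Sum>k\<in>dual_rail. real (if k = (1, 0) then fst b else snd b))"
    by (intro sum.cong refl lad)
  also have "\<dots> = real l" using b(1) by (auto simp: dual_rail_def out_block_def photons_def)
  also have "real l / (real l + 2) + real l * (2 / (real l * (real l + 2))) = 1"
    using l by (simp add: add_divide_distrib[symmetric])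
  finally show ?thesis using True by simp
qed

text \<open>On l - 1 photons \<open>\<Sum> a_k a_k\<dagger> = l + 1\<close>. To this, divided by l +
  2, the depolarizing part adds 2 / (l (l + 2)) for each of the l + 1 output states.\<close>

lemma kraus_unital:
  assumes e: "e \<in> env_block l" "e' \<in> env_block l"
  shows "(\<Sum>b\<in>out_block l. kraus_kernel l e b e' b)
    = (if e = e' then (real l + 1) / real l else 0)"
proof (cases "e = e'")
  case False
  have "kraus_kernel l e b e' b = 0" if "b \<in> out_block l" for b
    using False by (subst sum_kraus[OF e(1) that]) (auto intro!: sum.neutral)
  then show ?thesis using False by simp
next
  case True
  have l: "l > 0" using e(1) by (auto simp: env_block_def)
  have lad: "(\<Sum>b\<in>out_block l. if b = shift k e then ladder k b * ladder k b else 0) = real (if k = (1, 0) then fst e + 1 else snd e + 1)"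
    if k: "k \<in> dual_rail" for k
  proof -
    have "shift k e \<in> out_block l" using e(1) k by (simp add: env_block_def out_block_def)
    then show ?thesis using k by (elim dual_rail_cases) (simp_all add: ladder_def shift_def)
  qed
  have "(\<Sum>b\<in>out_block l. kraus_kernel l e b e b)
    = (\<Sum>b\<in>out_block l. (\<Sum>k\<in>dual_rail. if b = shift k e then ladder k b * ladder k b else 0) / (real l + 2)
      + 2 / (real l * (real l + 2)))"
    by (intro sum.cong refl) (simp add: sum_kraus e)
  also have "\<dots> = (\<Sum>k\<in>dual_rail. \<Sum>b\<in>out_block l. if b = shift k e then ladder k b * ladder k b else 0) / (real l + 2)
      + (real l + 1) * (2 / (real l * (real l + 2)))"
    by (subst sum.swap) (simp add: sum.distrib sum_divide_distrib card_out_block)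
  also have "(\<Sum>k\<in>dual_rail. \<Sum>b\<in>out_block l. if b = shift k e then ladder k b * ladder k b else 0)
    = (\<Sum>k\<in>dual_rail. real (if k = (1, 0) then fst e + 1 else snd e + 1))"
    by (intro sum.cong refl lad)
  also have "\<dots> = real l + 1" using e(1) by (auto simp: dual_rail_def env_block_def photons_def)
  also have "(real l + 1) / (real l + 2) + (real l + 1) * (2 / (real l * (real l + 2))) = (real l + 1) / real l"
  proof -
    have "(x + 1) / (x + 2) + (x + 1) * (2 / (x * (x + 2))) = (x + 1) / x" if "x > 0" for x :: real
    proof -
      have "(x + 1) / (x + 2) + (x + 1) * (2 / (x * (x + 2))) = x * (x + 1) / (x * (x + 2)) + 2 * (x + 1) / (x * (x + 2))"
        using that by simp
      also have "\<dots> = (x * (x + 1) + 2 * (x + 1)) / (x * (x + 2))" by (simp only: add_divide_distrib)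
      also have "x * (x + 1) + 2 * (x + 1) = (x + 1) * (x + 2)" by (simp add: algebra_simps)
      finally show ?thesis using that by simp
    qed
    then show ?thesis using l by simp
  qed
  finally show ?thesis using True by simp
qed

text \<open>In the kernel \<open>e\<close> and \<open>e'\<close> are exchanged, which is the
  transposition. Lowering produces all of (l + 2) times the coefficient except for l + 1 on the
  diagonal, and the depolarizing part supplies this through the trace of the output block.\<close>

lemma env_coeff_degraded:
  assumes e: "e \<in> env_block l" "e' \<in> env_block l" and a: "a \<in> dual_rail" "a' \<in> dual_rail"
  shows "env_coeff r a a' e e' = (\<Sum>b\<in>out_block l. \<Sum>b'\<in>out_block l.
    kraus_kernel l e' b e b' * out_coeff r a a' b b')"
proof -
  have l: "l > 0" using e(1) by (auto simp: env_block_def)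
  let ?F = "\<lambda>k b b'. if b = shift k e' \<and> b' = shift k e then ladder k b * ladder k b' * out_coeff r a a' b b' else 0"
  let ?T = "\<lambda>k. ladder k (shift k e') * ladder k (shift k e) * out_coeff r a a' (shift k e') (shift k e)"
  have sh: "shift k e \<in> out_block l" "shift k e' \<in> out_block l" if "k \<in> dual_rail" for k
    using e that by (auto simp: env_block_def out_block_def)
  have "(\<Sum>b\<in>out_block l. \<Sum>b'\<in>out_block l.
      kraus_kernel l e' b e b' * out_coeff r a a' b b')
    = (\<Sum>b\<in>out_block l. \<Sum>b'\<in>out_block l.
      (\<Sum>k\<in>dual_rail. ?F k b b') / (real l + 2)
      + (if e = e' \<and> b = b' then 2 / (real l * (real l + 2)) * out_coeff r a a' b b else 0))"
  proof (intro sum.cong refl)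
    fix b b' assume b: "b \<in> out_block l"
    have "(\<Sum>k\<in>dual_rail. ?F k b b')
      = (\<Sum>k\<in>dual_rail. if b = shift k e' \<and> b' = shift k e then ladder k b * ladder k b' else 0) * out_coeff r a a' b b'"
      unfolding sum_distrib_right by (intro sum.cong refl) simp
    then show "kraus_kernel l e' b e b' * out_coeff r a a' b b'
      = (\<Sum>k\<in>dual_rail. ?F k b b') / (real l + 2)
      + (if e = e' \<and> b = b' then 2 / (real l * (real l + 2)) * out_coeff r a a' b b else 0)"
      by (auto simp: sum_kraus[OF e(2) b] distrib_right)
  qed
  also have "\<dots> = (\<Sum>k\<in>dual_rail. \<Sum>b\<in>out_block l. \<Sum>b'\<in>out_block l. ?F k b b') / (real l + 2)
      + (\<Sum>b\<in>out_block l. \<Sum>b'\<in>out_block l. if e = e' \<and> b = b' then 2 / (real l * (real l + 2)) * out_coeff r a a' b b else 0)"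
    by (simp only: sum.distrib sum_divide_distrib[symmetric] sum.swap[of _ dual_rail])
  also have "(\<Sum>b\<in>out_block l. \<Sum>b'\<in>out_block l. if e = e' \<and> b = b' then 2 / (real l * (real l + 2)) * out_coeff r a a' b b else 0)
      = (if e = e' \<and> a = a' then 2 / (real l * (real l + 2)) * block_prob r l else 0)"
  proof -
    have "(\<Sum>b\<in>out_block l. \<Sum>b'\<in>out_block l. if e = e' \<and> b = b' then 2 / (real l * (real l + 2)) * out_coeff r a a' b b else 0)
      = (if e = e' then 2 / (real l * (real l + 2)) * (\<Sum>b\<in>out_block l. out_coeff r a a' b b) else 0)"
      by (cases "e = e'") (simp_all add: sum_distrib_left)
    then show ?thesis by (simp add: out_coeff_trace a)
  qed
  also have "(\<Sum>k\<in>dual_rail. \<Sum>b\<in>out_block l. \<Sum>b'\<in>out_block l. ?F k b b')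
      = (\<Sum>k\<in>dual_rail. ?T k)"
  proof (rule sum.cong[OF refl])
    fix k assume k: "k \<in> dual_rail"
    have "(\<Sum>b\<in>out_block l. \<Sum>b'\<in>out_block l. ?F k b b')
      = (\<Sum>b\<in>out_block l. if b = shift k e' then \<Sum>b'\<in>out_block l.
        if b' = shift k e then ladder k b * ladder k b' * out_coeff r a a' b b' else 0 else 0)"
      by (intro sum.cong refl) auto
    then show "(\<Sum>b\<in>out_block l. \<Sum>b'\<in>out_block l. ?F k b b')
      = ?T k"
      using sh[OF k] by simp
  qed
  also have "(\<Sum>k\<in>dual_rail. ?T k) / (real l + 2)
      + (if e = e' \<and> a = a' then 2 / (real l * (real l + 2)) * block_prob r l else 0) = env_coeff r a a' e e'"
  proof -
    obtain x y x' y' where xy: "e = (x, y)" "e' = (x', y')" by (cases e; cases e')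
    have le: "l = Suc (x + y)" "l = Suc (x' + y')" using e xy by (auto simp: env_block_def photons_def)
    \<comment> \<open>The identity
      \<open>\<Sum> a_k X a_k\<dagger> + (l + 1) = (l + 2) (X + 1)\<close> in matrix entries. Equal
      inputs reach only \<open>e = e'\<close>; unequal inputs reach only the \<open>e'\<close> that
      arises by moving one photon between the modes.\<close>
    have "(\<Sum>k\<in>dual_rail. ?T k)
        + (if e = e' \<and> a = a' then weight r l * (real l + 1) else 0) = (real l + 2) * env_coeff r a a' e e'"
    proof -
      define f where "f k = ?T k" for k
      have dr: "(\<Sum>k\<in>dual_rail. f k) = f (0, 1) + f (1, 0)" by (simp add: dual_rail_def)
      have lad: "ladder (1, 0) (p, q) = sqrt (real p)" "ladder (0, 1) (p, q) = sqrt (real q)" for p q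
        by (simp_all add: ladder_def)
      have sh': "shift (1, 0) (p, q) = (Suc p, q)" "shift (0, 1) (p, q) = (p, Suc q)" for p q
        by (simp_all add: shift_def)
      have sq: "sqrt (real p) * sqrt (real p) = real p" "sqrt (real p) * t * (w * (sqrt (real p) * u)) = real p * (w * (t * u))"
        "t * sqrt (real p) * (w * (u * sqrt (real p))) = real p * (w * (u * t))" for p and t u w :: real
      proof -
        show s: "sqrt (real p) * sqrt (real p) = real p" by simp
        have "sqrt (real p) * t * (w * (sqrt (real p) * u)) = (sqrt (real p) * sqrt (real p)) * (w * (t * u))" by algebra
        then show "sqrt (real p) * t * (w * (sqrt (real p) * u)) = real p * (w * (t * u))" by (simp only: s)
        have "t * sqrt (real p) * (w * (u * sqrt (real p))) = (sqrt (real p) * sqrt (real p)) * (w * (u * t))" by algebra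
        then show "t * sqrt (real p) * (w * (u * sqrt (real p))) = real p * (w * (u * t))" by (simp only: s)
      qed
      have tot: "photons (p, q) = p + q" for p q by (simp add: photons_def)
      let ?goal = "f (0, 1) + f (1, 0) + (if e = e' \<and> a = a' then weight r l * (real l + 1) else 0) = (real l + 2) * env_coeff r a a' e e'"
      have ?goal
        using a
      proof (elim dual_rail_cases)
        assume aa: "a = (0, 1)" "a' = (0, 1)"
        show ?goal
        proof (cases "e = e'")
          case True
          then have "f (0, 1) = weight r l * ((real y + 1) * (real y + 1))" "f (1, 0) = weight r l * ((real x + 1) * real y)"
            "env_coeff r a a' e e' = weight r l * (real y + 1)"
            unfolding f_def xy aa out_coeff_def env_coeff_def lad sh' tot sq by (simp_all add: le(1) xy algebra_simps)
          then show ?thesis using True aa le(1) by (simp add: algebra_simps)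
        qed (simp add: f_def aa out_coeff_def env_coeff_def)
      next
        assume aa: "a = (1, 0)" "a' = (1, 0)"
        show ?goal
        proof (cases "e = e'")
          case True
          then have "f (1, 0) = weight r l * ((real x + 1) * (real x + 1))" "f (0, 1) = weight r l * ((real y + 1) * real x)"
            "env_coeff r a a' e e' = weight r l * (real x + 1)"
            unfolding f_def xy aa out_coeff_def env_coeff_def lad sh' tot sq by (simp_all add: le(1) xy algebra_simps)
          then show ?thesis using True aa le(1) by (simp add: algebra_simps)
        qed (simp add: f_def aa out_coeff_def env_coeff_def)
      next
        assume aa: "a = (0, 1)" "a' = (1, 0)"
        show ?goal
        proof (cases "x = Suc x' \<and> y' = Suc y")
          case True
          define s where "s = sqrt (real (Suc y)) * sqrt (real (Suc x'))"
          have "f (0, 1) = weight r l * (real y + 2) * s" "f (1, 0) = weight r l * (real x' + 2) * s"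
            "env_coeff r a a' e e' = weight r l * s"
            using True le(2) unfolding f_def xy aa out_coeff_def env_coeff_def lad sh' tot s_def sq
            by simp_all
          then show ?thesis using True aa le(1) by (simp add: algebra_simps)
        qed (use le in \<open>auto simp: f_def aa out_coeff_def env_coeff_def shift_def xy\<close>)
      next
        assume aa: "a = (1, 0)" "a' = (0, 1)"
        show ?goal
        proof (cases "y = Suc y' \<and> x' = Suc x")
          case True
          define s where "s = sqrt (real (Suc x)) * sqrt (real (Suc y'))"
          have "f (1, 0) = weight r l * (real x + 2) * s" "f (0, 1) = weight r l * (real y' + 2) * s"
            "env_coeff r a a' e e' = weight r l * s"
            using True le(2) unfolding f_def xy aa out_coeff_def env_coeff_def lad sh' tot s_def sq
            by simp_all
          then show ?thesis using True aa le(1) by (simp add: algebra_simps)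
        qed (use le in \<open>auto simp: f_def aa out_coeff_def env_coeff_def shift_def xy\<close>)
      qed
      then show ?thesis unfolding f_def[symmetric] dr .
    qed
    then have "(\<Sum>k\<in>dual_rail. ?T k) / (real l + 2)
        + (if e = e' \<and> a = a' then weight r l * (real l + 1) else 0) / (real l + 2) = env_coeff r a a' e e'"
      unfolding add_divide_distrib[symmetric] by simp
    moreover have "2 / (real l * (real l + 2)) * block_prob r l = weight r l * (real l + 1) / (real l + 2)"
    proof -
      have "2 / (real l * (real l + 2)) * (w * (real l * (real l + 1) / 2)) = real l * (w * (real l + 1)) / (real l * (real l + 2))" for w
        by simp
      then show ?thesis using l by (simp add: block_prob_def)
    qed
    ultimately show ?thesis by (simp only: if_distrib[of "\<lambda>x. x / _"] div_0)
  qed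
  finally show ?thesis by simp
qed

subsection \<open>Normalisation of the Hawking isometry\<close>

lemma has_sum_times_nonneg:
  fixes f :: "'x \<Rightarrow> real" and g :: "'y \<Rightarrow> real"
  assumes "(f has_sum s) A" "(g has_sum t) B" "\<And>x. x \<in> A \<Longrightarrow> f x \<ge> 0" "\<And>y. y \<in> B \<Longrightarrow> g y \<ge> 0"
  shows "((\<lambda>(x, y). f x * g y) has_sum s * t) (A \<times> B)"
proof (rule has_sum_SigmaI)
  show h: "((\<lambda>y. case (x, y) of (x, y) \<Rightarrow> f x * g y) has_sum f x * t) B" for x
    using assms(2) by (simp add: has_sum_cmult_right)
  show "((\<lambda>x. f x * t) has_sum s * t) A" using assms(1) by (rule has_sum_cmult_left)
  show "(\<lambda>(x, y). f x * g y) summable_on A \<times> B"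
    by (rule summable_on_SigmaI[OF h]) (use assms in \<open>auto intro: summable_on_cmult_left has_sum_imp_summable\<close>)
qed

lemma tanh_square_less_1: "(tanh r)\<^sup>2 < 1" for r :: real
  using inverse_cosh_square[of r] by (smt (verit) cosh_real_pos zero_less_divide_1_iff zero_less_power)

text \<open>The occupied rail contributes the differentiated geometric series, the empty rail the
  geometric series; their product \<open>1 / (1 - z)^3\<close> cancels the prefactor.\<close>

lemma column_norm_has_sum:
  assumes "a \<in> dual_rail"
  shows "((\<lambda>e. weight r (Suc (photons e)) * (ladder a (shift a e) * ladder a (shift a e))) has_sum 1) UNIV"
proof -
  define z where "z = (tanh r)\<^sup>2"
  have z: "0 \<le> z" "z < 1" using tanh_square_less_1[of r] by (auto simp: z_def)
  have g1: "((\<lambda>n. real (Suc n) * z ^ n) has_sum 1 / (1 - z)\<^sup>2) UNIV"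
    using geometric_deriv_sums[of z] z by (intro sums_nonneg_imp_has_sum) auto
  have g0: "((\<lambda>n. z ^ n) has_sum 1 / (1 - z)) UNIV"
    using geometric_sums[of z] z by (intro sums_nonneg_imp_has_sum) auto
  have one: "(1 - z) ^ 3 * (1 / (1 - z)\<^sup>2 * (1 / (1 - z))) = 1"
    using z by (simp add: power2_eq_square power3_eq_cube)
  have "((\<lambda>(m, n). real (Suc m) * z ^ m * z ^ n) has_sum 1 / (1 - z)\<^sup>2 * (1 / (1 - z))) (UNIV \<times> UNIV)"
    using z by (intro has_sum_times_nonneg g1 g0) auto
  from has_sum_cmult_right[OF this, of "(1 - z) ^ 3"]
  have A: "((\<lambda>(m, n). (1 - z) ^ 3 * (real (Suc m) * z ^ m * z ^ n)) has_sum 1) UNIV"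
    by (simp only: one case_prod_unfold UNIV_Times_UNIV)
  have "((\<lambda>(m, n). z ^ m * (real (Suc n) * z ^ n)) has_sum 1 / (1 - z) * (1 / (1 - z)\<^sup>2)) (UNIV \<times> UNIV)"
    using z by (intro has_sum_times_nonneg g1 g0) auto
  from has_sum_cmult_right[OF this, of "(1 - z) ^ 3"]
  have B: "((\<lambda>(m, n). (1 - z) ^ 3 * (z ^ m * (real (Suc n) * z ^ n))) has_sum 1) UNIV"
    by (simp only: one case_prod_unfold UNIV_Times_UNIV mult.commute[of "1 / (1 - z)" "1 / (1 - z)\<^sup>2"])
  show ?thesis
    using assms
  proof (elim dual_rail_cases)
    assume a: "a = (1, 0)"
    show ?thesis
      by (rule has_sum_cong[THEN iffD1, OF _ A])
        (auto simp: a weight_def ladder_def shift_def photons_def z_def power_add mult_ac)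
  next
    assume a: "a = (0, 1)"
    show ?thesis
      by (rule has_sum_cong[THEN iffD1, OF _ B])
        (auto simp: a weight_def ladder_def shift_def photons_def z_def power_add mult_ac)
  qed
qed

text \<open>Equal inputs reduce to the column norm; different inputs give columns with disjoint
  supports. In both cases the products are nonnegative, which yields the absolute summability needed
  over words.\<close>

lemma amplitude_isometry:
  assumes a: "a \<in> dual_rail" "a' \<in> dual_rail"
  shows "((\<lambda>(b, e). amplitude r a b e * amplitude r a' b e) has_sum (if a = a' then 1 else 0)) UNIV"
    and "(\<lambda>(b, e). norm (amplitude r a b e * amplitude r a' b e)) summable_on UNIV"
proof -
  have "((\<lambda>(b, e). amplitude r a b e * amplitude r a' b e) has_sum (if a = a' then 1 else 0)) UNIV \<and>
    (\<forall>b e. amplitude r a b e * amplitude r a' b e \<ge> 0)"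
  proof (cases "a = a'")
    case True
    have nn: "amplitude r a b e * amplitude r a b e \<ge> 0" for b e by simp
    have "((\<lambda>e. weight r (Suc (photons e)) * (ladder a (shift a e) * ladder a (shift a e))) has_sum 1) UNIV \<longleftrightarrow>
      ((\<lambda>(b, e). amplitude r a b e * amplitude r a b e) has_sum 1) {(b, e). b = shift a e}"
      by (rule has_sum_reindex_bij_witness[of _ snd "\<lambda>e. (shift a e, e)"]) (use a in \<open>auto simp: amplitude_product\<close>)
    also have "\<dots> \<longleftrightarrow> ((\<lambda>(b, e). amplitude r a b e * amplitude r a b e) has_sum 1) UNIV"
      by (rule has_sum_cong_neutral) (auto simp: amplitude_def)
    finally show ?thesis using column_norm_has_sum[OF a(1), of r] True nn by simp
  next
    case False
    then have *: "amplitude r a b e * amplitude r a' b e = 0" for b e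
      using a by (auto simp: amplitude_product simp del: mult_eq_0_iff)
    show ?thesis unfolding * using False by (auto intro!: has_sum_0)
  qed
  then show h: "((\<lambda>(b, e). amplitude r a b e * amplitude r a' b e) has_sum (if a = a' then 1 else 0)) UNIV"
    and "(\<lambda>(b, e). norm (amplitude r a b e * amplitude r a' b e)) summable_on UNIV"
    by (simp_all only: real_norm_def abs_of_nonneg) (auto intro: has_sum_imp_summable)
qed

subsection \<open>Several uses of the channel\<close>

definition word_amplitude ::
    "real \<Rightarrow> nat \<Rightarrow> fock list \<Rightarrow> fock list \<Rightarrow> fock list \<Rightarrow> real" where
  "word_amplitude r n a b e = (\<Prod>i<n. amplitude r (a ! i) (b ! i) (e ! i))"

definition out_word ::
    "real \<Rightarrow> nat \<Rightarrow> fock list \<Rightarrow> fock list \<Rightarrow> fock list \<Rightarrow> fock list \<Rightarrow> real" where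
  "out_word r n a a' b b' = (\<Prod>i<n. out_coeff r (a ! i) (a' ! i) (b ! i) (b' ! i))"

definition env_word ::
    "real \<Rightarrow> nat \<Rightarrow> fock list \<Rightarrow> fock list \<Rightarrow> fock list \<Rightarrow> fock list \<Rightarrow> real" where
  "env_word r n a a' e e' = (\<Prod>i<n. env_coeff r (a ! i) (a' ! i) (e ! i) (e' ! i))"

definition canonical_extension ::
    "real \<Rightarrow> nat \<Rightarrow> (fock list \<times> fock list, fock list) opr" where
  "canonical_extension r n = (\<lambda>(b, e) a. complex_of_real (word_amplitude r n a b e))"

lemma words_nth: "w \<in> words n A \<Longrightarrow> i < n \<Longrightarrow> w ! i \<in> A"
  by (auto simp: words_eq_pwords pwords_def)

lemma words_length: "w \<in> words n A \<Longrightarrow> length w = n"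
  by (simp add: words_def)

lemma finite_words: "finite A \<Longrightarrow> finite (words n A)"
  by (simp add: words_eq_pwords finite_pwords)

lemma words_eq_iff:
  assumes "a \<in> words n A" "a' \<in> words n A'"
  shows "a = a' \<longleftrightarrow> (\<forall>i<n. a ! i = a' ! i)"
  using words_length[OF assms(1)] words_length[OF assms(2)] by (auto simp: list_eq_iff_nth_eq)

lemma prod_delta_words:
  assumes "a \<in> words n A" "a' \<in> words n A'"
  shows "(\<Prod>i<n. if a ! i = a' ! i then f i else (0::'b::{comm_semiring_1,semiring_no_zero_divisors}))
    = (if a = a' then \<Prod>i<n. f i else 0)"
proof (cases "a = a'")
  case False
  then obtain i where "i < n" "a ! i \<noteq> a' ! i" unfolding words_eq_iff[OF assms] by blast
  then have "(\<Prod>i<n. if a ! i = a' ! i then f i else 0) = 0" by (intro prod_zero) auto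
  with False show ?thesis by simp
qed simp

abbreviation inputs :: "nat \<Rightarrow> fock list set" where
  "inputs n \<equiv> words n dual_rail"

lemma out_word_has_sum:
  assumes a: "a \<in> inputs n" "a' \<in> inputs n"
  shows "((\<lambda>e. word_amplitude r n a b e * word_amplitude r n a' b' e) has_sum out_word r n a a' b b') (words n UNIV)"
  unfolding word_amplitude_def out_word_def prod.distrib[symmetric] words_eq_pwords[of n UNIV]
  by (rule has_sum_pwords[THEN conjunct1]) (rule out_coeff_has_sum words_nth[OF a(1)] words_nth[OF a(2)] | assumption)+

lemma env_word_has_sum:
  assumes a: "a \<in> inputs n" "a' \<in> inputs n"
  shows "((\<lambda>b. word_amplitude r n a b e * word_amplitude r n a' b e') has_sum env_word r n a a' e e') (words n UNIV)"
  unfolding word_amplitude_def env_word_def prod.distrib[symmetric] words_eq_pwords[of n UNIV]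
  by (rule has_sum_pwords[THEN conjunct1]) (rule env_coeff_has_sum words_nth[OF a(1)] words_nth[OF a(2)] | assumption)+

lemma word_amplitude_isometry:
  assumes a: "a \<in> inputs n" "a' \<in> inputs n"
  shows "((\<lambda>(b, e). word_amplitude r n a b e * word_amplitude r n a' b e) has_sum (if a = a' then 1 else 0))
    (words n UNIV \<times> words n UNIV)"
proof -
  let ?f = "\<lambda>i (b, e). amplitude r (a ! i) b e * amplitude r (a' ! i) b e"
  have "((\<lambda>w. \<Prod>i<n. ?f i (w ! i)) has_sum (\<Prod>i<n. if a ! i = a' ! i then 1 else 0)) (pwords n (\<lambda>_. UNIV))"
  proof (rule has_sum_pwords[THEN conjunct1])
    fix i assume i: "i < n"
    show "(?f i has_sum (if a ! i = a' ! i then 1 else 0)) UNIV"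
      by (rule amplitude_isometry(1) words_nth[OF a(1) i] words_nth[OF a(2) i])+
    show "(\<lambda>x. norm (?f i x)) summable_on UNIV"
      using amplitude_isometry(2)[OF words_nth[OF a(1) i] words_nth[OF a(2) i], of r] by (simp add: case_prod_unfold)
  qed
  also have "(\<Prod>i<n. if a ! i = a' ! i then 1 else (0::real)) = (if a = a' then 1 else 0)"
    using prod_delta_words[OF a, of "\<lambda>_. 1::real"] by simp
  finally have "((\<lambda>w. \<Prod>i<n. ?f i (w ! i)) has_sum (if a = a' then 1 else 0)) (pwords n (\<lambda>_. UNIV))" .
  also have "?this \<longleftrightarrow> ?thesis"
    by (rule has_sum_reindex_bij_witness[of _ "\<lambda>(b, e). zip b e" "\<lambda>w. (map fst w, map snd w)"])
      (auto simp: words_def pwords_def zip_map_fst_snd word_amplitude_def prod.distrib case_prod_unfold)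
  finally show ?thesis .
qed

lemma black_hole_channel_matrix_unit:
  assumes a: "a \<in> dual_rail" "a' \<in> dual_rail"
  shows "black_hole_channel r (matrix_unit a a') b b' = of_real (out_coeff r a a' b b')"
proof -
  have "conjugate_by dual_rail (hawking_isometry2 r) (matrix_unit a a') (b, e) (b', e)
    = of_real (amplitude r a b e * amplitude r a' b' e)" for e
    using a by (simp add: conjugate_by_matrix_unit hawking_isometry2_eq)
  then have "black_hole_channel r (matrix_unit a a') b b'
    = (\<Sum>\<^sub>\<infinity>e. of_real (amplitude r a b e * amplitude r a' b' e))"
    by (simp add: black_hole_channel_def ptrace_right_def)
  also have "\<dots> = of_real (out_coeff r a a' b b')"
    by (rule infsumI, rule has_sum_of_real, rule out_coeff_has_sum(1)[OF a])
  finally show ?thesis .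
qed

abbreviation channel_power :: "real \<Rightarrow> nat \<Rightarrow> (fock list, fock list) superop" where
  "channel_power r n \<equiv> tensor_power dual_rail n (black_hole_channel r)"

lemma channel_power_eq:
  "channel_power r n \<rho> b b' =
    (\<Sum>a\<in>inputs n. \<Sum>a'\<in>inputs n. \<rho> a a' * of_real (out_word r n a a' b b'))"
  unfolding tensor_power_def out_word_def of_real_prod
  by (intro sum.cong refl arg_cong2[of _ _ _ _ "(*)"] prod.cong black_hole_channel_matrix_unit)
    (auto simp: words_nth)

lemma conjugate_by_canonical:
  "conjugate_by A (canonical_extension r n) \<rho> (b, e) (b', e')
    = (\<Sum>a\<in>A. \<Sum>a'\<in>A. \<rho> a a' * of_real (word_amplitude r n a b e * word_amplitude r n a' b' e'))"
  by (simp add: conjugate_by_def canonical_extension_def mult_ac)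

lemma canonical_extension_isometric:
  "isometric_extension (inputs n) (words n UNIV) (words n UNIV) (canonical_extension r n) (channel_power r n)"
  unfolding isometric_extension_def isometry_def
proof (intro conjI ballI allI)
  fix a a' assume a: "a \<in> inputs n" "a' \<in> inputs n"
  from has_sum_of_real[OF word_amplitude_isometry[OF a, of r], where 'a = complex]
  show "((\<lambda>b. cnj (canonical_extension r n b a) * canonical_extension r n b a') has_sum (if a = a' then 1 else 0))
      (words n UNIV \<times> words n UNIV)"
    by (simp add: canonical_extension_def case_prod_unfold if_distrib cong: if_cong)
next
  fix \<rho> b b'
  have "((\<lambda>e. conjugate_by (inputs n) (canonical_extension r n) \<rho> (b, e) (b', e)) has_sum
      channel_power r n \<rho> b b') (words n UNIV)"
    unfolding conjugate_by_canonical channel_power_eq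
    by (intro has_sum_sum has_sum_cmult_right has_sum_of_real out_word_has_sum)
  then show "channel_power r n \<rho> b b'
    = ptrace_right (words n UNIV) (conjugate_by (inputs n) (canonical_extension r n) \<rho>) b b'"
    unfolding ptrace_right_def by (rule infsumI[symmetric])
qed

lemma ptrace_left_canonical:
  "ptrace_left (words n UNIV) (conjugate_by (inputs n) (canonical_extension r n) \<rho>) e e' =
    (\<Sum>a\<in>inputs n. \<Sum>a'\<in>inputs n. \<rho> a a' * of_real (env_word r n a a' e e'))"
  unfolding ptrace_left_def conjugate_by_canonical
  by (intro infsumI has_sum_sum has_sum_cmult_right has_sum_of_real env_word_has_sum)

text \<open>The environment is relabelled through \<open>g\<close> and padded with zeros. It
  guarantees that the choice \<open>SOME U\<close> in the coherent information denotes an actual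
  extension.\<close>

lemma isometric_extension_nat_environment:
  fixes U :: "('b \<times> 'e, 'a) opr" and g :: "'e \<Rightarrow> nat"
  assumes U: "isometric_extension A B E U N" and g: "inj_on g E"
  shows "\<exists>U'. isometric_extension A B (UNIV :: nat set) U' N"
proof -
  define h where "h = the_inv_into E g"
  have hg: "h (g e) = e" if "e \<in> E" for e using that g by (simp add: h_def the_inv_into_f_f)
  define U' where "U' = (\<lambda>(b, k) a. if k \<in> g ` E then U (b, h k) a else 0)"
  have "isometric_extension A B UNIV U' N"
    unfolding isometric_extension_def isometry_def
  proof (intro conjI ballI allI)
    fix a a' assume "a \<in> A" "a' \<in> A"
    then have "((\<lambda>b. cnj (U b a) * U b a') has_sum (if a = a' then 1 else 0)) (B \<times> E)"
      using U by (simp add: isometric_extension_def isometry_def)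
    also have "?this \<longleftrightarrow> ((\<lambda>b. cnj (U' b a) * U' b a') has_sum (if a = a' then 1 else 0)) (B \<times> g ` E)"
      by (rule has_sum_reindex_bij_witness[of _ "\<lambda>(b, k). (b, h k)" "\<lambda>(b, e). (b, g e)"])
        (auto simp: hg U'_def)
    also have "\<dots> \<longleftrightarrow> ((\<lambda>b. cnj (U' b a) * U' b a') has_sum (if a = a' then 1 else 0)) (B \<times> UNIV)"
      by (rule has_sum_cong_neutral) (auto simp: U'_def split: if_splits)
    finally show "((\<lambda>b. cnj (U' b a) * U' b a') has_sum (if a = a' then 1 else 0)) (B \<times> UNIV)" .
  next
    fix \<rho> b b' assume "b \<in> B" "b' \<in> B"
    then have "N \<rho> b b' = (\<Sum>\<^sub>\<infinity>e\<in>E. conjugate_by A U \<rho> (b, e) (b', e))"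
      using U by (simp add: isometric_extension_def ptrace_right_def)
    also have "\<dots> = (\<Sum>\<^sub>\<infinity>k\<in>g ` E. conjugate_by A U' \<rho> (b, k) (b', k))"
      by (rule infsum_reindex_bij_witness[of _ h g]) (auto simp: hg U'_def conjugate_by_def)
    also have "\<dots> = (\<Sum>\<^sub>\<infinity>k. conjugate_by A U' \<rho> (b, k) (b', k))"
      by (rule infsum_cong_neutral) (auto simp: U'_def conjugate_by_def)
    finally show "N \<rho> b b' = ptrace_right UNIV (conjugate_by A U' \<rho>) b b'" by (simp add: ptrace_right_def)
  qed
  then show ?thesis by blast
qed

section \<open>Symmetry and photon-number selection rules of the coefficients\<close>

lemma out_coeff_swap:
  assumes "a \<in> dual_rail" "a' \<in> dual_rail"
  shows "out_coeff r a' a b' b = out_coeff r a a' b b'"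
proof (cases "shift a' b = shift a b'")
  case True
  then have "photons b = photons b'" using photons_shift[OF assms(1), of b'] photons_shift[OF assms(2), of b] by simp
  then show ?thesis using True by (simp add: out_coeff_def mult_ac)
next
  case False
  then have "shift a b' \<noteq> shift a' b" by simp
  then show ?thesis using False by (simp add: out_coeff_def)
qed

lemma env_coeff_swap:
  assumes "a \<in> dual_rail" "a' \<in> dual_rail"
  shows "env_coeff r a' a e' e = env_coeff r a a' e e'"
proof (cases "shift a e = shift a' e'")
  case True
  then have "photons e = photons e'" using photons_shift[OF assms(1), of e] photons_shift[OF assms(2), of e'] by simp
  then show ?thesis using True by (simp add: env_coeff_def mult_ac)
next
  case False
  then have "shift a' e' \<noteq> shift a e" by simp
  then show ?thesis using False by (simp add: env_coeff_def)
qed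

lemma out_coeff_eq_0:
  assumes "a \<in> dual_rail" "a' \<in> dual_rail" "photons b \<noteq> photons b'"
  shows "out_coeff r a a' b b' = 0"
proof -
  have "shift a' b \<noteq> shift a b'" using assms by (metis nat.inject photons_shift)
  then show ?thesis by (simp add: out_coeff_def)
qed

lemma env_coeff_eq_0:
  assumes "a \<in> dual_rail" "a' \<in> dual_rail" "photons e \<noteq> photons e'"
  shows "env_coeff r a a' e e' = 0"
proof -
  have "shift a e \<noteq> shift a' e'" using assms by (metis nat.inject photons_shift)
  then show ?thesis by (simp add: env_coeff_def)
qed

subsection \<open>Block probabilities\<close>

text \<open>The norm of one column of the isometry, regrouped by output photon number.\<close>

lemma block_prob_has_sum: "(block_prob r has_sum 1) UNIV"
proof -
  let ?a = "(1, 0) :: fock"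
  have a: "?a \<in> dual_rail" by (simp add: dual_rail_def)
  have "((\<lambda>e. weight r (Suc (photons e)) * (ladder ?a (shift ?a e) * ladder ?a (shift ?a e))) has_sum 1) UNIV"
    by (rule column_norm_has_sum[OF a])
  also have "?this \<longleftrightarrow> ((\<lambda>b. out_coeff r ?a ?a b b) has_sum 1) {b. fst b > 0}"
    by (rule has_sum_reindex_bij_witness[of _ "\<lambda>b. (fst b - 1, snd b)" "shift ?a"])
      (auto simp: shift_def out_coeff_def photons_def)
  also have "\<dots> \<longleftrightarrow> ((\<lambda>b. out_coeff r ?a ?a b b) has_sum 1) UNIV"
    by (rule has_sum_cong_neutral) (auto simp: out_coeff_def ladder_def)
  also have "\<dots> \<longleftrightarrow> ((\<lambda>(l, b). out_coeff r ?a ?a b b) has_sum 1) (Sigma UNIV out_block)"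
    by (rule has_sum_reindex_bij_witness[of _ snd "\<lambda>b. (photons b, b)"]) (auto simp: out_block_def)
  finally show ?thesis
  proof (rule has_sum_SigmaD)
    fix l
    show "((\<lambda>b. case (l, b) of (l, b) \<Rightarrow> out_coeff r ?a ?a b b) has_sum block_prob r l) (out_block l)"
      using out_coeff_trace[OF a a, of r l] by (simp add: has_sum_finiteI)
  qed
qed

lemma block_prob_le_1: "block_prob r l \<le> 1"
  using finite_sum_le_has_sum[OF block_prob_has_sum, of "{l}" r] by simp

text \<open>The block probability is of order \<open>l^2 z^l\<close>; the division by
  \<open>tanh r\<close> corrects the exponent \<open>l - 1\<close> in \<open>weight\<close>.\<close>

lemma sqrt_block_prob_le:
  assumes "r > 0"
  shows "sqrt (block_prob r l) \<le> (real l + 1) * tanh r ^ l / tanh r"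
proof (cases l)
  case 0
  then show ?thesis using assms by simp
next
  case (Suc m)
  define t where "t = tanh r"
  have t: "t > 0" "t\<^sup>2 < 1" using assms tanh_square_less_1[of r] by (auto simp: t_def)
  have "block_prob r l = (1 - t\<^sup>2) ^ 3 * ((t ^ m)\<^sup>2 * (real l * (real l + 1) / 2))"
    by (simp add: block_prob_def weight_def Suc t_def power_mult[symmetric] mult.commute[of 2] mult.assoc)
  also have "\<dots> \<le> 1 * ((t ^ m)\<^sup>2 * (real l + 1)\<^sup>2)"
    using t by (intro mult_mono power_le_one mult_left_mono) (auto simp: power2_eq_square algebra_simps)
  also have "\<dots> = ((real l + 1) * t ^ m)\<^sup>2" by (simp add: power_mult_distrib mult.commute)
  finally have "sqrt (block_prob r l) \<le> (real l + 1) * t ^ m"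
    using t by (intro real_le_lsqrt) auto
  also have "t ^ m = t ^ l / t" using t Suc by simp
  finally show ?thesis by (simp add: t_def)
qed

text \<open>The bound m + n + 1 \<le> (m + 1) (n + 1) makes the majorant a product of two
  single-mode series.\<close>

lemma photons_geometric_summable:
  assumes "0 \<le> t" "t < 1"
  shows "(\<lambda>b. (real (photons b) + 1) * t ^ photons b) summable_on UNIV"
proof (rule summable_on_comparison_test)
  have s: "(\<lambda>n. real (Suc n) * t ^ n) summable_on UNIV"
    using geometric_deriv_sums[of t] assms
    by (intro has_sum_imp_summable[OF sums_nonneg_imp_has_sum]) auto
  have "((\<lambda>(m, n). real (Suc m) * t ^ m * (real (Suc n) * t ^ n)) has_sum
      (\<Sum>\<^sub>\<infinity>n. real (Suc n) * t ^ n) * (\<Sum>\<^sub>\<infinity>n. real (Suc n) * t ^ n)) (UNIV \<times> UNIV)"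
    using assms by (intro has_sum_times_nonneg has_sum_infsum s) auto
  then show "(\<lambda>(m, n). real (Suc m) * t ^ m * (real (Suc n) * t ^ n)) summable_on UNIV"
    by (auto dest: has_sum_imp_summable)
  fix b :: "fock"
  obtain m n where b: "b = (m, n)" by (cases b)
  have "real (photons b) + 1 \<le> real (Suc m) * real (Suc n)" by (simp add: b photons_def algebra_simps)
  then have "(real (photons b) + 1) * t ^ photons b \<le> real (Suc m) * real (Suc n) * t ^ photons b"
    using assms by (intro mult_right_mono) auto
  then show "(real (photons b) + 1) * t ^ photons b \<le> (case b of (m, n) \<Rightarrow> real (Suc m) * t ^ m * (real (Suc n) * t ^ n))"
    by (simp add: b photons_def power_add mult_ac)
qed (use assms in auto)

text \<open>The sum runs over basis states, so each block counts with its dimension; geometric decay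
  absorbs this. The two labellings serve output and environment.\<close>

lemma sqrt_block_prob_summable:
  assumes "r > 0"
  shows "(\<lambda>b. sqrt (block_prob r (photons b))) summable_on UNIV"
    and "(\<lambda>b. sqrt (block_prob r (Suc (photons b)))) summable_on UNIV"
proof -
  have t: "0 < tanh r" "tanh r < 1" using assms by (auto simp: tanh_real_lt_1)
  have g: "(\<lambda>b. (real (photons b) + 1) * tanh r ^ photons b) summable_on UNIV"
    using t by (intro photons_geometric_summable) auto
  show "(\<lambda>b. sqrt (block_prob r (photons b))) summable_on UNIV"
  proof (rule summable_on_comparison_test)
    show "(\<lambda>b. (real (photons b) + 1) * tanh r ^ photons b * (1 / tanh r)) summable_on UNIV"
      using g by (rule summable_on_cmult_left)
  qed (use sqrt_block_prob_le[OF assms] in auto)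
  show "(\<lambda>b. sqrt (block_prob r (Suc (photons b)))) summable_on UNIV"
  proof (rule summable_on_comparison_test)
    show "(\<lambda>b. 2 * ((real (photons b) + 1) * tanh r ^ photons b)) summable_on UNIV"
      using g by (rule summable_on_cmult_right)
    fix b
    have "sqrt (block_prob r (Suc (photons b))) \<le> (real (Suc (photons b)) + 1) * tanh r ^ photons b"
      using sqrt_block_prob_le[OF assms, of "Suc (photons b)"] t by simp
    also have "\<dots> \<le> (2 * (real (photons b) + 1)) * tanh r ^ photons b"
      using t by (intro mult_right_mono) auto
    finally show "sqrt (block_prob r (Suc (photons b))) \<le> 2 * ((real (photons b) + 1) * tanh r ^ photons b)"
      by (simp only: mult.assoc)
  qed auto
qed

subsection \<open>The block decomposition of the output and environment states\<close>

abbreviation level :: "nat \<Rightarrow> ('a list \<Rightarrow> nat list) \<Rightarrow> nat list \<Rightarrow> 'a list set" where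
  "level n f L \<equiv> {w \<in> words n UNIV. f w = L}"

abbreviation env_label :: "fock list \<Rightarrow> nat list" where
  "env_label \<equiv> map (\<lambda>e. Suc (photons e))"

abbreviation out_words :: "nat \<Rightarrow> nat list \<Rightarrow> fock list set" where
  "out_words n L \<equiv> pwords n (\<lambda>i. out_block (L ! i))"

abbreviation env_words :: "nat \<Rightarrow> nat list \<Rightarrow> fock list set" where
  "env_words n L \<equiv> pwords n (\<lambda>i. env_block (L ! i))"

abbreviation kraus_words :: "nat \<Rightarrow> nat list \<Rightarrow> (fock + fock \<times> fock) list set" where
  "kraus_words n L \<equiv> pwords n (\<lambda>i. kraus_indices (L ! i))"

abbreviation word_prob :: "real \<Rightarrow> nat \<Rightarrow> nat list \<Rightarrow> real" where
  "word_prob r n L \<equiv> \<Prod>i<n. block_prob r (L ! i)"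

text \<open>Junk value \<open>x / 0 = 0\<close> if \<open>0\<close> occurs in \<open>L\<close>; then \<open>word_prob r n L = 0\<close>.\<close>

abbreviation dim_ratio :: "nat \<Rightarrow> nat list \<Rightarrow> real" where
  "dim_ratio n L \<equiv> \<Prod>i<n. (real (L ! i) + 1) / real (L ! i)"

lemma words_map_eq_iff:
  assumes "L \<in> words n UNIV"
  shows "w \<in> words n UNIV \<and> map f w = L \<longleftrightarrow> w \<in> pwords n (\<lambda>i. {x. f x = L ! i})"
  using words_length[OF assms] by (auto simp: words_def pwords_def list_eq_iff_nth_eq)

lemma out_word_block:
  "L \<in> words n UNIV \<Longrightarrow> level n (map photons) L = out_words n L"
  using words_map_eq_iff[of L n _ photons] by (auto simp: out_block_def)

lemma env_word_block:
  "L \<in> words n UNIV \<Longrightarrow> level n env_label L = env_words n L"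
  using words_map_eq_iff[of L n _ "\<lambda>e. Suc (photons e)"] by (auto simp: env_block_def)

lemma map_in_words: "w \<in> words n UNIV \<Longrightarrow> map f w \<in> words n UNIV"
  by (simp add: words_def)

lemma block_spectralD:
  fixes t :: "'i \<Rightarrow> 't" and c :: 't
  assumes bs: "block_spectral I t M u lam"
  defines "B \<equiv> {i \<in> I. t i = c}"
  shows "finite B"
    and "\<And>k l. k \<in> B \<Longrightarrow> l \<in> B \<Longrightarrow> (\<Sum>i\<in>B. cnj (u k i) * u l i) = (if k = l then 1 else 0)"
    and "\<And>i j. i \<in> B \<Longrightarrow> j \<in> B \<Longrightarrow> (\<Sum>k\<in>B. u k i * cnj (u k j)) = (if i = j then 1 else 0)"
    and "\<And>i j. i \<in> B \<Longrightarrow> j \<in> B \<Longrightarrow> M i j = (\<Sum>k\<in>B. of_real (lam k) * u k i * cnj (u k j))"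
proof -
  show "finite B"
  proof (cases "B = {}")
    case False
    then obtain k where "k \<in> I" "t k = c" by (auto simp: B_def)
    then show ?thesis using bs by (auto simp: block_spectral_def B_def)
  qed simp
  fix k l assume kl: "k \<in> B" "l \<in> B"
  then have *: "k \<in> I" "l \<in> I" "t k = t l" "B = {i \<in> I. t i = t k}" by (auto simp: B_def)
  show "(\<Sum>i\<in>B. cnj (u k i) * u l i) = (if k = l then 1 else 0)"
    using bs * unfolding block_spectral_def *(4) by blast
  show "(\<Sum>i\<in>B. u i k * cnj (u i l)) = (if k = l then 1 else 0)"
    using bs * unfolding block_spectral_def *(4) by blast
  show "M k l = (\<Sum>i\<in>B. of_real (lam i) * u i k * cnj (u i l))"
    using bs * unfolding block_spectral_def *(4) by blast
qed

lemma block_spectral_trace: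
  assumes bs: "block_spectral I t M u lam"
  shows "complex_of_real (\<Sum>k | k \<in> I \<and> t k = c. lam k) = (\<Sum>i | i \<in> I \<and> t i = c. M i i)"
proof -
  let ?B = "{i \<in> I. t i = c}"
  have "(\<Sum>i\<in>?B. M i i) = (\<Sum>i\<in>?B. \<Sum>k\<in>?B. of_real (lam k) * (cnj (u k i) * u k i))"
    using block_spectralD(4)[OF bs] by (intro sum.cong refl) (simp add: mult_ac)
  also have "\<dots> = (\<Sum>k\<in>?B. of_real (lam k) * (\<Sum>i\<in>?B. cnj (u k i) * u k i))"
    by (subst sum.swap) (simp add: sum_distrib_left)
  also have "\<dots> = (\<Sum>k\<in>?B. of_real (lam k))"
    using block_spectralD(2)[OF bs, where c = c] by (intro sum.cong refl) auto
  finally show ?thesis by simp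
qed

lemma block_spectral_diagonal:
  assumes "\<And>k. k \<in> I \<Longrightarrow> finite {i \<in> I. t i = t k}"
    and M: "\<And>i j. i \<in> I \<Longrightarrow> j \<in> I \<Longrightarrow> M i j = (if i = j then of_real (lam i) else 0)"
  shows "block_spectral I t M (\<lambda>k i. if i = k then 1 else 0) lam"
  unfolding block_spectral_def
proof (intro conjI ballI impI)
  fix k l assume kl: "k \<in> I" "l \<in> I" "t k = t l"
  let ?B = "{i \<in> I. t i = t k}"
  have B: "finite ?B" "k \<in> ?B" "l \<in> ?B" using assms(1) kl by auto
  have "(\<Sum>i\<in>?B. cnj (if i = k then 1 else 0) * (if i = l then 1 else 0)) = (\<Sum>i\<in>?B. if i = k then if k = l then 1 else 0 else (0::complex))"
    by (intro sum.cong refl) auto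
  then show "(\<Sum>i\<in>?B. cnj (if i = k then 1 else 0) * (if i = l then 1 else 0)) = (if k = l then 1 else (0::complex))"
    using B by simp
  have "(\<Sum>i\<in>?B. (if k = i then 1 else 0) * cnj (if l = i then 1 else 0)) = (\<Sum>i\<in>?B. if k = i then if k = l then 1 else 0 else (0::complex))"
    by (intro sum.cong refl) auto
  then show "(\<Sum>i\<in>?B. (if k = i then 1 else 0) * cnj (if l = i then 1 else 0)) = (if k = l then 1 else (0::complex))"
    using B by simp
  have "(\<Sum>i\<in>?B. complex_of_real (lam i) * (if k = i then 1 else 0) * cnj (if l = i then 1 else 0))
      = (\<Sum>i\<in>?B. if k = i then if k = l then of_real (lam i) else 0 else 0)"
    by (intro sum.cong refl) auto
  then show "M k l = (\<Sum>i\<in>?B. complex_of_real (lam i) * (if k = i then 1 else 0) * cnj (if l = i then 1 else 0))"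
    using B M kl by simp
qed (use assms in auto)

text \<open>Nonnegative eigenvalues are bounded by the trace of their block, a product of block
  probabilities. Products of the square roots are summable over words and dominate both the
  eigenvalues and the entropy terms, so the entropy is finite and may be summed block by
  block.\<close>

lemma entropy_by_blocks:
  fixes \<tau> :: "fock \<Rightarrow> nat"
  assumes bs: "block_spectral (words n UNIV) (map \<tau>) M u lam"
    and nonneg: "\<And>k. k \<in> words n UNIV \<Longrightarrow> lam k \<ge> 0"
    and tr: "\<And>L. L \<in> words n UNIV \<Longrightarrow>
      (\<Sum>k\<in>level n (map \<tau>) L. lam k) = (word_prob r n L)"
    and sq: "(\<lambda>b. sqrt (block_prob r (\<tau> b))) summable_on UNIV"
  obtains H where "vn_entropy (words n UNIV) M = ereal H"
    and "((\<lambda>L. \<Sum>k\<in>level n (map \<tau>) L. eta (lam k)) has_sum H) (words n UNIV)"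
proof -
  define W :: "fock list set" where "W = words n UNIV"
  define P where "P k = (\<Prod>i<n. block_prob r (\<tau> (k ! i)))" for k
  note fin = block_spectralD(1)[OF bs, folded W_def]
  have lamP: "lam k \<le> P k" if k: "k \<in> W" for k
  proof -
    have "lam k \<le> (\<Sum>k' | k' \<in> W \<and> map \<tau> k' = map \<tau> k. lam k')"
      using k nonneg by (intro member_le_sum fin) (auto simp: W_def)
    also have "\<dots> = P k"
      using tr[of "map \<tau> k"] k words_length[of k n UNIV] by (simp add: W_def P_def map_in_words)
    finally show ?thesis .
  qed
  have P1: "P k \<le> 1" for k unfolding P_def by (intro prod_le_1 conjI block_prob_nonneg block_prob_le_1)
  have "sqrt (P k) = (\<Prod>i<n. sqrt (block_prob r (\<tau> (k ! i))))" for k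
    unfolding P_def by (induction n) (simp_all add: real_sqrt_mult)
  moreover have "(\<lambda>k. \<Prod>i<n. sqrt (block_prob r (\<tau> (k ! i)))) summable_on W"
    unfolding W_def words_eq_pwords
    by (rule has_sum_imp_summable[OF has_sum_pwords[THEN conjunct1]]) (use sq in \<open>auto intro: has_sum_infsum\<close>)
  ultimately have sqP: "(\<lambda>k. sqrt (P k)) summable_on W" by simp
  have lam1: "0 \<le> lam k" "lam k \<le> 1" if "k \<in> W" for k
    using nonneg lamP[OF that] P1[of k] that by (auto simp: W_def)
  have "lam summable_on W"
  proof (rule summable_on_comparison_test[OF sqP])
    fix k assume k: "k \<in> W"
    have "lam k * lam k \<le> 1 * P k" using lam1[OF k] lamP[OF k] by (intro mult_mono) auto
    then show "lam k \<le> sqrt (P k)" by (intro real_le_rsqrt) (simp add: power2_eq_square)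
  qed (rule lam1)
  have "(\<lambda>k. 2 / ln 2 * sqrt (P k)) summable_on W" using sqP by (rule summable_on_cmult_right)
  then have etas: "(\<lambda>k. eta (lam k)) summable_on W"
  proof (rule summable_on_comparison_test)
    fix k assume k: "k \<in> W"
    have "eta (lam k) \<le> 2 / ln 2 * sqrt (lam k)" by (rule eta_le_sqrt[OF lam1(1)[OF k]])
    also have "\<dots> \<le> 2 / ln 2 * sqrt (P k)" using lamP[OF k] by (intro mult_left_mono) auto
    finally show "eta (lam k) \<le> 2 / ln 2 * sqrt (P k)" .
    show "eta (lam k) \<ge> 0" using lam1[OF k] by (rule eta_nonneg)
  qed
  define H where "H = (\<Sum>\<^sub>\<infinity>k\<in>W. eta (lam k))"
  have H: "((\<lambda>k. eta (lam k)) has_sum H) W" unfolding H_def using etas by (rule has_sum_infsum)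
  have "vn_entropy W M = ereal H"
    using bs \<open>lam summable_on W\<close> H nonneg unfolding W_def by (intro vn_entropy_block_spectral)
  moreover have "((\<lambda>L. \<Sum>k | k \<in> W \<and> map \<tau> k = L. eta (lam k)) has_sum H) (words n UNIV)"
  proof (rule has_sum_SigmaD)
    show "((\<lambda>(L, k). eta (lam k)) has_sum H) (Sigma (words n UNIV) (\<lambda>L. {k \<in> W. map \<tau> k = L}))"
      by (rule has_sum_reindex_bij_witness[THEN iffD1, of W snd "\<lambda>k. (map \<tau> k, k)", OF _ _ _ _ _ refl H])
        (auto simp: W_def map_in_words)
    fix L show "((\<lambda>k. case (L, k) of (L, k) \<Rightarrow> eta (lam k)) has_sum (\<Sum>k | k \<in> W \<and> map \<tau> k = L. eta (lam k))) {k \<in> W. map \<tau> k = L}"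
      using fin by (simp add: has_sum_finiteI)
  qed
  ultimately show thesis using that unfolding W_def by blast
qed

subsection \<open>Degradation for several uses of the channel\<close>

definition word_kraus ::
    "nat \<Rightarrow> nat list \<Rightarrow> (fock + fock \<times> fock) list \<Rightarrow> fock list \<Rightarrow> fock list \<Rightarrow> real" where
  "word_kraus n L x e b = (\<Prod>i<n. kraus (L ! i) (x ! i) (e ! i) (b ! i))"

abbreviation word_kernel :: "nat \<Rightarrow> nat list \<Rightarrow> fock list \<Rightarrow> fock list \<Rightarrow> fock list \<Rightarrow> fock list \<Rightarrow> real" where
  "word_kernel n L e b e' b' \<equiv> \<Sum>x\<in>kraus_words n L. word_kraus n L x e b * word_kraus n L x e' b'"

text \<open>The kernel for several uses is a product over positions; trace preservation, the scaled
  unit and degradation then factor into the one-use statements.\<close>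

lemma sum_word_kraus:
  "word_kernel n L e b e' b'
    = (\<Prod>i<n. kraus_kernel (L ! i) (e ! i) (b ! i) (e' ! i) (b' ! i))"
  unfolding word_kraus_def prod.distrib[symmetric] by (rule sum_pwords) simp

lemma prod_delta_pwords:
  fixes f :: "nat \<Rightarrow> real"
  assumes "a \<in> pwords n S" "a' \<in> pwords n S'"
  shows "(\<Prod>i<n. if a ! i = a' ! i then f i else 0) = (if a = a' then \<Prod>i<n. f i else 0)"
  using prod_delta_words[of a n UNIV a' UNIV f] assms by (simp add: words_def pwords_def)

lemma word_kraus_trace_preserving:
  assumes L: "\<And>i. i < n \<Longrightarrow> L ! i > 0"
    and b: "b \<in> out_words n L" "b' \<in> out_words n L"
  shows "(\<Sum>e\<in>env_words n L. word_kernel n L e b e b') = (if b = b' then 1 else 0)"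
proof -
  have "(\<Sum>e\<in>env_words n L. word_kernel n L e b e b')
    = (\<Prod>i<n. \<Sum>e\<in>env_block (L ! i). kraus_kernel (L ! i) e (b ! i) e (b' ! i))"
    unfolding sum_word_kraus by (rule sum_pwords) simp
  also have "\<dots> = (\<Prod>i<n. if b ! i = b' ! i then 1 else 0)"
    by (intro prod.cong refl kraus_trace_preserving) (use b L in \<open>auto simp: pwords_def\<close>)
  also have "\<dots> = (if b = b' then 1 else 0)" using prod_delta_pwords[OF b, of "\<lambda>_. 1"] by simp
  finally show ?thesis .
qed

lemma word_kraus_unital:
  assumes e: "e \<in> env_words n L" "e' \<in> env_words n L"
  shows "(\<Sum>b\<in>out_words n L. word_kernel n L e b e' b) = (if e = e' then dim_ratio n L else 0)"
proof -
  have "(\<Sum>b\<in>out_words n L. word_kernel n L e b e' b)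
    = (\<Prod>i<n. \<Sum>b\<in>out_block (L ! i). kraus_kernel (L ! i) (e ! i) b (e' ! i) b)"
    unfolding sum_word_kraus by (rule sum_pwords) simp
  also have "\<dots> = (\<Prod>i<n. if e ! i = e' ! i then (real (L ! i) + 1) / real (L ! i) else 0)"
    by (intro prod.cong refl kraus_unital) (use e in \<open>auto simp: pwords_def\<close>)
  also have "\<dots> = (if e = e' then dim_ratio n L else 0)" by (rule prod_delta_pwords[OF e])
  finally show ?thesis .
qed

lemma env_word_degraded:
  assumes e: "e \<in> env_words n L" "e' \<in> env_words n L"
    and a: "a \<in> inputs n" "a' \<in> inputs n"
  shows "env_word r n a a' e e' = (\<Sum>b\<in>out_words n L. \<Sum>b'\<in>out_words n L.
    word_kernel n L e' b e b' * out_word r n a a' b b')"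
proof -
  have "(\<Sum>b\<in>out_words n L. \<Sum>b'\<in>out_words n L.
      word_kernel n L e' b e b' * out_word r n a a' b b')
    = (\<Sum>b\<in>out_words n L. \<Prod>i<n. \<Sum>b'\<in>out_block (L ! i).
      kraus_kernel (L ! i) (e' ! i) (b ! i) (e ! i) b' * out_coeff r (a ! i) (a' ! i) (b ! i) b')"
    unfolding sum_word_kraus out_word_def prod.distrib[symmetric] by (intro sum.cong refl sum_pwords) simp
  also have "\<dots> = (\<Prod>i<n. \<Sum>b\<in>out_block (L ! i). \<Sum>b'\<in>out_block (L ! i).
      kraus_kernel (L ! i) (e' ! i) b (e ! i) b' * out_coeff r (a ! i) (a' ! i) b b')"
    by (rule sum_pwords) simp
  also have "\<dots> = env_word r n a a' e e'"
    unfolding env_word_def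
    by (intro prod.cong refl env_coeff_degraded[symmetric]) (use e a in \<open>auto simp: pwords_def words_nth\<close>)
  finally show ?thesis by simp
qed

lemma out_word_trace:
  assumes a: "a \<in> inputs n" "a' \<in> inputs n"
  shows "(\<Sum>b\<in>out_words n L. out_word r n a a' b b)
    = (if a = a' then word_prob r n L else 0)"
proof -
  have "(\<Sum>b\<in>out_words n L. out_word r n a a' b b)
    = (\<Prod>i<n. \<Sum>b\<in>out_block (L ! i). out_coeff r (a ! i) (a' ! i) b b)"
    unfolding out_word_def by (rule sum_pwords) simp
  also have "\<dots> = (\<Prod>i<n. if a ! i = a' ! i then block_prob r (L ! i) else 0)"
    by (intro prod.cong refl out_coeff_trace) (use a in \<open>auto simp: words_nth\<close>)
  also have "\<dots> = (if a = a' then word_prob r n L else 0)" by (rule prod_delta_words[OF a])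
  finally show ?thesis .
qed

definition env_state :: "real \<Rightarrow> nat \<Rightarrow> (fock list, fock list) superop" where
  "env_state r n \<rho> = ptrace_left (words n UNIV) (conjugate_by (inputs n) (canonical_extension r n) \<rho>)"

lemma env_state_eq:
  "env_state r n \<rho> e e' =
    (\<Sum>a\<in>inputs n. \<Sum>a'\<in>inputs n. \<rho> a a' * of_real (env_word r n a a' e e'))"
  unfolding env_state_def by (rule ptrace_left_canonical)

lemma env_state_degraded:
  assumes e: "e \<in> env_words n L" "e' \<in> env_words n L"
  shows "env_state r n \<rho> e e' = (\<Sum>b\<in>out_words n L. \<Sum>b'\<in>out_words n L.
    of_real (word_kernel n L e' b e b') * channel_power r n \<rho> b b')"
proof -
  let ?D = "inputs n" and ?B = "out_words n L"
  define G where "G b b' = word_kernel n L e' b e b'" for b b'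
  have "env_state r n \<rho> e e' = (\<Sum>a\<in>?D. \<Sum>a'\<in>?D. \<Sum>b\<in>?B. \<Sum>b'\<in>?B. \<rho> a a' * of_real (G b b' * out_word r n a a' b b'))"
    unfolding env_state_eq
    by (intro sum.cong refl) (simp add: env_word_degraded[OF e] G_def sum_distrib_left)
  also have "\<dots> = (\<Sum>b\<in>?B. \<Sum>b'\<in>?B. \<Sum>a\<in>?D. \<Sum>a'\<in>?D. \<rho> a a' * of_real (G b b' * out_word r n a a' b b'))"
  proof -
    have swap: "(\<Sum>j\<in>?D. \<Sum>b\<in>?B. \<Sum>b'\<in>?B. f j b b') = (\<Sum>b\<in>?B. \<Sum>b'\<in>?B. \<Sum>j\<in>?D. f j b b')"
      for f :: "_ \<Rightarrow> _ \<Rightarrow> _ \<Rightarrow> complex"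
      by (subst sum.swap, rule sum.cong[OF refl], rule sum.swap)
    show ?thesis by (subst swap[symmetric], rule sum.cong[OF refl], rule swap)
  qed
  also have "\<dots> = (\<Sum>b\<in>?B. \<Sum>b'\<in>?B. of_real (G b b') * channel_power r n \<rho> b b')"
    unfolding channel_power_eq sum_distrib_left by (simp add: mult_ac)
  finally show ?thesis by (simp only: G_def)
qed

subsection \<open>Upper bound on the coherent information\<close>

lemma input_state_cnj: "input_state \<phi> a' a = cnj (input_state \<phi> a a')"
  unfolding input_state_def infsum_cnj[symmetric] by (simp add: mult.commute)

lemma hermitian_word_state:
  assumes "\<And>a a'. a \<in> D \<Longrightarrow> a' \<in> D \<Longrightarrow> c a' a b' b = c a a' b (b' :: 'b)"
  shows "(\<Sum>a\<in>D. \<Sum>a'\<in>D. input_state \<phi> a a' * complex_of_real (c a a' b' b))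
    = cnj (\<Sum>a\<in>D. \<Sum>a'\<in>D. input_state \<phi> a a' * of_real (c a a' b b'))"
proof -
  have "cnj (\<Sum>a\<in>D. \<Sum>a'\<in>D. input_state \<phi> a a' * of_real (c a a' b b'))
    = (\<Sum>a\<in>D. \<Sum>a'\<in>D. input_state \<phi> a' a * of_real (c a' a b' b))"
    unfolding cnj_sum by (intro sum.cong refl) (simp add: assms input_state_cnj[symmetric])
  then show ?thesis by (subst (asm) sum.swap) simp
qed

lemma finite_word_blocks:
  fixes k :: "fock list"
  assumes "k \<in> words n UNIV"
  shows "finite {b \<in> words n UNIV. map photons b = map photons k}"
    and "finite {e \<in> words n UNIV. env_label e = env_label k}"
  using out_word_block[OF map_in_words[OF assms, of photons]]
    env_word_block[OF map_in_words[OF assms, of "\<lambda>e. Suc (photons e)"]]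
  by (simp_all add: finite_pwords)

abbreviation out_state :: "real \<Rightarrow> nat \<Rightarrow> (nat \<times> fock list) vec \<Rightarrow> (fock list, fock list) opr" where
  "out_state r n \<phi> \<equiv> channel_power r n (input_state \<phi>)"

lemma ex_block_spectral_output:
  "\<exists>u lam. block_spectral (words n UNIV) (map photons) (out_state r n \<phi>) u lam"
proof (rule ex_block_spectral)
  fix b b' :: "fock list" assume b: "b \<in> words n UNIV" "b' \<in> words n UNIV"
  {
    assume "map photons b \<noteq> map photons b'"
    then obtain i where i: "i < n" "photons (b ! i) \<noteq> photons (b' ! i)"
      using words_length[OF b(1)] words_length[OF b(2)] by (auto simp: list_eq_iff_nth_eq)
    have "out_word r n a a' b b' = 0" if "a \<in> inputs n" "a' \<in> inputs n" for a a'
      unfolding out_word_def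
      by (rule prod_zero) (use i out_coeff_eq_0[OF words_nth[OF that(1) i(1)] words_nth[OF that(2) i(1)] i(2)] in auto)
    then show "out_state r n \<phi> b b' = 0" by (simp add: channel_power_eq)
  }
  show "out_state r n \<phi> b' b = cnj (out_state r n \<phi> b b')"
    unfolding channel_power_eq
    by (rule hermitian_word_state) (auto simp: out_word_def intro!: prod.cong out_coeff_swap words_nth)
qed (rule finite_word_blocks(1))

lemma ex_block_spectral_environment:
  "\<exists>u lam. block_spectral (words n UNIV) (env_label) (env_state r n (input_state \<phi>)) u lam"
proof (rule ex_block_spectral)
  fix e e' :: "fock list" assume e: "e \<in> words n UNIV" "e' \<in> words n UNIV"
  {
    assume "env_label e \<noteq> env_label e'"
    then obtain i where i: "i < n" "photons (e ! i) \<noteq> photons (e' ! i)"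
      using words_length[OF e(1)] words_length[OF e(2)] by (auto simp: list_eq_iff_nth_eq)
    have "env_word r n a a' e e' = 0" if "a \<in> inputs n" "a' \<in> inputs n" for a a'
      unfolding env_word_def
      by (rule prod_zero) (use i env_coeff_eq_0[OF words_nth[OF that(1) i(1)] words_nth[OF that(2) i(1)] i(2)] in auto)
    then show "env_state r n (input_state \<phi>) e e' = 0" by (simp add: env_state_eq)
  }
  show "env_state r n (input_state \<phi>) e' e = cnj (env_state r n (input_state \<phi>) e e')"
    unfolding env_state_eq
    by (rule hermitian_word_state) (auto simp: env_word_def intro!: prod.cong env_coeff_swap words_nth)
qed (rule finite_word_blocks(2))

lemma channel_power_trace:
  assumes \<phi>: "pure_state (UNIV \<times> inputs n) \<phi>"
  shows "(\<Sum>b\<in>out_words n L. out_state r n \<phi> b b)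
    = of_real (word_prob r n L)"
proof -
  let ?D = "inputs n" and ?B = "out_words n L"
  have D: "finite ?D" by (simp add: finite_words)
  have "(\<Sum>b\<in>?B. out_state r n \<phi> b b)
    = (\<Sum>a\<in>?D. \<Sum>a'\<in>?D. input_state \<phi> a a' * of_real (\<Sum>b\<in>?B. out_word r n a a' b b))"
    unfolding channel_power_eq of_real_sum sum_distrib_left
    by (subst sum.swap, rule sum.cong[OF refl], rule sum.swap)
  also have "\<dots> = (\<Sum>a\<in>?D. \<Sum>a'\<in>?D. if a = a' then input_state \<phi> a a * of_real (word_prob r n L) else 0)"
    by (intro sum.cong refl) (simp add: out_word_trace)
  also have "\<dots> = (\<Sum>a\<in>?D. input_state \<phi> a a) * of_real (word_prob r n L)"
    using D by (simp add: sum_distrib_right)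
  finally show ?thesis using input_state_trace[OF D \<phi>] by simp
qed

text \<open>Resolved by the environment word \<open>e\<close>, the quadratic form is a sum of
  quadratic forms of the input state at the vectors \<open>x e\<close>, which are \<open>v\<close>
  pulled back through the Kraus operator of \<open>e\<close>.\<close>

lemma channel_power_psd:
  assumes \<phi>: "pure_state (UNIV \<times> inputs n) \<phi>" and B: "finite B"
  shows "Re (\<Sum>b\<in>B. \<Sum>b'\<in>B. cnj (v b) * out_state r n \<phi> b b' * v b') \<ge> 0"
proof -
  let ?D = "inputs n"
  have D: "finite ?D" by (simp add: finite_words)
  define x where "x e a = (\<Sum>b\<in>B. cnj (v b) * of_real (word_amplitude r n a b e))" for e a
  let ?S = "\<lambda>e. \<Sum>b\<in>B. \<Sum>b'\<in>B. cnj (v b) * v b' * (\<Sum>a\<in>?D. \<Sum>a'\<in>?D. input_state \<phi> a a' *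
      of_real (word_amplitude r n a b e * word_amplitude r n a' b' e))"
  let ?t = "\<lambda>a a' b b' e. (cnj (v b) * of_real (word_amplitude r n a b e)) * (v b' * of_real (word_amplitude r n a' b' e))"
  have "(?S
    has_sum (\<Sum>b\<in>B. \<Sum>b'\<in>B. cnj (v b) * v b' * out_state r n \<phi> b b')) (words n UNIV)"
    unfolding channel_power_eq
    by (intro has_sum_sum has_sum_cmult_right has_sum_of_real out_word_has_sum)
  also have "?S
    = (\<lambda>e. \<Sum>a\<in>?D. \<Sum>a'\<in>?D. x e a * input_state \<phi> a a' * cnj (x e a'))"
  proof
    fix e
    have swap: "(\<Sum>j\<in>B. \<Sum>b\<in>?D. \<Sum>b'\<in>?D. f j b b') = (\<Sum>b\<in>?D. \<Sum>b'\<in>?D. \<Sum>j\<in>B. f j b b')"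
      for f :: "_ \<Rightarrow> _ \<Rightarrow> _ \<Rightarrow> complex"
      by (subst sum.swap, rule sum.cong[OF refl], rule sum.swap)
    have "?S e
      = (\<Sum>b\<in>B. \<Sum>b'\<in>B. \<Sum>a\<in>?D. \<Sum>a'\<in>?D. input_state \<phi> a a' * ?t a a' b b' e)"
      by (simp add: sum_distrib_left mult_ac)
    also have "\<dots> = (\<Sum>a\<in>?D. \<Sum>a'\<in>?D. \<Sum>b\<in>B. \<Sum>b'\<in>B. input_state \<phi> a a' * ?t a a' b b' e)"
      by (subst swap[symmetric], rule sum.cong[OF refl], rule swap)
    also have "\<dots> = (\<Sum>a\<in>?D. \<Sum>a'\<in>?D. x e a * input_state \<phi> a a' * cnj (x e a'))"
    proof (intro sum.cong refl)
      fix a a'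
      have "x e a * cnj (x e a') = (\<Sum>b\<in>B. \<Sum>b'\<in>B. ?t a a' b b' e)"
        unfolding x_def cnj_sum sum_product by simp
      then have "(\<Sum>b\<in>B. \<Sum>b'\<in>B. input_state \<phi> a a' * ?t a a' b b' e)
        = input_state \<phi> a a' * (x e a * cnj (x e a'))"
        by (simp only: sum_distrib_left)
      then show "(\<Sum>b\<in>B. \<Sum>b'\<in>B. input_state \<phi> a a' * ?t a a' b b' e)
        = x e a * input_state \<phi> a a' * cnj (x e a')" by (simp only: mult_ac)
    qed
    finally show "?S e
      = (\<Sum>a\<in>?D. \<Sum>a'\<in>?D. x e a * input_state \<phi> a a' * cnj (x e a'))" .
  qed
  finally have "((\<lambda>e. Re (\<Sum>a\<in>?D. \<Sum>a'\<in>?D. x e a * input_state \<phi> a a' * cnj (x e a'))) has_sum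
      Re (\<Sum>b\<in>B. \<Sum>b'\<in>B. cnj (v b) * v b' * out_state r n \<phi> b b')) (words n UNIV)"
    by (rule has_sum_Re)
  then have "Re (\<Sum>b\<in>B. \<Sum>b'\<in>B. cnj (v b) * v b' * out_state r n \<phi> b b') \<ge> 0"
    by (rule has_sum_nonneg) (rule input_state_psd(2)[OF D \<phi>])
  then show ?thesis by (simp add: mult_ac)
qed

text \<open>The summation includes \<open>l = 0\<close>, where the ratio is a division by zero; the
  term is 0 since \<open>block_prob r 0 = 0\<close>.\<close>

definition capacity :: "real \<Rightarrow> real" where
  "capacity r = (\<Sum>\<^sub>\<infinity>l. block_prob r l * log 2 ((real l + 1) / real l))"

lemma log_ratio_bounds: "0 \<le> log 2 ((real l + 1) / real l)" "log 2 ((real l + 1) / real l) \<le> 1"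
proof -
  show "0 \<le> log 2 ((real l + 1) / real l)"
    by (cases "l = 0") (auto simp: log_def field_simps)
  show "log 2 ((real l + 1) / real l) \<le> 1"
    by (cases "l = 0") (auto simp: log_le_one_cancel_iff field_simps, simp add: log_def)
qed

lemma capacity_summable: "(\<lambda>l. block_prob r l * log 2 ((real l + 1) / real l)) summable_on UNIV"
  using has_sum_imp_summable[OF block_prob_has_sum]
proof (rule summable_on_comparison_test)
  fix l
  show "block_prob r l * log 2 ((real l + 1) / real l) \<le> block_prob r l"
    by (rule mult_left_le[OF log_ratio_bounds(2) block_prob_nonneg])
  show "0 \<le> block_prob r l * log 2 ((real l + 1) / real l)"
    by (rule mult_nonneg_nonneg[OF block_prob_nonneg log_ratio_bounds(1)])
qed

lemma prod_update_factor:
  fixes f g :: "nat \<Rightarrow> real"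
  assumes "j < n"
  shows "(\<Prod>i<n. if i = j then f i * g i else f i) = (\<Prod>i<n. f i) * g j"
proof -
  have "(\<Prod>i<n. if i = j then f i * g i else f i) = (\<Prod>i<n. f i * (if i = j then g i else 1))"
    by (intro prod.cong refl) simp
  then show ?thesis using assms by (simp add: prod.distrib)
qed

text \<open>The additivity computation: the logarithm of the ratio is a sum over positions. In the
  term for position \<open>j\<close> all other block probabilities sum to 1, leaving one
  \<open>capacity r\<close> for each position.\<close>

lemma word_information_has_sum:
  "((\<lambda>L. (word_prob r n L) * log 2 (dim_ratio n L))
    has_sum real n * capacity r) (words n UNIV)"
proof -
  define g where "g l = log 2 ((real l + 1) / real l)" for l
  let ?f = "\<lambda>j L. \<Prod>i<n. if i = j then block_prob r (L ! i) * g (L ! i) else block_prob r (L ! i)"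
  have "((\<lambda>L. \<Sum>j<n. ?f j L)
      has_sum (\<Sum>j<n. \<Prod>i<n. if i = j then capacity r else 1)) (words n UNIV)"
    unfolding words_eq_pwords
  proof (rule has_sum_sum)
    fix j
    show "((\<lambda>L. ?f j L)
      has_sum (\<Prod>i<n. if i = j then capacity r else 1)) (pwords n (\<lambda>_. UNIV))"
    proof (rule has_sum_pwords[THEN conjunct1])
      fix i
      show "((\<lambda>l. if i = j then block_prob r l * g l else block_prob r l) has_sum (if i = j then capacity r else 1)) UNIV"
        using capacity_summable[of r] block_prob_has_sum[of r]
        by (auto simp: capacity_def g_def intro: has_sum_infsum)
      then show "(\<lambda>l. norm (if i = j then block_prob r l * g l else block_prob r l)) summable_on UNIV"
        using log_ratio_bounds(1)
        by (auto simp: g_def abs_mult dest: has_sum_imp_summable split: if_splits)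
    qed
  qed
  also have "(\<Sum>j<n. \<Prod>i<n. if i = j then capacity r else 1) = real n * capacity r" by simp
  finally show ?thesis
  proof (rule has_sum_cong[THEN iffD1, rotated])
    fix L :: "nat list"
    have *: "(\<Sum>j<n. ?f j L)
      = (word_prob r n L) * (\<Sum>j<n. g (L ! j))"
      unfolding sum_distrib_left by (intro sum.cong refl prod_update_factor) simp
    show "(\<Sum>j<n. ?f j L)
      = (word_prob r n L) * log 2 (dim_ratio n L)"
    \<comment> \<open>A zero label makes the logarithm of the product meaningless as a sum, but the
      word probability vanishes with it.\<close>
    proof (cases "\<exists>i<n. L ! i = 0")
      case True
      then have "(word_prob r n L) = 0" by (intro prod_zero) force+
      then show ?thesis using * by simp
    next
      case False
      then have "ln (dim_ratio n L) = (\<Sum>i<n. ln ((real (L ! i) + 1) / real (L ! i)))"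
        by (intro ln_prod) auto
      then have "log 2 (dim_ratio n L) = (\<Sum>i<n. g (L ! i))"
        by (simp add: log_def g_def sum_divide_distrib)
      then show ?thesis using * by simp
    qed
  qed
qed

text \<open>Positivity and trace of the environment spectrum are outputs of the degradation
  argument, so positivity is assumed only for the output spectrum.\<close>

lemma block_entropy_difference_le:
  assumes bsB: "block_spectral (words n UNIV) (map photons) (channel_power r n \<rho>) u lam"
    and bsE: "block_spectral (words n UNIV) (env_label) (env_state r n \<rho>) w mu"
    and lam: "\<And>k. k \<in> words n UNIV \<Longrightarrow> lam k \<ge> 0"
    and tr: "(\<Sum>k\<in>level n (map photons) L. lam k) = (word_prob r n L)"
    and L: "L \<in> words n UNIV"
  defines "E \<equiv> level n env_label L"
  shows "\<And>e. e \<in> E \<Longrightarrow> mu e \<ge> 0" and "(\<Sum>e\<in>E. mu e) = (word_prob r n L)"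
    and "(\<Sum>k\<in>level n (map photons) L. eta (lam k)) - (\<Sum>e\<in>E. eta (mu e))
      \<le> (word_prob r n L) * log 2 (dim_ratio n L)"
proof -
  define B where "B = level n (map photons) L"
  note B = out_word_block[OF L, folded B_def] and E = env_word_block[OF L, folded E_def]
  note sB = block_spectralD[OF bsB, where c = L, folded B_def] and sE = block_spectralD[OF bsE, where c = L, folded E_def]
  have *: "(\<forall>e\<in>E. mu e \<ge> 0) \<and> (\<Sum>e\<in>E. mu e) = (word_prob r n L) \<and>
    (\<Sum>k\<in>B. eta (lam k)) \<le> (\<Sum>e\<in>E. eta (mu e)) + log 2 (dim_ratio n L) * (\<Sum>k\<in>B. lam k)"
  proof (cases "\<exists>i<n. L ! i = 0")
    \<comment> \<open>A zero label leaves no environment word, and the output block has trace 0, so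
      its eigenvalues all vanish.\<close>
    case True
    then have "E = {}" unfolding E by (force simp: pwords_def)
    moreover have P: "(word_prob r n L) = 0" using True by (intro prod_zero) force+
    have "lam k = 0" if "k \<in> B" for k
      using tr[folded B_def] that lam sB(1) unfolding P by (subst (asm) sum_nonneg_eq_0_iff) (auto simp: B_def)
    ultimately show ?thesis using P by simp
  next
    case False
    then have pos: "\<And>i. i < n \<Longrightarrow> L ! i > 0" by auto
    have c: "(dim_ratio n L) > 0" using pos by (intro prod_pos) auto
    let ?X = "kraus_words n L"
    have fin: "finite ?X" by (rule finite_pwords) simp
    have lamB: "\<And>k. k \<in> B \<Longrightarrow> lam k \<ge> 0" using lam by (simp add: B_def)
    have TP: "(\<Sum>e\<in>E. word_kernel n L e b e b') = (if b = b' then 1 else 0)"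
      if "b \<in> B" "b' \<in> B" for b b'
      using that pos unfolding B E by (intro word_kraus_trace_preserving)
    have unital: "(\<Sum>b\<in>B. word_kernel n L e b e' b)
      = (if e = e' then dim_ratio n L else 0)" if "e \<in> E" "e' \<in> E" for e e'
      using that unfolding B E by (rule word_kraus_unital)
    have degr: "env_state r n \<rho> e e' = (\<Sum>b\<in>B. \<Sum>b'\<in>B.
        of_real (word_kernel n L e' b e b') * channel_power r n \<rho> b b')"
      if "e \<in> E" "e' \<in> E" for e e'
      using that unfolding B E by (rule env_state_degraded)
    note deg = entropy_degraded[where B = B and E = E and X = ?X and K = "word_kraus n L" and v = u and lam = lam
        and SB = "channel_power r n \<rho>" and u = w and mu = mu and SE = "env_state r n \<rho>"
        and c = "\<Prod>i<n. (real (L ! i) + 1) / real (L ! i)"]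
    have "\<forall>e\<in>E. mu e \<ge> 0"
      by (rule ballI, rule deg(1)) (assumption | rule sB sE fin c TP unital degr lamB)+
    moreover have "sum mu E = sum lam B"
      by (rule deg(2)) (assumption | rule sB sE fin c TP unital degr lamB)+
    moreover have "(\<Sum>k\<in>B. eta (lam k)) \<le> (\<Sum>e\<in>E. eta (mu e)) + log 2 (dim_ratio n L) * (\<Sum>k\<in>B. lam k)"
      by (rule deg(3)) (assumption | rule sB sE fin c TP unital degr lamB)+
    ultimately show ?thesis using tr[folded B_def] by simp
  qed
  then show "\<And>e. e \<in> E \<Longrightarrow> mu e \<ge> 0" and "(\<Sum>e\<in>E. mu e) = (word_prob r n L)" by auto
  from * show "(\<Sum>k\<in>level n (map photons) L. eta (lam k)) - (\<Sum>e\<in>E. eta (mu e))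
      \<le> (word_prob r n L) * log 2 (dim_ratio n L)"
    using tr[folded B_def] unfolding B_def[symmetric] by (simp add: mult.commute)
qed

text \<open>The spectral decompositions are parameters: arbitrary ones give the upper bound, while
  the explicit diagonal ones of the maximally mixed input give the exact value.\<close>

theorem coherent_information_channel_power:
  assumes r: "r > 0" and \<phi>: "pure_state (UNIV \<times> inputs n) \<phi>"
    and U: "isometric_extension (inputs n) (words n UNIV) UNIV U (channel_power r n)"
    and bsB: "block_spectral (words n UNIV) (map photons) (out_state r n \<phi>) u lam"
    and bsE: "block_spectral (words n UNIV) (env_label) (env_state r n (input_state \<phi>)) w mu"
  obtains H where "coherent_information (inputs n) (words n UNIV) U \<phi> = ereal H"
    and "((\<lambda>L. (\<Sum>k\<in>level n (map photons) L. eta (lam k))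
      - (\<Sum>e\<in>level n env_label L. eta (mu e))) has_sum H) (words n UNIV)"
    and "H \<le> real n * capacity r"
proof -
  have D: "finite (inputs n)" by (simp add: finite_words)
  have trB: "(\<Sum>k\<in>level n (map photons) L. lam k) = (word_prob r n L)"
    if "L \<in> words n UNIV" for L
    using block_spectral_trace[OF bsB, of L] channel_power_trace[OF \<phi>, where L = L and r = r]
    unfolding out_word_block[OF that] by (metis of_real_eq_iff)
  have lam: "lam k \<ge> 0" if k: "k \<in> words n UNIV" for k
  proof -
    let ?B = "{b \<in> words n UNIV. map photons b = map photons k}"
    note s = block_spectralD[OF bsB, where c = "map photons k"]
    have "complex_of_real (lam k) = (\<Sum>b\<in>?B. \<Sum>b'\<in>?B. cnj (u k b) * out_state r n \<phi> b b' * u k b')"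
      by (rule eigenvalue_quadratic_form[OF s(1)]) (use s(2,4) k in auto)
    then show ?thesis
      using channel_power_psd[OF \<phi> s(1), of "u k" r] by (metis Re_complex_of_real)
  qed
  note diff = block_entropy_difference_le[OF bsB bsE lam trB]
  have mu: "mu k \<ge> 0" if k: "k \<in> words n UNIV" for k
    using diff(1)[of "env_label k" k] k map_in_words[OF k] by auto
  have trE: "(\<Sum>k\<in>level n env_label L. mu k) = (word_prob r n L)"
    if "L \<in> words n UNIV" for L
    using diff(2) that by blast
  obtain HB where HB: "vn_entropy (words n UNIV) (out_state r n \<phi>) = ereal HB"
    "((\<lambda>L. \<Sum>k\<in>level n (map photons) L. eta (lam k)) has_sum HB) (words n UNIV)"
    using entropy_by_blocks[OF bsB lam trB sqrt_block_prob_summable(1)[OF r]] by blast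
  obtain HE where HE: "vn_entropy (words n UNIV) (env_state r n (input_state \<phi>)) = ereal HE"
    "((\<lambda>L. \<Sum>k\<in>level n env_label L. eta (mu k)) has_sum HE) (words n UNIV)"
    using entropy_by_blocks[OF bsE mu trE sqrt_block_prob_summable(2)[OF r]] by blast
  have "coherent_information (inputs n) (words n UNIV) U \<phi> = ereal (HB - HE)"
    unfolding coherent_information_eq[OF D \<phi> U canonical_extension_isometric] env_state_def[symmetric] HB(1) HE(1)
    by simp
  moreover have hs: "((\<lambda>L. (\<Sum>k\<in>level n (map photons) L. eta (lam k))
      - (\<Sum>e\<in>level n env_label L. eta (mu e))) has_sum HB - HE) (words n UNIV)"
    using has_sum_add[OF HB(2), of "\<lambda>L. - (\<Sum>e\<in>level n env_label L. eta (mu e))" "- HE"] HE(2)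
    by (simp add: has_sum_uminus)
  moreover have "HB - HE \<le> real n * capacity r"
    by (rule has_sum_mono[OF hs word_information_has_sum]) (use diff(3) in blast)
  ultimately show thesis by (rule that)
qed

subsection \<open>The maximally entangled input attains the bound\<close>

lemma card_pwords: "card (pwords n S) = (\<Prod>i<n. card (S i))" if "\<And>i. i < n \<Longrightarrow> finite (S i)"
proof -
  have "(\<Sum>w\<in>pwords n S. \<Prod>i<n. (1::real)) = (\<Prod>i<n. \<Sum>x\<in>S i. 1)"
    by (rule sum_pwords[where f = "\<lambda>_ _. 1"]) (rule that)
  then have "real (card (pwords n S)) = real (\<Prod>i<n. card (S i))" by simp
  then show ?thesis by (simp only: of_nat_eq_iff)
qed

text \<open>The reference is indexed by numbers, so it stores the input word through
  \<open>to_nat\<close>; there are \<open>2 ^ n\<close> input words.\<close>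

definition max_entangled :: "nat \<Rightarrow> (nat \<times> fock list) vec" where
  "max_entangled n = (\<lambda>(k, a). if a \<in> inputs n \<and> k = to_nat a then of_real (1 / sqrt (2 ^ n)) else 0)"

lemma card_words_dual_rail: "card (inputs n) = 2 ^ n"
  by (simp add: words_eq_pwords card_pwords) (simp add: dual_rail_def numeral_2_eq_2)

lemma pure_state_max_entangled: "pure_state (UNIV \<times> inputs n) (max_entangled n)"
proof -
  let ?D = "inputs n"
  have "((\<lambda>i. (cmod (max_entangled n i))\<^sup>2) has_sum 1) (UNIV \<times> ?D)"
  proof (rule has_sum_finite_neutralI[of "(\<lambda>a. (to_nat a, a)) ` ?D"])
    show "1 = (\<Sum>i\<in>(\<lambda>a. (to_nat a, a)) ` ?D. (cmod (max_entangled n i))\<^sup>2)"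
      by (subst sum.reindex)
        (auto simp: inj_on_def max_entangled_def norm_divide power_divide card_words_dual_rail)
  qed (auto simp: finite_words max_entangled_def)
  then show ?thesis
    by (auto simp: pure_state_def ell2_def max_entangled_def dest: has_sum_imp_summable)
qed

lemma input_state_max_entangled:
  assumes "a \<in> inputs n" "a' \<in> inputs n"
  shows "input_state (max_entangled n) a a' = (if a = a' then 1 / 2 ^ n else 0)"
proof (cases "a = a'")
  case True
  have "((\<lambda>k. max_entangled n (k, a) * cnj (max_entangled n (k, a))) has_sum 1 / 2 ^ n) UNIV"
  proof (rule has_sum_finite_neutralI[of "{to_nat a}"])
    have "complex_of_real (1 / sqrt (2 ^ n)) * of_real (1 / sqrt (2 ^ n)) = of_real (1 / 2 ^ n)"
      unfolding of_real_mult[symmetric] by simp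
    then show "1 / 2 ^ n = (\<Sum>k\<in>{to_nat a}. max_entangled n (k, a) * cnj (max_entangled n (k, a)))"
      using assms by (simp add: max_entangled_def)
  qed (auto simp: max_entangled_def)
  then show ?thesis using True by (simp add: input_state_def infsumI)
next
  case False
  then have "max_entangled n (k, a) * cnj (max_entangled n (k, a')) = 0" for k
    by (auto simp: max_entangled_def)
  then show ?thesis using False unfolding input_state_def by (simp only: infsum_0) simp
qed

lemma max_entangled_word_state:
  "(\<Sum>a\<in>inputs n. \<Sum>a'\<in>inputs n. input_state (max_entangled n) a a' *
      complex_of_real (\<Prod>i<n. c (a ! i) (a' ! i) (b ! i) (b' ! i)))
    = of_real (\<Prod>i<n. (\<Sum>a\<in>dual_rail. c a a (b ! i) (b' ! i)) / 2)"
proof -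
  let ?D = "inputs n"
  have "(\<Sum>a\<in>?D. \<Sum>a'\<in>?D. input_state (max_entangled n) a a' *
      complex_of_real (\<Prod>i<n. c (a ! i) (a' ! i) (b ! i) (b' ! i)))
    = (\<Sum>a\<in>?D. \<Sum>a'\<in>?D. if a = a' then complex_of_real ((\<Prod>i<n. c (a ! i) (a ! i) (b ! i) (b' ! i)) / 2 ^ n) else 0)"
    by (intro sum.cong refl) (simp add: input_state_max_entangled)
  also have "\<dots> = of_real ((\<Sum>a\<in>?D. \<Prod>i<n. c (a ! i) (a ! i) (b ! i) (b' ! i)) / 2 ^ n)"
    by (simp add: finite_words sum_divide_distrib)
  also have "(\<Sum>a\<in>?D. \<Prod>i<n. c (a ! i) (a ! i) (b ! i) (b' ! i)) = (\<Prod>i<n. \<Sum>a\<in>dual_rail. c a a (b ! i) (b' ! i))"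
    unfolding words_eq_pwords by (rule sum_pwords) simp
  finally show ?thesis by (simp add: prod_dividef)
qed

text \<open>For the maximally mixed input X is half the photon number: l / 2 on the output block.
  The environment block has l - 1 photons, so X + 1 is (l + 1) / 2 there.\<close>

definition out_eigenvalue :: "real \<Rightarrow> nat \<Rightarrow> real" where
  "out_eigenvalue r l = weight r l * real l / 2"

definition env_eigenvalue :: "real \<Rightarrow> nat \<Rightarrow> real" where
  "env_eigenvalue r l = weight r l * (real l + 1) / 2"

lemma out_coeff_mixture:
  "(\<Sum>a\<in>dual_rail. out_coeff r a a b b') / 2 = (if b = b' then out_eigenvalue r (photons b) else 0)"
proof (cases "b = b'")
  case True
  then have "(\<Sum>a\<in>dual_rail. out_coeff r a a b b') = weight r (photons b) * (real (fst b) + real (snd b))"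
    by (simp add: dual_rail_def out_coeff_def ladder_def algebra_simps)
  then show ?thesis using True by (simp add: out_eigenvalue_def photons_def)
qed (simp add: out_coeff_def)

lemma env_coeff_mixture:
  "(\<Sum>a\<in>dual_rail. env_coeff r a a e e') / 2 = (if e = e' then env_eigenvalue r (Suc (photons e)) else 0)"
proof (cases "e = e'")
  case True
  then have "(\<Sum>a\<in>dual_rail. env_coeff r a a e e') = weight r (Suc (photons e)) * (real (fst e) + real (snd e) + 2)"
    by (simp add: dual_rail_def env_coeff_def ladder_def shift_def algebra_simps)
  then show ?thesis using True by (simp add: env_eigenvalue_def photons_def algebra_simps)
qed (simp add: env_coeff_def)

lemma weight_pos:
  assumes "r > 0"
  shows "weight r l > 0"
  using assms tanh_square_less_1[of r] by (simp add: weight_def)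

text \<open>Both blocks are scalar and have the same trace, so their entropies differ by that trace
  times the logarithm of the ratio of the two eigenvalues.\<close>

lemma max_entangled_block_entropy:
  assumes r: "r > 0" and L: "L \<in> words n UNIV"
  shows "(\<Sum>k\<in>level n (map photons) L. eta (\<Prod>i<n. out_eigenvalue r (photons (k ! i))))
      - (\<Sum>e\<in>level n env_label L. eta (\<Prod>i<n. env_eigenvalue r (Suc (photons (e ! i)))))
    = (word_prob r n L) * log 2 (dim_ratio n L)"
    (is "?B - ?E = _")
proof -
  define lB lE where "lB = (\<Prod>i<n. out_eigenvalue r (L ! i))" and "lE = (\<Prod>i<n. env_eigenvalue r (L ! i))"
  define P where "P = (word_prob r n L)"
  have "?B
    = (\<Sum>k\<in>out_words n L. eta lB)"
    unfolding out_word_block[OF L] lB_def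
    by (intro sum.cong refl arg_cong[of _ _ eta] prod.cong) (auto simp: pwords_def out_block_def)
  also have "\<dots> = (\<Prod>i<n. real (L ! i) + 1) * eta lB"
    by (simp add: card_pwords card_out_block add.commute)
  also have "\<dots> = - ((\<Prod>i<n. (real (L ! i) + 1) * out_eigenvalue r (L ! i)) * log 2 lB)"
    by (simp add: eta_def prod.distrib lB_def)
  also have "(\<Prod>i<n. (real (L ! i) + 1) * out_eigenvalue r (L ! i)) = P"
    unfolding P_def by (intro prod.cong refl) (simp add: out_eigenvalue_def block_prob_def)
  finally have B: "?B = - (P * log 2 lB)" .
  have "?E
    = (\<Sum>k\<in>env_words n L. eta lE)"
    unfolding env_word_block[OF L] lE_def
    by (intro sum.cong refl arg_cong[of _ _ eta] prod.cong) (auto simp: pwords_def env_block_def)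
  also have "\<dots> = (\<Prod>i<n. real (L ! i)) * eta lE" by (simp add: card_pwords card_env_block)
  also have "\<dots> = - ((\<Prod>i<n. real (L ! i) * env_eigenvalue r (L ! i)) * log 2 lE)"
    by (simp add: eta_def prod.distrib lE_def)
  also have "(\<Prod>i<n. real (L ! i) * env_eigenvalue r (L ! i)) = P"
    unfolding P_def by (intro prod.cong refl) (simp add: env_eigenvalue_def block_prob_def)
  finally have E: "?E
    = - (P * log 2 lE)" .
  have "P * (log 2 lE - log 2 lB) = P * log 2 (dim_ratio n L)"
  proof (cases "\<exists>i<n. L ! i = 0")
    case True
    then have "P = 0" unfolding P_def by (intro prod_zero) force+
    then show ?thesis by simp
  next
    case False
    then have pos: "\<And>i. i < n \<Longrightarrow> L ! i > 0" by auto
    have l: "lB > 0" "lE > 0" unfolding lB_def lE_def using pos weight_pos[OF r]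
      by (auto intro!: prod_pos divide_pos_pos mult_pos_pos simp: out_eigenvalue_def env_eigenvalue_def)
    have "lE / lB = (dim_ratio n L)"
      unfolding lB_def lE_def prod_dividef[symmetric]
    proof (rule prod.cong[OF refl])
      fix i assume "i \<in> {..<n}"
      then show "env_eigenvalue r (L ! i) / out_eigenvalue r (L ! i) = (real (L ! i) + 1) / real (L ! i)"
        using pos[of i] weight_pos[OF r, of "L ! i"] by (simp add: out_eigenvalue_def env_eigenvalue_def)
    qed
    then show ?thesis using l by (simp add: log_divide flip: \<open>lE / lB = _\<close>)
  qed
  then show ?thesis unfolding B E P_def[symmetric] by (simp add: algebra_simps)
qed

lemma coherent_information_max_entangled:
  assumes r: "r > 0"
    and U: "isometric_extension (inputs n) (words n UNIV) UNIV U (channel_power r n)"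
  shows "coherent_information (inputs n) (words n UNIV) U (max_entangled n) = ereal (real n * capacity r)"
proof -
  let ?\<rho> = "input_state (max_entangled n)"
  have bsB: "block_spectral (words n UNIV) (map photons) (channel_power r n ?\<rho>) (\<lambda>k i. if i = k then 1 else 0)
      (\<lambda>k. \<Prod>i<n. out_eigenvalue r (photons (k ! i)))"
  proof (rule block_spectral_diagonal)
    fix b b' :: "fock list" assume b: "b \<in> words n UNIV" "b' \<in> words n UNIV"
    have "channel_power r n ?\<rho> b b' = of_real (\<Prod>i<n. if b ! i = b' ! i then out_eigenvalue r (photons (b ! i)) else 0)"
      unfolding channel_power_eq out_word_def max_entangled_word_state out_coeff_mixture ..
    then show "channel_power r n ?\<rho> b b' = (if b = b' then of_real (\<Prod>i<n. out_eigenvalue r (photons (b ! i))) else 0)"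
      by (simp only: prod_delta_words[OF b] of_real_0 split: if_split) simp
  qed (rule finite_word_blocks(1))
  have bsE: "block_spectral (words n UNIV) (env_label) (env_state r n ?\<rho>) (\<lambda>k i. if i = k then 1 else 0)
      (\<lambda>k. \<Prod>i<n. env_eigenvalue r (Suc (photons (k ! i))))"
  proof (rule block_spectral_diagonal)
    fix e e' :: "fock list" assume e: "e \<in> words n UNIV" "e' \<in> words n UNIV"
    have "env_state r n ?\<rho> e e' = of_real (\<Prod>i<n. if e ! i = e' ! i then env_eigenvalue r (Suc (photons (e ! i))) else 0)"
      unfolding env_state_eq env_word_def max_entangled_word_state env_coeff_mixture ..
    then show "env_state r n ?\<rho> e e' = (if e = e' then of_real (\<Prod>i<n. env_eigenvalue r (Suc (photons (e ! i)))) else 0)"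
      by (simp only: prod_delta_words[OF e] of_real_0 split: if_split) simp
  qed (rule finite_word_blocks(2))
  obtain H where H: "coherent_information (inputs n) (words n UNIV) U (max_entangled n) = ereal H"
    "((\<lambda>L. (\<Sum>k\<in>level n (map photons) L. eta (\<Prod>i<n. out_eigenvalue r (photons (k ! i))))
      - (\<Sum>e\<in>level n env_label L. eta (\<Prod>i<n. env_eigenvalue r (Suc (photons (e ! i))))))
      has_sum H) (words n UNIV)"
    using coherent_information_channel_power[OF r pure_state_max_entangled U bsB bsE] by blast
  from H(2) have "((\<lambda>L. (word_prob r n L) * log 2 (dim_ratio n L)) has_sum H) (words n UNIV)"
    by (rule has_sum_cong[THEN iffD1, rotated]) (rule max_entangled_block_entropy[OF r])
  then have "H = real n * capacity r" using word_information_has_sum by (rule has_sum_unique)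
  then show ?thesis using H(1) by simp
qed

subsection \<open>The quantum capacity\<close>

text \<open>The bound holds for every pure input and every extension, and the maximally entangled
  input attains it, so \<open>GREATEST\<close> is determined whatever \<open>U\<close> is
  chosen.\<close>

lemma optimized_coherent_information_channel_power:
  assumes r: "r > 0"
  shows "optimized_coherent_information (inputs n) (words n UNIV) (channel_power r n) = ereal (real n * capacity r)"
proof -
  define U where "U = (SOME U. isometric_extension (inputs n) (words n UNIV) (UNIV :: nat set) U (channel_power r n))"
  have U: "isometric_extension (inputs n) (words n UNIV) UNIV U (channel_power r n)"
    unfolding U_def
    using isometric_extension_nat_environment[OF canonical_extension_isometric, of to_nat]
    by (rule someI_ex) simp
  have "(GREATEST q. \<exists>\<phi>. pure_state (UNIV \<times> inputs n) \<phi> \<and>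
      q = coherent_information (inputs n) (words n UNIV) U \<phi>) = ereal (real n * capacity r)"
  proof (rule Greatest_equality)
    show "\<exists>\<phi>. pure_state (UNIV \<times> inputs n) \<phi> \<and>
        ereal (real n * capacity r) = coherent_information (inputs n) (words n UNIV) U \<phi>"
      using pure_state_max_entangled coherent_information_max_entangled[OF r U] by metis
    fix q assume "\<exists>\<phi>. pure_state (UNIV \<times> inputs n) \<phi> \<and>
        q = coherent_information (inputs n) (words n UNIV) U \<phi>"
    then obtain \<phi> where \<phi>: "pure_state (UNIV \<times> inputs n) \<phi>"
      and q: "q = coherent_information (inputs n) (words n UNIV) U \<phi>" by blast
    obtain u lam where bsB: "block_spectral (words n UNIV) (map photons) (out_state r n \<phi>) u lam"
      using ex_block_spectral_output by blast
    obtain w mu where bsE: "block_spectral (words n UNIV) (env_label) (env_state r n (input_state \<phi>)) w mu"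
      using ex_block_spectral_environment by blast
    show "q \<le> ereal (real n * capacity r)"
      using coherent_information_channel_power[OF r \<phi> U bsB bsE] unfolding q by (metis ereal_less_eq(3))
  qed
  then show ?thesis unfolding optimized_coherent_information_def Let_def U_def[symmetric] .
qed

lemma quantum_capacity_black_hole:
  assumes r: "r > 0"
  shows "quantum_capacity dual_rail UNIV (black_hole_channel r) = ereal (capacity r)"
  unfolding quantum_capacity_def
proof (rule limI, rule tendsto_eventually)
  \<comment> \<open>The sequence is constant from \<open>n = 1\<close> on; only the quotient at
    \<open>n = 0\<close> is a convention.\<close>
  have "ereal (real n * capacity r) / ereal (real n) = ereal (capacity r)" if "n > 0" for n
    using that by simp
  then show "\<forall>\<^sub>F n in sequentially. optimized_coherent_information (inputs n) (words n UNIV) (channel_power r n)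
      / ereal (real n) = ereal (capacity r)"
    unfolding optimized_coherent_information_channel_power[OF r]
    using eventually_gt_at_top[of 0] by (rule eventually_mono[rotated])
qed

lemma capacity_eq:
  assumes z: "z = (tanh r)\<^sup>2"
  shows "capacity r = (1 - z) ^ 3 / 2 *
    (\<Sum>\<^sub>\<infinity>l\<in>{1..}. real l * (real l + 1) * z ^ (l - 1) * log 2 ((real l + 1) / real l))"
proof -
  have "capacity r = (\<Sum>\<^sub>\<infinity>l\<in>{1..}. block_prob r l * log 2 ((real l + 1) / real l))"
    unfolding capacity_def by (rule infsum_cong_neutral) (auto simp: not_less_eq_eq)
  also have "\<dots> = (\<Sum>\<^sub>\<infinity>l\<in>{1..}. (1 - z) ^ 3 / 2 * (real l * (real l + 1) * z ^ (l - 1) * log 2 ((real l + 1) / real l)))"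
    by (intro infsum_cong) (simp add: block_prob_def weight_def z mult_ac)
  finally show ?thesis by (simp only: infsum_cmult_right')
qed

text \<open>The term \<open>l = 1\<close> is positive, as its logarithm is 1, and no term is
  negative.\<close>

lemma capacity_pos:
  assumes r: "r > 0"
  shows "capacity r > 0"
proof -
  have "0 < block_prob r 1 * log 2 ((real 1 + 1) / real 1)"
    using weight_pos[OF r, of 1] by (simp add: block_prob_def)
  also have "\<dots> = (\<Sum>l\<in>{1}. block_prob r l * log 2 ((real l + 1) / real l))" by simp
  also have "\<dots> \<le> capacity r"
    unfolding capacity_def
    by (rule finite_sum_le_infsum[OF capacity_summable])
      (auto intro!: mult_nonneg_nonneg log_ratio_bounds(1) simp del: zero_le_log_cancel_iff)
  finally show ?thesis .
qed

theorem mainTheorem1: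
  fixes \<omega> \<kappa> r z :: real
  assumes "\<omega> > 0" and "\<kappa> > 0" and "r > 0"
    and "tanh r = exp (- pi * \<omega> / \<kappa>)"
    and "z = (tanh r)\<^sup>2"
  shows "quantum_capacity dual_rail UNIV (black_hole_channel r) =
           ereal ((1 - z) ^ 3 / 2 *
             (\<Sum>\<^sub>\<infinity>l\<in>{1..}. real l * (real l + 1) * z ^ (l - 1) * log 2 ((real l + 1) / real l)))
         \<and> quantum_capacity dual_rail UNIV (black_hole_channel r) > 0"
  using quantum_capacity_black_hole[OF assms(3)] capacity_eq[OF assms(5)] capacity_pos[OF assms(3)]
  by simp

end
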